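(* Consider the three-node half-duplex relay network with channel training and decode-and-forward (DF) relaying with parallel channel coding described in the context, with parameters $m>2$, $0<\alpha<1$, $\delta_s,\delta_r\in(0,1)$, $P_s,P_r,N_0>0$ and $\sigma_{sd},\sigma_{sr},\sigma_{rd}>0$. Let $w_{sd},w_{sr},w_{rd}$ be i.i.d. $\mathcal{CN}(0,1)$ and put $$a_1=\frac{\delta_s(1-\delta_s)m^2P_s^2\sigma_{sd}^4/(1-\alpha)}{(1-\delta_s)mP_s\sigma_{sd}^2N_0/(1-\alpha)+(m-2)(\sigma_{sd}^2\delta_smP_s+N_0)N_0}|w_{sd}|^2,$$ $$c_1=\frac{\delta_s(1-\delta_s)m^2P_s^2\sigma_{sr}^4/(1-\alpha)}{(1-\delta_s)mP_s\sigma_{sr}^2N_0/(1-\alpha)+(m-2)(\sigma_{sr}^2\delta_smP_s+N_0)N_0}|w_{sr}|^2,$$ $$d_1=\frac{\delta_r(1-\delta_r)m^2P_r^2\sigma_{rd}^4/\alpha}{(1-\delta_r)mP_r\sigma_{rd}^2N_0/\alpha+(m-2)(\sigma_{rd}^2\delta_rmP_r+N_0)N_0}|w_{rd}|^2 .$$ Then the following rate (per symbol) is achievable for DF with parallel channel coding: $$I_{low}=\min\left\{E\left\{\frac{(1-\alpha)(m-2)}{m}\log(1+c_1)\right\},\ E\left\{\frac{(1-\alpha)(m-2)}{m}\log(1+a_1)+\frac{\alpha(m-2)}{m}\log(1+d_1)\right\}\right\}.$$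
   Context: Notation: $\mathcal{CN}(\mu,\sigma^2)$ denotes a proper complex Gaussian variable with mean $\mu$ and variance $\sigma^2$. $\log$ is to a fixed base (base 2 for rates in bits). Channel: a source, a relay and a destination. The source-relay, source-destination and relay-destination fading coefficients $h_{sr}\sim\mathcal{CN}(0,\sigma_{sr}^2)$, $h_{sd}\sim\mathcal{CN}(0,\sigma_{sd}^2)$, $h_{rd}\sim\mathcal{CN}(0,\sigma_{rd}^2)$ are independent, constant over blocks of $m$ symbols, and take independent realizations in different blocks. No node knows their realizations a priori. All noise samples are independent $\mathcal{CN}(0,N_0)$. Per block, the source and relay satisfy $\|\mathbf x_{s,t}\|^2+E\|\mathbf x_s\|^2\le mP_s$ and $\|\mathbf x_{r,t}\|^2+E\|\mathbf x_r\|^2\le mP_r$, where $\mathbf x_{s,t},\mathbf x_{r,t}$ are training signals and $\mathbf x_s,\mathbf x_r$ are data vectors. Training: in the first symbol of each block the source sends a pilot of energy $\delta_s mP_s$, from which the relay and destination form MMSE estimates $\hat h_{sr},\hat h_{sd}$; in the second symbol the relay sends a pilot of energy $\delta_r mP_r$, from which the destination forms the MMSE estimate $\hat h_{rd}$. For instance $\hat h_{sr}=\frac{\sigma_{sr}^2\sqrt{\delta_smP_s}}{\sigma_{sr}^2\delta_smP_s+N_0}y_{r,t}$ with $y_{r,t}=h_{sr}\sqrt{\delta_s m P_s}+n_r$, and $h_{sr}=\hat h_{sr}+\tilde h_{sr}$ with $\mathrm{var}(\tilde h_{sr})=\frac{\sigma_{sr}^2N_0}{\sigma_{sr}^2\delta_smP_s+N_0}$;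 the others are similar. Data phase (remaining $m-2$ symbols; block lengths below are assumed to be integers): the source transmits $\mathbf x_s$ of dimension $(1-\alpha)(m-2)$ while the relay listens, and then is silent while the relay transmits $\mathbf x_r$ of dimension $\alpha(m-2)$. The received signals are $\mathbf y_r=h_{sr}\mathbf x_s+\mathbf n_r$ (relay), $\mathbf y_d=h_{sd}\mathbf x_s+\mathbf n_d$ and $\mathbf y_d^r=h_{rd}\mathbf x_r+\mathbf n_d^r$ (destination). The data vectors have independent entries of equal energy with $E\{\mathbf x_s\mathbf x_s^\dagger\}=\frac{(1-\delta_s)mP_s}{(m-2)(1-\alpha)}\mathbf I$ and $E\{\mathbf x_r\mathbf x_r^\dagger\}=\frac{(1-\delta_r)mP_r}{(m-2)\alpha}\mathbf I$. DF with parallel channel coding: the relay decodes the source message from $\mathbf y_r$ and re-encodes it with an independent codebook. Achievability is in the usual sense of reliable communication with coding over many blocks, where the relay decodes with knowledge of $\hat h_{sr}$ and the destination with knowledge of $\hat h_{sd},\hat h_{rd}$. In single-letter form (mutual informations normalized per transmitted symbol), the scheme supports, up to the factor $\frac{m-2}{m}$ accounting for the two training symbols, any rate below the supremum over input distributions of $\min\{(1-\alpha)I(x_s;y_r|\hat h_{sr}),\ (1-\alpha)I(x_s;y_d|\hat h_{sd})+\alpha I(x_r;y_d^r|\hat h_{rd})\}$. *)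

theory Defs
  imports "HOL-Probability.Probability"
begin

definition cn_density :: "complex \<Rightarrow> real \<Rightarrow> complex \<Rightarrow> real" where
  "cn_density \<mu> v z = exp (- (cmod (z - \<mu>))\<^sup>2 / v) / (pi * v)"

text \<open>Law of a proper complex Gaussian with mean \<open>\<mu>\<close> and variance \<open>v > 0\<close>;
  \<open>lborel\<close> on \<^typ>\<open>complex\<close> is planar Lebesgue measure.\<close>

definition CN :: "complex \<Rightarrow> real \<Rightarrow> complex measure" where
  "CN \<mu> v = density lborel (\<lambda>z. ennreal (cn_density \<mu> v z))"

text \<open>Links: source-relay, source-destination, relay-destination.\<close>

datatype link = SR | SD | RD

record relay_net =
  block_len :: nat              \<comment> \<open>\<open>m\<close>\<close>
  relay_duty :: real            \<comment> \<open>\<open>\<alpha>\<close>\<close>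
  src_train_frac :: real        \<comment> \<open>\<open>\<delta>\<^sub>s\<close>\<close>
  rel_train_frac :: real        \<comment> \<open>\<open>\<delta>\<^sub>r\<close>\<close>
  src_power :: real             \<comment> \<open>\<open>P\<^sub>s\<close>\<close>
  rel_power :: real             \<comment> \<open>\<open>P\<^sub>r\<close>\<close>
  noise_var :: real             \<comment> \<open>\<open>N\<^sub>0\<close>\<close>
  fade_dev :: "link \<Rightarrow> real"    \<comment> \<open>\<open>\<sigma>\<close>, the square root of the fading variance\<close>

text \<open>The following quantities belong to the transmitter of the given link, so they agree on
  \<^const>\<open>SR\<close> and \<^const>\<open>SD\<close>.\<close>

fun duty :: "relay_net \<Rightarrow> link \<Rightarrow> real" where
  "duty c RD = relay_duty c"
| "duty c _ = 1 - relay_duty c"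

fun train_frac :: "relay_net \<Rightarrow> link \<Rightarrow> real" where
  "train_frac c RD = rel_train_frac c"
| "train_frac c _ = src_train_frac c"

fun tx_power :: "relay_net \<Rightarrow> link \<Rightarrow> real" where
  "tx_power c RD = rel_power c"
| "tx_power c _ = src_power c"

definition pilot_energy :: "relay_net \<Rightarrow> link \<Rightarrow> real" where
  "pilot_energy c l = train_frac c l * real (block_len c) * tx_power c l"

text \<open>Dimension of a data vector; the floor is exact when \<open>\<alpha> (m - 2)\<close> is an integer.\<close>

definition data_len :: "relay_net \<Rightarrow> link \<Rightarrow> nat" where
  "data_len c l = nat \<lfloor>duty c l * (real (block_len c) - 2)\<rfloor>"

definition symbol_energy :: "relay_net \<Rightarrow> link \<Rightarrow> real" where
  "symbol_energy c l = (1 - train_frac c l) * real (block_len c) * tx_power c l /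
     ((real (block_len c) - 2) * duty c l)"

text \<open>The independent Gaussian variables driving the channel: in block \<open>t\<close>, each link has a
  fading coefficient, a noise sample at its receiver during its pilot, and noise samples at its
  receiver during the data symbols \<open>s\<close>.  The two receivers of the source signal have separate
  noise, and no two links reaching the destination are active at the same time.\<close>

datatype rvar = Fade link nat | PilotNoise link nat | DataNoise link nat nat

fun rvar_var :: "relay_net \<Rightarrow> rvar \<Rightarrow> real" where
  "rvar_var c (Fade l t) = (fade_dev c l)\<^sup>2"
| "rvar_var c (PilotNoise l t) = noise_var c"
| "rvar_var c (DataNoise l t s) = noise_var c"

definition channel_space :: "relay_net \<Rightarrow> (rvar \<Rightarrow> complex) measure" where
  "channel_space c = Pi\<^sub>M UNIV (\<lambda>v. CN 0 (rvar_var c v))"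

definition pilot_obs :: "relay_net \<Rightarrow> link \<Rightarrow> nat \<Rightarrow> (rvar \<Rightarrow> complex) \<Rightarrow> complex" where
  "pilot_obs c l t \<omega> =
     \<omega> (Fade l t) * of_real (sqrt (pilot_energy c l)) + \<omega> (PilotNoise l t)"

definition mmse_est :: "relay_net \<Rightarrow> link \<Rightarrow> nat \<Rightarrow> (rvar \<Rightarrow> complex) \<Rightarrow> complex" where
  "mmse_est c l t \<omega> =
     of_real ((fade_dev c l)\<^sup>2 * sqrt (pilot_energy c l) /
       ((fade_dev c l)\<^sup>2 * pilot_energy c l + noise_var c)) * pilot_obs c l t \<omega>"

text \<open>What the receiver of link \<open>l\<close> gets from the \<open>n\<close> blocks of superblock \<open>j\<close> when the data
  vectors \<open>x i\<close> (\<open>i < n\<close>) are sent: the fading estimates and the received data symbols.\<close>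

type_synonym observation = "(nat \<Rightarrow> complex) \<times> (nat \<times> nat \<Rightarrow> complex)"

definition observe ::
  "relay_net \<Rightarrow> link \<Rightarrow> nat \<Rightarrow> nat \<Rightarrow> (nat \<Rightarrow> nat \<Rightarrow> complex) \<Rightarrow> (rvar \<Rightarrow> complex) \<Rightarrow> observation" where
  "observe c l n j x \<omega> =
     (\<lambda>i\<in>{..<n}. mmse_est c l (j * n + i) \<omega>,
      \<lambda>(i, s)\<in>{..<n} \<times> {..<data_len c l}.
        \<omega> (Fade l (j * n + i)) * x i s + \<omega> (DataNoise l (j * n + i) s))"

definition obs_space :: "relay_net \<Rightarrow> link \<Rightarrow> nat \<Rightarrow> observation measure" where
  "obs_space c l n =
     Pi\<^sub>M {..<n} (\<lambda>_. borel) \<Otimes>\<^sub>M Pi\<^sub>M ({..<n} \<times> {..<data_len c l}) (\<lambda>_. borel)"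

text \<open>Decode-and-forward with parallel channel coding, over \<open>B + 1\<close> superblocks of \<open>n\<close> blocks.
  The source sends message \<open>j < B\<close> in superblock \<open>j\<close>.  The relay decodes it at the end of that
  superblock and sends its own codeword for the decoded message in superblock \<open>j + 1\<close>.  The
  destination decodes message \<open>j\<close> jointly from the source signal of superblock \<open>j\<close> and the relay
  signal of superblock \<open>j + 1\<close>.  The relay is silent in superblock \<open>0\<close> and the source in
  superblock \<open>B\<close>.\<close>

record df_code =
  num_superblocks :: nat        \<comment> \<open>\<open>B\<close>\<close>
  superblock_len :: nat         \<comment> \<open>\<open>n\<close>\<close>
  num_messages :: nat           \<comment> \<open>\<open>M\<close>\<close>
  src_enc :: "nat \<Rightarrow> nat \<Rightarrow> nat \<Rightarrow> complex"   \<comment> \<open>message, block in superblock, data symbol\<close>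
  rel_enc :: "nat \<Rightarrow> nat \<Rightarrow> nat \<Rightarrow> complex"
  rel_dec :: "observation \<Rightarrow> nat"
  dst_dec :: "observation \<times> observation \<Rightarrow> nat"

text \<open>The data vectors of a codebook as random vectors, for a uniformly distributed message:
  independent entries, scaled identity as correlation matrix, and the energy constraint per
  block.\<close>

definition admissible_codebook ::
  "relay_net \<Rightarrow> link \<Rightarrow> nat \<Rightarrow> nat \<Rightarrow> (nat \<Rightarrow> nat \<Rightarrow> nat \<Rightarrow> complex) \<Rightarrow> bool" where
  "admissible_codebook c l n M enc \<longleftrightarrow>
     (let U = measure_pmf (pmf_of_set {..<M}); K = data_len c l in
      \<forall>i<n.
        prob_space.indep_vars U (\<lambda>_. borel) (\<lambda>s w. enc w i s) {..<K} \<and>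
        (\<forall>s<K. \<forall>s'<K. (LINT w|U. enc w i s * cnj (enc w i s')) =
           (if s = s' then of_real (symbol_energy c l) else 0)) \<and>
        pilot_energy c l + (LINT w|U. (\<Sum>s<K. (cmod (enc w i s))\<^sup>2))
          \<le> real (block_len c) * tx_power c l)"

definition admissible_code :: "relay_net \<Rightarrow> df_code \<Rightarrow> bool" where
  "admissible_code c C \<longleftrightarrow>
     0 < num_superblocks C \<and> 0 < superblock_len C \<and> 0 < num_messages C \<and>
     admissible_codebook c SR (superblock_len C) (num_messages C) (src_enc C) \<and>
     admissible_codebook c RD (superblock_len C) (num_messages C) (rel_enc C) \<and>
     rel_dec C \<in> obs_space c SR (superblock_len C) \<rightarrow>\<^sub>M count_space UNIV \<and>
     dst_dec C \<in> obs_space c SD (superblock_len C) \<Otimes>\<^sub>M obs_space c RD (superblock_len C)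
       \<rightarrow>\<^sub>M count_space UNIV \<and>
     (\<forall>z. rel_dec C z < num_messages C)"

text \<open>Decisions about message \<open>j\<close> when the message sequence is \<open>w\<close>.\<close>

definition relay_decision ::
  "relay_net \<Rightarrow> df_code \<Rightarrow> (nat \<Rightarrow> nat) \<Rightarrow> nat \<Rightarrow> (rvar \<Rightarrow> complex) \<Rightarrow> nat" where
  "relay_decision c C w j \<omega> =
     rel_dec C (observe c SR (superblock_len C) j (src_enc C (w j)) \<omega>)"

definition dest_decision ::
  "relay_net \<Rightarrow> df_code \<Rightarrow> (nat \<Rightarrow> nat) \<Rightarrow> nat \<Rightarrow> (rvar \<Rightarrow> complex) \<Rightarrow> nat" where
  "dest_decision c C w j \<omega> =
     dst_dec C
       (observe c SD (superblock_len C) j (src_enc C (w j)) \<omega>,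
        observe c RD (superblock_len C) (j + 1) (rel_enc C (relay_decision c C w j \<omega>)) \<omega>)"

text \<open>Probability, for independent uniform messages, that some message is decoded wrongly at the
  relay or at the destination.\<close>

definition error_prob :: "relay_net \<Rightarrow> df_code \<Rightarrow> real" where
  "error_prob c C =
     (\<Sum>w \<in> {..<num_superblocks C} \<rightarrow>\<^sub>E {..<num_messages C}.
        measure (channel_space c)
          {\<omega>. \<exists>j<num_superblocks C.
             relay_decision c C w j \<omega> \<noteq> w j \<or> dest_decision c C w j \<omega> \<noteq> w j}) /
     real (num_messages C) ^ num_superblocks C"

text \<open>Rate per channel symbol, in units given by the base \<open>b\<close> of the logarithm; all symbols are
  counted, including pilots and the additional last superblock.\<close>

definition code_rate :: "real \<Rightarrow> relay_net \<Rightarrow> df_code \<Rightarrow> real" where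
  "code_rate b c C =
     real (num_superblocks C) * log b (real (num_messages C)) /
     real ((num_superblocks C + 1) * superblock_len C * block_len c)"

definition df_achievable :: "real \<Rightarrow> relay_net \<Rightarrow> real \<Rightarrow> bool" where
  "df_achievable b c R \<longleftrightarrow>
     (\<forall>\<eta>>0. \<forall>\<epsilon>>0. \<exists>C. admissible_code c C \<and> R - \<eta> < code_rate b c C \<and> error_prob c C < \<epsilon>)"

end

theory Submission
  imports Defs "HOL-Combinatorics.Permutations" "HOL-Real_Asymp.Real_Asymp"
begin

text \<open>Random coding with a mismatched, nearest-neighbour decoding metric.  Each receiver takes its
  channel estimate \<open>h\<close> for the true coefficient and treats the estimation error times the data as
  additional Gaussian noise, which gives an effective noise variance \<open>v\<close>.  It scores a candidate
  input by the logarithm of the ratio between the Gaussian likelihood and the output density under a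
  Gaussian input of energy \<open>P\<close>.  For every input law of energy \<open>P\<close> the score of the true input has
  mean \<open>ln (1 + |h|\<^sup>2 P / v)\<close> given \<open>h\<close>, since only second moments enter.  If the exponential of the
  score of an independent input has mean at most \<open>1\<close>, then Markov's inequality for false alarms and
  Chebyshev's inequality over many blocks for misses give vanishing error below this rate.

  The last condition must hold for an input law that a finite codebook can realise exactly.
  Normalised sums of \<open>2 \<nu>\<close> random signs work: their point probabilities are bounded by a Gaussian of
  energy \<open>P (1 + 1 / (2 \<nu>))\<close>, so the output density exceeds a Gaussian one by a factor that tends to
  \<open>1\<close> as \<open>\<nu>\<close> grows.  Messages are written in base \<open>16\<^sup>\<nu>\<close> with one digit for each data symbol, and
  an independent uniformly random permutation of the messages in every block makes the code random
  while every block of every codebook keeps exactly independent symbols of the prescribed energy.\<close>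

section \<open>Gaussian-like constellations\<close>

text \<open>An admissible code needs exactly independent entries and exact second moments in every
  block under a uniform message, which a codebook with randomly drawn entries in general misses;
  this rules out the usual Gaussian ensemble. The mean score is insensitive to the shape of the
  input because every cross term of the expanded squares contains the estimation error or the noise
  as a centred factor independent of the rest; independence of estimate and error is where Gaussian
  fading enters. Inputs of different energy have different mean scores, so for a fixed code the
  scores are not centred; averaging over the permutations removes this bias. The symbols of a block
  share one fading coefficient, so Chebyshev's inequality can only work across blocks, and it costs
  fourth moments of the Gaussian variables. The parameters are fixed in the order
  \<open>\<nu>\<close> (loss of the constellation), \<open>B\<close> (loss of the extra superblock),
  \<open>n\<close> (error probability), so every bound must be uniform in what is chosen
  later.\<close>

lemma gaussian_half_integral:
  fixes a :: real
  assumes "a > 0"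
  shows "has_bochner_integral lborel (\<lambda>x. indicator {0..} x *\<^sub>R exp (- a * x\<^sup>2)) (sqrt (pi / a) / 2)"
proof -
  have s: "sqrt a > 0" "(sqrt a)\<^sup>2 = a" using assms by auto
  have "has_bochner_integral lborel (\<lambda>x. indicator {0..} (0 + sqrt a * x) *\<^sub>R exp (- (0 + sqrt a * x)\<^sup>2))
      ((sqrt pi / 2) /\<^sub>R \<bar>sqrt a\<bar>)"
    using lborel_has_bochner_integral_real_affine_iff[of "sqrt a" "\<lambda>x. indicator {0..} x *\<^sub>R exp (- x\<^sup>2)" "sqrt pi / 2" 0]
      gaussian_moment_0 s by simp
  moreover have "indicator {0..} (0 + sqrt a * x) *\<^sub>R exp (- (0 + sqrt a * x)\<^sup>2)
      = indicator {0..} x *\<^sub>R (exp (- a * x\<^sup>2) :: real)" for x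
    using s by (auto simp: indicator_def zero_le_mult_iff power_mult_distrib)
  moreover have "(sqrt pi / 2) /\<^sub>R \<bar>sqrt a\<bar> = sqrt (pi / a) / 2"
    using s by (simp add: real_sqrt_divide field_simps)
  ultimately show ?thesis by simp
qed

text \<open>The summand decreases in \<open>k\<close>, so each term is at most the integral over the
  unit interval to its left.\<close>

lemma gaussian_tail_sum_le:
  fixes a :: real
  assumes "a > 0"
  shows "(\<Sum>k=1..K. exp (- a * (real k)\<^sup>2)) \<le> sqrt (pi / a) / 2"
proof -
  let ?f = "\<lambda>x::real. indicator {0..} x *\<^sub>R exp (- a * x\<^sup>2)"
  let ?g = "\<lambda>x::real. \<Sum>k=1..K. exp (- a * (real k)\<^sup>2) * indicator {real k - 1..<real k} x"
  have g: "has_bochner_integral lborel ?g (\<Sum>k=1..K. exp (- a * (real k)\<^sup>2) * 1)"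
  proof (intro has_bochner_integral_sum has_bochner_integral_mult_right)
    fix k :: nat
    show "has_bochner_integral lborel (indicat_real {real k - 1..<real k}) 1"
      using has_bochner_integral_real_indicator[of "{real k - 1..<real k}" lborel] by simp
  qed
  have le: "?g x \<le> ?f x" for x
  proof -
    have "?g x = (\<Sum>k\<in>{k\<in>{1..K}. real k - 1 \<le> x \<and> x < real k}. exp (- a * (real k)\<^sup>2))"
      by (rule sum.mono_neutral_cong_right) (auto simp: indicator_def)
    \<comment> \<open>The unit intervals are disjoint, so at most one \<open>k\<close> contributes
      at \<open>x\<close>.\<close>
    also have "\<dots> \<le> ?f x"
    proof (cases "\<exists>k\<in>{1..K}. real k - 1 \<le> x \<and> x < real k")
      case True
      then obtain k where k: "k \<in> {1..K}" "real k - 1 \<le> x" "x < real k" by blast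
      have "j = k" if "real j - 1 \<le> x" "x < real j" for j
        using k that by linarith
      then have "{k\<in>{1..K}. real k - 1 \<le> x \<and> x < real k} = {k}"
        using k by blast
      moreover have "x \<ge> 0" using k by auto
      moreover have "a * x\<^sup>2 \<le> a * (real k)\<^sup>2"
        using assms k \<open>x \<ge> 0\<close> by (intro mult_left_mono power_mono) auto
      ultimately show ?thesis by simp
    next
      case False
      then have "{k\<in>{1..K}. real k - 1 \<le> x \<and> x < real k} = {}" by auto
      then show ?thesis by (simp only: sum.empty) (simp add: indicator_def)
    qed
    finally show ?thesis .
  qed
  have "integral\<^sup>L lborel ?g \<le> integral\<^sup>L lborel ?f"
    using g gaussian_half_integral[OF assms] le
    by (intro integral_mono) (auto simp: has_bochner_integral_iff)
  then show ?thesis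
    using has_bochner_integral_integral_eq[OF g]
      has_bochner_integral_integral_eq[OF gaussian_half_integral[OF assms]] by simp
qed

text \<open>On each side of \<open>x\<close> the distances to the grid points dominate distinct
  integers 0, 1, 2 and so on. Each side costs at most one plus half of the full integral, which is
  where the summand 2 comes from.\<close>

lemma gaussian_grid_sum_le:
  fixes a x :: real
  assumes "a > 0"
  shows "(\<Sum>k\<le>N. exp (- a * (real k - x)\<^sup>2)) \<le> 2 + sqrt (pi / a)"
proof -
  define e where "e k = exp (- a * (real k)\<^sup>2)" for k :: nat
  define L R where "L = {k. k \<le> N \<and> real k \<le> x}" and "R = {k. k \<le> N \<and> x < real k}"
  have e: "(\<Sum>k\<in>S. e k) \<le> 1 + sqrt (pi / a) / 2" if "S \<subseteq> {..K}" for S K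
  proof -
    have "(\<Sum>k\<in>S. e k) \<le> (\<Sum>k\<le>K. e k)"
      using that by (intro sum_mono2) (auto simp: e_def)
    also have "{..K} = insert 0 {1..K}" by auto
    also have "(\<Sum>k\<in>insert 0 {1..K}. e k) = 1 + (\<Sum>k=1..K. e k)"
      by (subst sum.insert) (auto simp: e_def)
    finally show ?thesis using gaussian_tail_sum_le[OF assms, of K] by (simp add: e_def)
  qed
  have fin: "finite L" "finite R" by (auto simp: L_def R_def)
  have mono: "exp (- a * t\<^sup>2) \<le> e k" if "real k \<le> \<bar>t\<bar>" for t k
    using that assms power_mono[of "real k" "\<bar>t\<bar>" 2] by (simp add: e_def)
  have L: "(\<Sum>k\<in>L. exp (- a * (real k - x)\<^sup>2)) \<le> 1 + sqrt (pi / a) / 2"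
  proof -
    \<comment> \<open>For negative \<open>x\<close> the set \<open>L\<close> is empty and the value
      0 produced by \<open>nat\<close> is harmless.\<close>
    define j where "j = nat \<lfloor>x\<rfloor>"
    have kj: "k \<le> j" if "k \<in> L" for k
      using that by (simp add: L_def j_def le_nat_iff le_floor_iff)
    have jx: "real j \<le> x" if "k \<in> L" for k
    proof -
      have "0 \<le> x" using that unfolding L_def by (smt (verit) mem_Collect_eq of_nat_0_le_iff)
      then show ?thesis by (simp add: j_def)
    qed
    have "(\<Sum>k\<in>L. exp (- a * (real k - x)\<^sup>2)) \<le> (\<Sum>k\<in>L. e (j - k))"
      using kj jx by (intro sum_mono mono) (force simp: of_nat_diff)
    also have "\<dots> = (\<Sum>k\<in>(\<lambda>k. j - k) ` L. e k)"
      using kj by (subst sum.reindex) (auto simp: inj_on_def o_def, metis diff_diff_cancel)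
    also have "\<dots> \<le> 1 + sqrt (pi / a) / 2" by (rule e[of _ j]) auto
    finally show ?thesis .
  qed
  have R: "(\<Sum>k\<in>R. exp (- a * (real k - x)\<^sup>2)) \<le> 1 + sqrt (pi / a) / 2"
  proof (cases "R = {}")
    case True
    then show ?thesis using assms by simp
  next
    case False
    \<comment> \<open>\<open>Min\<close> covers negative \<open>x\<close> as well, where the grid
      may start well to the right of \<open>x\<close>.\<close>
    define j where "j = Min R"
    have j: "j \<in> R" "\<And>k. k \<in> R \<Longrightarrow> j \<le> k" using False fin by (auto simp: j_def)
    have "(\<Sum>k\<in>R. exp (- a * (real k - x)\<^sup>2)) \<le> (\<Sum>k\<in>R. e (k - j))"
      using j by (intro sum_mono mono) (auto simp: of_nat_diff R_def)
    also have "\<dots> = (\<Sum>k\<in>(\<lambda>k. k - j) ` R. e k)"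
      using j by (subst sum.reindex) (auto simp: inj_on_def o_def eq_diff_iff)
    also have "\<dots> \<le> 1 + sqrt (pi / a) / 2" by (rule e[of _ N]) (auto simp: R_def)
    finally show ?thesis .
  qed
  have "{..N} = L \<union> R" "L \<inter> R = {}" by (auto simp: L_def R_def)
  then have "(\<Sum>k\<le>N. exp (- a * (real k - x)\<^sup>2))
      = (\<Sum>k\<in>L. exp (- a * (real k - x)\<^sup>2)) + (\<Sum>k\<in>R. exp (- a * (real k - x)\<^sup>2))"
    using fin by (simp add: sum.union_disjoint)
  then show ?thesis using L R by simp
qed

section \<open>Central binomial coefficients and their Gaussian majorant\<close>

lemma one_minus_le_exp_ratio:
  fixes a :: real
  assumes "a \<ge> 0"
  shows "1 - a \<le> (1 + a) * exp (- 2 * a)"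
proof -
  \<comment> \<open>The difference of the two sides vanishes at 0 and is nondecreasing, since its
    derivative is \<open>1 - (1 + 2 * x) * exp (- 2 * x)\<close>.\<close>
  have "(1 + 0) * exp (- 2 * 0) - 1 + 0 \<le> (1 + a) * exp (- 2 * a) - 1 + a"
  proof (rule DERIV_nonneg_imp_nondecreasing[OF assms])
    fix x :: real
    assume "0 \<le> x"
    have "((\<lambda>a. (1 + a) * exp (- 2 * a) - 1 + a) has_real_derivative
        1 - (1 + 2 * x) * exp (- 2 * x)) (at x)"
      by (auto intro!: derivative_eq_intros simp: algebra_simps)
    moreover have "(1 + 2 * x) * exp (- 2 * x) \<le> exp (2 * x) * exp (- 2 * x)"
      by (intro mult_right_mono exp_ge_add_one_self) auto
    ultimately show "\<exists>y. ((\<lambda>a. (1 + a) * exp (- 2 * a) - 1 + a) has_real_derivative y) (at x) \<and> 0 \<le> y"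
      by (intro exI[of _ "1 - (1 + 2 * x) * exp (- 2 * x)"]) (simp add: exp_minus)
  qed
  then show ?thesis by simp
qed

text \<open>Consecutive coefficients have the ratio \<open>(\<nu> - j) / (\<nu> + j + 1)\<close>.
  With \<open>c = \<nu> + 1 / 2\<close> and \<open>a = (j + 1 / 2) / c\<close> this is exactly
  \<open>(1 - a) / (1 + a)\<close>, hence at most \<open>exp (- 2 * a)\<close>, and the exponents
  \<open>(2 * j + 1) / c\<close> add up to \<open>j\<^sup>2 / c\<close>. The half in
  \<open>c\<close> is the origin of the correction in \<open>wide_energy\<close>.\<close>

lemma central_binomial_gaussian_bound:
  assumes "\<nu> > 0"
  shows "real (2 * \<nu> choose k)
    \<le> real (2 * \<nu> choose \<nu>) * exp (- ((real k - real \<nu>)\<^sup>2 / (real \<nu> + 1 / 2)))"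
proof -
  define c where "c = real \<nu> + 1 / 2"
  have c: "c > 0" by (simp add: c_def)
  have up: "real (2 * \<nu> choose (\<nu> + j)) \<le> real (2 * \<nu> choose \<nu>) * exp (- ((real j)\<^sup>2 / c))" for j
  proof (induction j)
    case (Suc j)
    show ?case
    proof (cases "j < \<nu>")
      case False
      then show ?thesis by (simp add: binomial_eq_0)
    next
      case True
      define a where "a = (real j + 1 / 2) / c"
      have a: "a \<ge> 0" using c by (simp add: a_def)
      have "Suc (\<nu> + j) * (2 * \<nu> choose Suc (\<nu> + j)) = (2 * \<nu> - (\<nu> + j)) * (2 * \<nu> choose (\<nu> + j))"
        by (rule binomial_absorb_comp[symmetric, THEN trans[rotated]])
           (metis Suc_times_binomial_add binomial_absorb_comp binomial_absorption mult.commute)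
      then have "real (Suc (\<nu> + j)) * real (2 * \<nu> choose Suc (\<nu> + j))
          = (real \<nu> - real j) * real (2 * \<nu> choose (\<nu> + j))"
        using True by (metis (no_types, lifting) add_diff_cancel_left diff_diff_left mult_2 of_nat_diff of_nat_mult order_less_imp_le)
      moreover have "c * a = real j + 1 / 2" using c by (simp add: a_def)
      then have "real (Suc (\<nu> + j)) = c * (1 + a)" "real \<nu> - real j = c * (1 - a)"
        by (simp_all add: distrib_left right_diff_distrib) (simp_all add: c_def)
      ultimately have "(1 + a) * real (2 * \<nu> choose Suc (\<nu> + j)) = (1 - a) * real (2 * \<nu> choose (\<nu> + j))"
        using c by simp
      also have "\<dots> \<le> ((1 + a) * exp (- 2 * a)) * real (2 * \<nu> choose (\<nu> + j))"
        by (intro mult_right_mono one_minus_le_exp_ratio a) auto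
      also have "\<dots> \<le> ((1 + a) * exp (- 2 * a)) * (real (2 * \<nu> choose \<nu>) * exp (- ((real j)\<^sup>2 / c)))"
        using a Suc.IH by (intro mult_left_mono) auto
      finally have "real (2 * \<nu> choose Suc (\<nu> + j))
          \<le> real (2 * \<nu> choose \<nu>) * (exp (- 2 * a) * exp (- ((real j)\<^sup>2 / c)))"
        using a by (simp add: mult.assoc mult.left_commute)
      also have "exp (- 2 * a) * exp (- ((real j)\<^sup>2 / c)) = exp (- ((real (Suc j))\<^sup>2 / c))"
        using c by (simp add: exp_add[symmetric] a_def field_simps power2_eq_square)
      finally show ?thesis by simp
    qed
  qed simp
  show ?thesis
  \<comment> \<open>Symmetry about \<open>\<nu>\<close> reduces the lower half to the upper
    one.\<close>
  proof (cases "k \<ge> \<nu>")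
    case True
    then show ?thesis using up[of "k - \<nu>"] by (simp add: c_def)
  next
    case False
    then have "2 * \<nu> choose k = 2 * \<nu> choose (\<nu> + (\<nu> - k))"
      by (subst binomial_symmetric) (auto intro!: arg_cong[where f="\<lambda>x. 2 * \<nu> choose x"])
    moreover have "(real \<nu> - real k)\<^sup>2 = (real k - real \<nu>)\<^sup>2" by (simp add: power2_commute)
    ultimately show ?thesis using False up[of "\<nu> - k"] by (simp add: c_def of_nat_diff)
  qed
qed

text \<open>Probability that \<open>2 * \<nu>\<close> fair signs cancel; the height of the Gaussian
  majorant.\<close>

definition central_prob :: "nat \<Rightarrow> real" where
  "central_prob \<nu> = real (2 * \<nu> choose \<nu>) / 4 ^ \<nu>"

lemma central_prob_pos: "central_prob \<nu> > 0"
  by (simp add: central_prob_def)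

text \<open>Each step multiplies the probability by
  \<open>(2 * \<nu> + 1) / (2 * \<nu> + 2)\<close>, and the squares telescope against the factors of
  Wallis' product. Its limit then gives the asymptotics without Stirling's formula.\<close>

lemma central_prob_wallis:
  "(central_prob \<nu>)\<^sup>2 * (2 * real \<nu> + 1) * (\<Prod>k=1..\<nu>. (4*real k^2) / (4*real k^2 - 1)) = 1"
proof (induction \<nu>)
  case 0
  then show ?case by (simp add: central_prob_def)
next
  case (Suc \<nu>)
  have bs: "real (Suc \<nu>) * real (2 * Suc \<nu> choose Suc \<nu>) = 2 * (2 * real \<nu> + 1) * real (2 * \<nu> choose \<nu>)"
  proof -
    have 1: "Suc \<nu> * (2 * Suc \<nu> choose Suc \<nu>) = (2 * Suc \<nu>) * (Suc (2 * \<nu>) choose \<nu>)"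
      using Suc_times_binomial_eq[of "Suc (2 * \<nu>)" \<nu>] by (simp add: mult.commute)
    have 2: "Suc \<nu> * (Suc (2 * \<nu>) choose \<nu>) = Suc (2 * \<nu>) * (2 * \<nu> choose \<nu>)"
      using Suc_times_binomial_eq[of "2 * \<nu>" \<nu>] binomial_symmetric[of \<nu> "Suc (2 * \<nu>)"]
      by (simp add: mult.commute)
    from 1 2 have "Suc \<nu> * (2 * Suc \<nu> choose Suc \<nu>) = 2 * (Suc (2 * \<nu>) * (2 * \<nu> choose \<nu>))"
      by (metis mult.assoc)
    then have "real (Suc \<nu>) * real (2 * Suc \<nu> choose Suc \<nu>)
        = 2 * (real (Suc (2 * \<nu>)) * real (2 * \<nu> choose \<nu>))"
      by (metis of_nat_mult of_nat_numeral)
    moreover have "real (Suc (2 * \<nu>)) = 2 * real \<nu> + 1" by simp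
    ultimately show ?thesis by (simp only: mult.assoc)
  qed
  have step: "central_prob (Suc \<nu>) = central_prob \<nu> * ((2 * real \<nu> + 1) / (2 * (real \<nu> + 1)))"
  proof -
    define X Y where "X = real (2 * Suc \<nu> choose Suc \<nu>)" and "Y = real (2 * \<nu> choose \<nu>)"
    have "X = Y * (2 * (2 * real \<nu> + 1) / (real \<nu> + 1))"
      using bs unfolding X_def[symmetric] Y_def[symmetric] by (simp add: field_simps)
    moreover have alg: "y * (2 * u / z) / (4 * p) = y / p * (u / (2 * z))" for y u z p :: real by (simp add: mult_ac)
    ultimately show ?thesis
      unfolding central_prob_def X_def[symmetric] Y_def[symmetric] power_Suc
      by (simp only:)
  qed
  define c P x y z where "c = central_prob \<nu>"
    and "P = (\<Prod>k=1..\<nu>. (4*real k^2) / (4*real k^2 - 1))"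
    and "x = 2 * real \<nu> + 1" and "y = 2 * real \<nu> + 3" and "z = real \<nu> + 1"
  have nz: "x \<noteq> 0" "y \<noteq> 0" "z \<noteq> 0" unfolding x_def y_def z_def by linarith+
  have "4 * (real (Suc \<nu>))\<^sup>2 - 1 = x * y" "real (Suc \<nu>) = z" "2 * z + 1 = y"
    by (simp_all add: algebra_simps power2_eq_square x_def y_def z_def)
  then have p: "(\<Prod>k=1..Suc \<nu>. (4*real k^2) / (4*real k^2 - 1)) = P * (4 * z\<^sup>2 / (x * y))"
    and y: "2 * real (Suc \<nu>) + 1 = y"
    by (simp_all add: P_def del: of_nat_Suc)
  have "(c * (x / (2 * z)))\<^sup>2 * y * (P * (4 * z\<^sup>2 / (x * y))) = c\<^sup>2 * x * P"
    using nz by (simp add: power2_eq_square field_simps)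
  then show ?case
    using Suc.IH step unfolding p y by (simp add: c_def P_def x_def z_def)
qed

text \<open>The same \<open>\<nu> + 1 / 2\<close> as in the exponent of the majorant, so the total
  mass of the majorant tends to 1.\<close>

lemma central_prob_limit: "(\<lambda>\<nu>. central_prob \<nu> * sqrt (pi * (real \<nu> + 1 / 2))) \<longlonglongrightarrow> 1"
proof -
  let ?W = "\<lambda>\<nu>. \<Prod>k=1..\<nu>. (4*real k^2) / (4*real k^2 - 1)"
  have "(\<lambda>\<nu>. sqrt (pi / 2 / ?W \<nu>)) \<longlonglongrightarrow> sqrt (pi / 2 / (pi / 2))"
    by (intro tendsto_real_sqrt tendsto_divide tendsto_const wallis) auto
  moreover have "sqrt (pi / 2 / ?W \<nu>) = central_prob \<nu> * sqrt (pi * (real \<nu> + 1 / 2))" for \<nu>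
  proof -
    have "?W \<nu> \<noteq> 0" using central_prob_wallis[of \<nu>] by (metis mult_zero_right zero_neq_one)
    then have "1 / ?W \<nu> = (central_prob \<nu>)\<^sup>2 * (2 * real \<nu> + 1)"
      using central_prob_wallis[of \<nu>] by (simp add: field_simps)
    then have "pi / 2 / ?W \<nu> = (central_prob \<nu>)\<^sup>2 * (pi * (real \<nu> + 1 / 2))"
      unfolding divide_inverse by simp
    then show ?thesis using central_prob_pos[of \<nu>] by (simp add: real_sqrt_mult)
  qed
  ultimately show ?thesis by simp
qed

lemma central_prob_tendsto_0: "central_prob \<longlonglongrightarrow> 0"
proof -
  have "(\<lambda>\<nu>. central_prob \<nu> * sqrt (pi * (real \<nu> + 1 / 2)) * (1 / sqrt (pi * (real \<nu> + 1 / 2)))) \<longlonglongrightarrow> 1 * 0"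
    by (intro tendsto_mult central_prob_limit) real_asymp
  moreover have "sqrt (pi * (real \<nu> + 1 / 2)) \<noteq> 0" for \<nu>
    by (simp add: add_nonneg_eq_0_iff)
  ultimately show ?thesis by simp
qed

section \<open>Binary digits and sums of random signs\<close>

lemma sum_mod_div:
  fixes F :: "nat \<Rightarrow> nat \<Rightarrow> 'a::comm_monoid_add"
  assumes "q > 0"
  shows "(\<Sum>u<q * L. F (u mod q) (u div q)) = (\<Sum>d<q. \<Sum>u<L. F d u)"
  unfolding sum.cartesian_product
proof (rule sum.reindex_bij_witness[of _ "\<lambda>(d, u). d + q * u" "\<lambda>u. (u mod q, u div q)"], goal_cases)
  case (4 a)
  then obtain d u where a: "a = (d, u)" "d < q" "u < L" by auto
  have "d + q * u < q * Suc u" using a by simp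
  also have "\<dots> \<le> q * L" using a by (intro mult_le_mono2) simp
  finally show ?case using a by simp
qed (use assms in \<open>auto simp: less_mult_imp_div_less mult.commute\<close>)

text \<open>Reads the lowest \<open>N\<close> binary digits of \<open>d\<close> as signs, so a
  uniform \<open>d\<close> below \<open>2 ^ N\<close> gives the endpoint of a simple random
  walk.\<close>

primrec sign_sum :: "nat \<Rightarrow> nat \<Rightarrow> real" where
  "sign_sum 0 d = 0"
| "sign_sum (Suc N) d = (if even d then 1 else - 1) + sign_sum N (d div 2)"

lemma sum_sign_sum_Suc:
  fixes H :: "real \<Rightarrow> real"
  shows "(\<Sum>d<2 ^ Suc N. H (sign_sum (Suc N) d))
    = (\<Sum>d<2 ^ N. H (sign_sum N d + 1)) + (\<Sum>d<2 ^ N. H (sign_sum N d - 1))"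
proof -
  have "(\<Sum>d<2 * 2 ^ N. H (sign_sum (Suc N) d))
      = (\<Sum>d<2 * 2 ^ N. H ((if d mod 2 = 0 then 1 else - 1) + sign_sum N (d div 2)))"
    by (intro sum.cong refl) (simp add: even_iff_mod_2_eq_zero)
  also have "\<dots> = (\<Sum>b<2::nat. \<Sum>d<2 ^ N. H ((if b = 0 then 1 else - 1) + sign_sum N d))"
    by (rule sum_mod_div[where F="\<lambda>b d. H ((if b = 0 then 1 else - 1) + sign_sum N d)"]) simp
  finally show ?thesis by (simp add: numeral_2_eq_2 add.commute)
qed

text \<open>Here \<open>k\<close> counts the plus signs. Splitting off one sign shifts the argument
  of \<open>H\<close> by one either way and leads to Pascal's rule.\<close>

lemma sum_sign_sum:
  fixes H :: "real \<Rightarrow> real"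
  shows "(\<Sum>d<2 ^ N. H (sign_sum N d)) = (\<Sum>k\<le>N. real (N choose k) * H (2 * real k - real N))"
proof (induction N arbitrary: H)
  case (Suc N)
  let ?h = "\<lambda>k. H (2 * real k - real (Suc N))"
  have "(\<Sum>d<2 ^ Suc N. H (sign_sum (Suc N) d))
      = (\<Sum>k\<le>N. real (N choose k) * ?h (Suc k)) + (\<Sum>k\<le>N. real (N choose k) * ?h k)"
  proof -
    have "2 * real k - real N + 1 = 2 * real (Suc k) - real (Suc N)"
      "2 * real k - real N - 1 = 2 * real k - real (Suc N)" for k by simp_all
    then show ?thesis
      unfolding sum_sign_sum_Suc Suc.IH[of "\<lambda>x. H (x + 1)"] Suc.IH[of "\<lambda>x. H (x - 1)"] by (simp only:)
  qed
  also have "(\<Sum>k\<le>N. real (N choose k) * ?h k) = ?h 0 + (\<Sum>k\<le>N. real (N choose Suc k) * ?h (Suc k))"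
  proof -
    have "(\<Sum>k\<le>N. real (N choose k) * ?h k) = (\<Sum>k\<le>Suc N. real (N choose k) * ?h k)" by simp
    also have "\<dots> = real (N choose 0) * ?h 0 + (\<Sum>k\<le>N. real (N choose Suc k) * ?h (Suc k))"
      by (rule sum.atMost_Suc_shift)
    finally show ?thesis by simp
  qed
  also have "(\<Sum>k\<le>N. real (N choose k) * ?h (Suc k)) + (?h 0 + (\<Sum>k\<le>N. real (N choose Suc k) * ?h (Suc k)))
      = real (Suc N choose 0) * ?h 0 + (\<Sum>k\<le>N. real (Suc N choose Suc k) * ?h (Suc k))"
    by (simp add: sum.distrib algebra_simps)
  also have "\<dots> = (\<Sum>k\<le>Suc N. real (Suc N choose k) * ?h k)"
    by (rule sum.atMost_Suc_shift[symmetric])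
  finally show ?case .
qed simp

lemma sum_sign_sum_mean: "(\<Sum>d<2 ^ N. sign_sum N d) = 0"
proof (induction N)
  case (Suc N)
  then show ?case using sum_sign_sum_Suc[of "\<lambda>x. x" N] by (simp add: sum.distrib sum_subtractf)
qed simp

lemma sum_sign_sum_square: "(\<Sum>d<2 ^ N. (sign_sum N d)\<^sup>2) = real N * 2 ^ N"
proof (induction N)
  case (Suc N)
  have "(x + 1)\<^sup>2 + (x - 1)\<^sup>2 = 2 * x\<^sup>2 + 2" for x :: real
    by (simp add: power2_eq_square algebra_simps)
  then have "(\<Sum>d<2 ^ Suc N. (sign_sum (Suc N) d)\<^sup>2) = (\<Sum>d<2 ^ N. 2 * (sign_sum N d)\<^sup>2 + 2)"
    using sum_sign_sum_Suc[of "\<lambda>x. x\<^sup>2" N] by (simp add: sum.distrib[symmetric])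
  then show ?case by (simp add: sum.distrib sum_distrib_left[symmetric] Suc.IH algebra_simps)
qed simp

text \<open>In grid units the majorant has the exponent \<open>r\<^sup>2 / (\<nu> + 1 / 2)\<close>;
  the grid spacing \<open>sqrt (E / \<nu>)\<close> turns this into the energy
  \<open>E * (\<nu> + 1 / 2) / \<nu>\<close>.\<close>

definition wide_energy :: "real \<Rightarrow> nat \<Rightarrow> real" where
  "wide_energy E \<nu> = E * (1 + 1 / (2 * real \<nu>))"

text \<open>Factor per real coordinate by which the output likelihood averaged over the
  constellation may exceed that of a Gaussian input. The first summand tends to 1; the second is the
  additive 2 of the grid sum, rescaled with \<open>1 + z = G / v\<close>.\<close>

definition qam_slack :: "nat \<Rightarrow> real \<Rightarrow> real" where
  "qam_slack \<nu> z = central_prob \<nu> * (sqrt (pi * (real \<nu> + 1 / 2)) + 2 * sqrt (1 + z))"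

text \<open>Half the sign sum is an integer between \<open>- \<nu>\<close> and \<open>\<nu>\<close>
  of variance \<open>\<nu> / 2\<close>, so each real coordinate receives the energy
  \<open>E / 2\<close>.\<close>

definition pam :: "real \<Rightarrow> nat \<Rightarrow> nat \<Rightarrow> real" where
  "pam E \<nu> d = sqrt (E / real \<nu>) * (sign_sum (2 * \<nu>) d / 2)"

lemma wide_energy_pos: "E > 0 \<Longrightarrow> wide_energy E \<nu> > 0"
  by (simp add: wide_energy_def add_pos_nonneg)

text \<open>Once the binomial weights are replaced by their majorant, input and noise Gaussian
  multiply to a Gaussian of the output times one of the input, and the grid bound sums the
  latter.\<close>

lemma pam_gaussian_sum_le:
  fixes g t :: real
  assumes "\<nu> > 0" "E > 0" "v > 0"
  defines "G \<equiv> g\<^sup>2 * wide_energy E \<nu> + v"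
  shows "(\<Sum>d<4 ^ \<nu>. exp (- ((t - g * pam E \<nu> d)\<^sup>2 / v)))
    \<le> 4 ^ \<nu> * qam_slack \<nu> (g\<^sup>2 * wide_energy E \<nu> / v) * (sqrt (v / G) * exp (- (t\<^sup>2 / G)))"
proof -
  define W where "W = wide_energy E \<nu>"
  define l where "l = sqrt (E / real \<nu>)"
  \<comment> \<open>\<open>a\<close> and \<open>x\<close> describe the Gaussian of the input given
    the output \<open>t\<close>, its sharpness and its centre in grid steps.\<close>
  define a where "a = l\<^sup>2 * (G / (v * W))"
  define x where "x = g * W * t / (G * l)"
  have W: "W > 0" using assms by (simp add: W_def wide_energy_pos)
  have l: "l > 0" "l\<^sup>2 = E / real \<nu>" using assms by (simp_all add: l_def)
  have G: "G > 0" using W assms by (simp add: G_def W_def[symmetric] add_nonneg_pos)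
  have a: "a > 0" using l G W assms by (simp add: a_def)
  have G1: "1 + g\<^sup>2 * W / v = G / v" using assms by (simp add: G_def W_def[symmetric] field_simps)
  have lW: "l\<^sup>2 / W * (real \<nu> + 1 / 2) = 1"
  proof -
    have "W * real \<nu> = E * (real \<nu> + 1 / 2)"
      using assms(1) by (simp add: W_def wide_energy_def field_simps)
    then have "l\<^sup>2 / W * (real \<nu> + 1 / 2) = W * real \<nu> / (W * real \<nu>)" by (simp add: l mult.commute)
    also have "\<dots> = 1" using W assms(1) by simp
    finally show ?thesis .
  qed
  then have al: "a * (real \<nu> + 1 / 2) = G / v"
  proof -
    have "a * (real \<nu> + 1 / 2) = (l\<^sup>2 / W * (real \<nu> + 1 / 2)) * (G / v)"
      by (simp add: a_def mult_ac)
    then show ?thesis unfolding lW by simp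
  qed
  have square: "- (r\<^sup>2 / (real \<nu> + 1 / 2)) - (t - g * (l * r))\<^sup>2 / v = - (t\<^sup>2 / G) - a * (r - x)\<^sup>2" for r
  proof -
    have "r\<^sup>2 / (real \<nu> + 1 / 2) = r\<^sup>2 * (l\<^sup>2 / W)"
    proof -
      have "real \<nu> + 1 / 2 \<noteq> 0" by linarith
      then have "l\<^sup>2 / W = 1 / (real \<nu> + 1 / 2)" by (subst nonzero_eq_divide_eq) (use lW in auto)
      then show ?thesis by (simp only: mult_1_right times_divide_eq_right)
    qed
    then have "r\<^sup>2 / (real \<nu> + 1 / 2) = (l * r)\<^sup>2 / W" by (simp add: power_mult_distrib)
    moreover have "a * (r - x)\<^sup>2 = G / (v * W) * (l * r - g * W * t / G)\<^sup>2"
    proof -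
      have "a * (r - x)\<^sup>2 = G / (v * W) * (l * (r - x))\<^sup>2" by (simp add: a_def power_mult_distrib)
      also have "l * (r - x) = l * r - g * W * t / G" using l by (simp add: x_def right_diff_distrib)
      finally show ?thesis .
    qed
    moreover have "- (b\<^sup>2 / W) - (t - g * b)\<^sup>2 / v = - (t\<^sup>2 / G) - G / (v * W) * (b - g * W * t / G)\<^sup>2" for b
    proof -
      \<comment> \<open>Completing the square with the denominators cleared; it rests on
        \<open>G = g\<^sup>2 * W + v\<close>.\<close>
      have poly: "b\<^sup>2 * (v * G) + (t - g * b)\<^sup>2 * (W * G) - t\<^sup>2 * (v * W) = (G * b - g * W * t)\<^sup>2"
        unfolding G_def W_def[symmetric] by algebra
      have "b\<^sup>2 / W + (t - g * b)\<^sup>2 / v - t\<^sup>2 / G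
          = (b\<^sup>2 * (v * G) + (t - g * b)\<^sup>2 * (W * G) - t\<^sup>2 * (v * W)) / (v * W * G)"
        using G W assms(3) by (simp add: add_divide_distrib diff_divide_distrib)
      also have "\<dots> = (G * (b - g * W * t / G))\<^sup>2 / (v * W * G)"
        using G unfolding poly by (simp add: right_diff_distrib)
      also have "\<dots> = G / (v * W) * (b - g * W * t / G)\<^sup>2"
        using G by (simp add: power2_eq_square)
      finally show ?thesis by simp
    qed
    ultimately show ?thesis by simp
  qed
  have "(\<Sum>d<4 ^ \<nu>. exp (- ((t - g * pam E \<nu> d)\<^sup>2 / v)))
      = (\<Sum>d<2 ^ (2 * \<nu>). exp (- ((t - g * (l * (sign_sum (2 * \<nu>) d / 2)))\<^sup>2 / v)))"
    by (simp add: power_mult pam_def l_def)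
  also have "\<dots> = (\<Sum>k\<le>2 * \<nu>. real (2 * \<nu> choose k) * exp (- ((t - g * (l * (real k - real \<nu>)))\<^sup>2 / v)))"
    by (subst sum_sign_sum) (simp add: diff_divide_distrib)
  also have "\<dots> \<le> (\<Sum>k\<le>2 * \<nu>. real (2 * \<nu> choose \<nu>) * exp (- ((real k - real \<nu>)\<^sup>2 / (real \<nu> + 1 / 2)))
      * exp (- ((t - g * (l * (real k - real \<nu>)))\<^sup>2 / v)))"
    by (intro sum_mono mult_right_mono central_binomial_gaussian_bound assms) simp
  also have "\<dots> = (\<Sum>k\<le>2 * \<nu>. real (2 * \<nu> choose \<nu>) * exp (- (t\<^sup>2 / G)) * exp (- a * (real k - (real \<nu> + x))\<^sup>2))"
    using square by (simp add: mult.assoc exp_add[symmetric] diff_diff_eq)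
  also have "\<dots> \<le> real (2 * \<nu> choose \<nu>) * exp (- (t\<^sup>2 / G)) * (2 + sqrt (pi / a))"
    unfolding sum_distrib_left[symmetric] by (intro mult_left_mono gaussian_grid_sum_le a) simp
  \<comment> \<open>From \<open>a * (\<nu> + 1 / 2) = G / v\<close>, the width of the input Gaussian
    carries the factor \<open>sqrt (v / G)\<close> that normalises the output.\<close>
  also have "2 + sqrt (pi / a) = (2 * sqrt (G / v) + sqrt (pi * (real \<nu> + 1 / 2))) * sqrt (v / G)"
  proof -
    have half: "real \<nu> + 1 / 2 = G / v / a" using al a by (metis less_irrefl nonzero_mult_div_cancel_left)
    have "pi / a = pi * (real \<nu> + 1 / 2) * (v / G)" unfolding half using G assms(3) by simp
    then have "sqrt (pi / a) = sqrt (pi * (real \<nu> + 1 / 2)) * sqrt (v / G)"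
      by (simp only: real_sqrt_mult)
    moreover have "sqrt (G / v) * sqrt (v / G) = 1"
      unfolding real_sqrt_mult[symmetric] using G assms(3) by simp
    ultimately show ?thesis by (simp add: distrib_right)
  qed
  also have "real (2 * \<nu> choose \<nu>) = 4 ^ \<nu> * central_prob \<nu>" by (simp add: central_prob_def)
  finally show ?thesis
    unfolding qam_slack_def W_def[symmetric] G1 by (simp add: mult_ac add.commute)
qed

section \<open>Complex constellations and the decoding metric\<close>

definition qam :: "real \<Rightarrow> nat \<Rightarrow> nat \<Rightarrow> complex" where
  "qam E \<nu> d = Complex (pam E \<nu> (d mod 4 ^ \<nu>)) (pam E \<nu> (d div 4 ^ \<nu>))"

lemma sum_qam:
  "(\<Sum>d<16 ^ \<nu>. F (qam E \<nu> d)) = (\<Sum>d<4 ^ \<nu>. \<Sum>e<4 ^ \<nu>. F (Complex (pam E \<nu> d) (pam E \<nu> e)))"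
  using sum_mod_div[of "4 ^ \<nu>" "\<lambda>d e. F (Complex (pam E \<nu> d) (pam E \<nu> e))" "4 ^ \<nu>"]
  by (simp add: qam_def power_mult_distrib[symmetric])

lemma pam_moments:
  assumes "\<nu> > 0" "E > 0"
  shows "(\<Sum>d<4 ^ \<nu>. pam E \<nu> d) = 0" "(\<Sum>d<4 ^ \<nu>. (pam E \<nu> d)\<^sup>2) = 4 ^ \<nu> * (E / 2)"
proof -
  show "(\<Sum>d<4 ^ \<nu>. pam E \<nu> d) = 0"
    using sum_sign_sum_mean[of "2 * \<nu>"]
    by (simp add: pam_def power_mult sum_distrib_left[symmetric] sum_divide_distrib[symmetric])
  have "(\<Sum>d<4 ^ \<nu>. (pam E \<nu> d)\<^sup>2) = E / real \<nu> / 4 * (\<Sum>d<2 ^ (2 * \<nu>). (sign_sum (2 * \<nu>) d)\<^sup>2)"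
    using assms by (simp add: pam_def power_mult power_mult_distrib power_divide sum_distrib_left)
  also have "\<dots> = 4 ^ \<nu> * (E / 2)"
    using assms unfolding sum_sign_sum_square by (simp add: power_mult)
  finally show "(\<Sum>d<4 ^ \<nu>. (pam E \<nu> d)\<^sup>2) = 4 ^ \<nu> * (E / 2)" .
qed

lemma qam_mean:
  assumes "\<nu> > 0" "E > 0"
  shows "(\<Sum>d<16 ^ \<nu>. qam E \<nu> d) = 0"
  unfolding sum_qam[where F="\<lambda>x. x"] using pam_moments[OF assms]
  by (simp add: complex_eq_iff sum_distrib_left[symmetric])

lemma qam_energy:
  assumes "\<nu> > 0" "E > 0"
  shows "(\<Sum>d<16 ^ \<nu>. (cmod (qam E \<nu> d))\<^sup>2) = 16 ^ \<nu> * E"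
proof -
  have "(16::real) ^ \<nu> = 4 ^ \<nu> * 4 ^ \<nu>" by (simp add: power_mult_distrib[symmetric])
  then show ?thesis
    unfolding sum_qam[where F="\<lambda>x. (cmod x)\<^sup>2"] using pam_moments[OF assms]
    by (simp add: cmod_power2 sum.distrib sum_distrib_left[symmetric])
qed

lemma qam_gaussian_sum_le:
  fixes h y :: complex
  assumes "\<nu> > 0" "E > 0" "v > 0"
  defines "G \<equiv> (cmod h)\<^sup>2 * wide_energy E \<nu> + v"
  shows "(\<Sum>d<16 ^ \<nu>. exp (- ((cmod (y - h * qam E \<nu> d))\<^sup>2 / v)))
    \<le> 16 ^ \<nu> * (qam_slack \<nu> ((cmod h)\<^sup>2 * wide_energy E \<nu> / v))\<^sup>2 * (v / G * exp (- ((cmod y)\<^sup>2 / G)))"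
proof -
  define g where "g = cmod h"
  \<comment> \<open>Rotating the output by the phase of \<open>h\<close> keeps distances and makes
    the coefficient real, so the two coordinates separate and the real bound applies twice.\<close>
  define y' where "y' = y * cis (- Arg h)"
  have G: "G > 0" using assms wide_energy_pos[of E \<nu>] by (simp add: G_def add_nonneg_pos)
  have h: "h * cis (- Arg h) = of_real g"
  proof -
    have "h * cis (- Arg h) = of_real g * (cis (Arg h) * cis (- Arg h))"
      using rcis_cmod_Arg[of h] by (simp only: rcis_def g_def mult.assoc[symmetric])
    then show ?thesis by (simp add: cis_mult)
  qed
  have "cmod (y - h * x) = cmod (y' - of_real g * x)" for x
  proof -
    have "cmod (y - h * x) = cmod ((y - h * x) * cis (- Arg h))" by (simp add: norm_mult)
    also have "(y - h * x) * cis (- Arg h) = y' - of_real g * x"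
      by (simp add: y'_def h[symmetric] algebra_simps)
    finally show ?thesis .
  qed
  then have dist: "(cmod (y - h * Complex a b))\<^sup>2 = (Re y' - g * a)\<^sup>2 + (Im y' - g * b)\<^sup>2" for a b
    by (simp add: cmod_power2)
  have y': "(cmod y)\<^sup>2 = (Re y')\<^sup>2 + (Im y')\<^sup>2"
  proof -
    have "cmod y' = cmod y" by (simp add: y'_def norm_mult)
    then show ?thesis using cmod_power2[of y'] by simp
  qed
  have "(\<Sum>d<16 ^ \<nu>. exp (- ((cmod (y - h * qam E \<nu> d))\<^sup>2 / v)))
      = (\<Sum>d<4 ^ \<nu>. exp (- ((Re y' - g * pam E \<nu> d)\<^sup>2 / v))) * (\<Sum>e<4 ^ \<nu>. exp (- ((Im y' - g * pam E \<nu> e)\<^sup>2 / v)))"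
    unfolding sum_qam[where F="\<lambda>x. exp (- ((cmod (y - h * x))\<^sup>2 / v))"] sum_product dist
    by (intro sum.cong refl) (simp add: add_divide_distrib exp_add[symmetric])
  also have "\<dots> \<le> (4 ^ \<nu> * qam_slack \<nu> (g\<^sup>2 * wide_energy E \<nu> / v) * (sqrt (v / G) * exp (- ((Re y')\<^sup>2 / G))))
      * (4 ^ \<nu> * qam_slack \<nu> (g\<^sup>2 * wide_energy E \<nu> / v) * (sqrt (v / G) * exp (- ((Im y')\<^sup>2 / G))))"
    using pam_gaussian_sum_le[OF assms(1-3), of _ g] unfolding G_def g_def
    by (intro mult_mono' sum_nonneg) simp_all
  also have "\<dots> = (4 ^ \<nu> * 4 ^ \<nu>) * (qam_slack \<nu> (g\<^sup>2 * wide_energy E \<nu> / v))\<^sup>2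
      * ((sqrt (v / G) * sqrt (v / G)) * (exp (- ((Re y')\<^sup>2 / G)) * exp (- ((Im y')\<^sup>2 / G))))"
    unfolding power2_eq_square by (simp only: mult_ac)
  also have "sqrt (v / G) * sqrt (v / G) = v / G" using G assms(3) by simp
  also have "exp (- ((Re y')\<^sup>2 / G)) * exp (- ((Im y')\<^sup>2 / G)) = exp (- ((cmod y)\<^sup>2 / G))"
    by (simp add: exp_add[symmetric] y' add_divide_distrib)
  also have "(4::real) ^ \<nu> * 4 ^ \<nu> = 16 ^ \<nu>" by (simp add: power_mult_distrib[symmetric])
  finally show ?thesis by (simp add: g_def)
qed

text \<open>The logarithm of the likelihood ratio between the Gaussian model \<open>y = h x + noise\<close> of
  variance \<open>v\<close> and its output law under a Gaussian input, lowered by what the finite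
  constellation costs.\<close>

definition score :: "real \<Rightarrow> nat \<Rightarrow> real \<Rightarrow> complex \<Rightarrow> complex \<Rightarrow> complex \<Rightarrow> real" where
  "score E \<nu> v h x y =
     (let z = (cmod h)\<^sup>2 * wide_energy E \<nu> in
      ln (1 + z / v) - (cmod (y - h * x))\<^sup>2 / v + (cmod y)\<^sup>2 / (z + v) - 2 * (qam_slack \<nu> (z / v) - 1))"

text \<open>Against the Gaussian output density the constellation loses a factor
  \<open>s\<^sup>2\<close>, where \<open>s\<close> is the slack. The penalty
  \<open>2 * (s - 1)\<close> in the score is at least \<open>2 * ln s\<close> and linear in
  \<open>s\<close>, so it compensates the factor and still has an easily bounded mean.\<close>

lemma sum_exp_score_le:
  assumes "\<nu> > 0" "E > 0" "v > 0"
  shows "(\<Sum>d<16 ^ \<nu>. exp (score E \<nu> v h (qam E \<nu> d) y)) \<le> 16 ^ \<nu>"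
proof -
  define z where "z = (cmod h)\<^sup>2 * wide_energy E \<nu>"
  define s where "s = qam_slack \<nu> (z / v)"
  have z: "z \<ge> 0" using assms wide_energy_pos[of E \<nu>] by (simp add: z_def)
  have s: "s > 0" unfolding s_def qam_slack_def using z assms central_prob_pos[of \<nu>]
    by (intro mult_pos_pos add_pos_pos) (auto simp: add_pos_nonneg)
  have "exp (score E \<nu> v h x y)
      = exp (- ((cmod (y - h * x))\<^sup>2 / v)) * ((z + v) / v * exp ((cmod y)\<^sup>2 / (z + v)) * exp (- 2 * (s - 1)))" for x
  proof -
    have "score E \<nu> v h x y = ln ((z + v) / v) + (- ((cmod (y - h * x))\<^sup>2 / v) + ((cmod y)\<^sup>2 / (z + v) + - 2 * (s - 1)))"
      using assms by (simp add: score_def Let_def z_def[symmetric] s_def[symmetric] add_divide_distrib add.commute)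
    then show ?thesis using z assms by (simp only: exp_add) simp
  qed
  then have "(\<Sum>d<16 ^ \<nu>. exp (score E \<nu> v h (qam E \<nu> d) y))
      = (\<Sum>d<16 ^ \<nu>. exp (- ((cmod (y - h * qam E \<nu> d))\<^sup>2 / v)))
        * ((z + v) / v * exp ((cmod y)\<^sup>2 / (z + v)) * exp (- 2 * (s - 1)))"
    by (simp only: sum_distrib_right)
  also have "\<dots> \<le> (16 ^ \<nu> * s\<^sup>2 * (v / (z + v) * exp (- ((cmod y)\<^sup>2 / (z + v)))))
        * ((z + v) / v * exp ((cmod y)\<^sup>2 / (z + v)) * exp (- 2 * (s - 1)))"
    using qam_gaussian_sum_le[OF assms, of y h] z assms
    by (intro mult_right_mono) (simp_all add: z_def s_def)
  also have "\<dots> = 16 ^ \<nu> * (s * exp (- (s - 1)))\<^sup>2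
      * ((v / (z + v) * ((z + v) / v)) * (exp (- ((cmod y)\<^sup>2 / (z + v))) * exp ((cmod y)\<^sup>2 / (z + v))))"
    by (simp add: power2_eq_square exp_add[symmetric] mult_ac)
  also have "v / (z + v) * ((z + v) / v) = 1" using z assms by simp
  also have "exp (- ((cmod y)\<^sup>2 / (z + v))) * exp ((cmod y)\<^sup>2 / (z + v)) = 1"
    by (simp add: exp_add[symmetric])
  also have "16 ^ \<nu> * (s * exp (- (s - 1)))\<^sup>2 * (1 * 1) \<le> (16 ^ \<nu> * 1 :: real)"
  proof -
    have "s \<le> exp (s - 1)" using exp_ge_add_one_self[of "s - 1"] by simp
    then have "s * exp (- (s - 1)) \<le> exp (s - 1) * exp (- (s - 1))" by (intro mult_right_mono) auto
    then have "s * exp (- (s - 1)) \<le> 1" by (simp add: exp_add[symmetric])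
    then show ?thesis using s by (simp add: power_le_one)
  qed
  finally show ?thesis by simp
qed

section \<open>Random coding with permutations\<close>

text \<open>Composing with a transposition shows that all points of \<open>S\<close> give the same
  sum; for a single permutation the sum over points runs through all of \<open>S\<close>.\<close>

lemma sum_permutations_at:
  fixes F :: "'a \<Rightarrow> real"
  assumes "finite S" "w \<in> S"
  shows "real (card S) * (\<Sum>p | p permutes S. F (p w)) = real (card {p. p permutes S}) * (\<Sum>u\<in>S. F u)"
proof -
  have "(\<Sum>p | p permutes S. F (p u)) = (\<Sum>p | p permutes S. F (p w))" if "u \<in> S" for u
    using sum_permutations_compose_right[of "Transposition.transpose w u" S "\<lambda>p. F (p w)"] that assms
    by (simp add: permutes_swap_id)
  then have "real (card S) * (\<Sum>p | p permutes S. F (p w)) = (\<Sum>u\<in>S. \<Sum>p | p permutes S. F (p u))"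
    by simp
  also have "\<dots> = (\<Sum>p | p permutes S. \<Sum>u\<in>S. F (p u))" by (rule sum.swap)
  also have "\<dots> = (\<Sum>p | p permutes S. \<Sum>u\<in>S. F u)"
    by (intro sum.cong refl sum.reindex_bij_betw permutes_imp_bij) auto
  finally show ?thesis by simp
qed

text \<open>The images of two distinct points form a uniform ordered pair of distinct points. Adding
  the diagonal, whose terms are nonnegative, completes the double sum; compared with independent
  draws this costs the factor \<open>card S / (card S - 1)\<close>.\<close>

lemma sum_permutations_at_pair_le:
  fixes F :: "'a \<Rightarrow> 'a \<Rightarrow> real"
  assumes "finite S" "w \<in> S" "w' \<in> S" "w \<noteq> w'"
    and nonneg: "\<And>u u'. u \<in> S \<Longrightarrow> u' \<in> S \<Longrightarrow> F u u' \<ge> 0"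
    and bound: "\<And>u. u \<in> S \<Longrightarrow> (\<Sum>u'\<in>S. F u u') \<le> real (card S)"
  shows "(\<Sum>p | p permutes S. F (p w) (p w'))
    \<le> real (card {p. p permutes S}) * (real (card S) / (real (card S) - 1))"
proof -
  define A where "A u u' = (\<Sum>p | p permutes S. F (p u) (p u'))" for u u'
  define D where "D = Sigma S (\<lambda>u. S - {u})"
  have "A u u' = A w w'" if "(u, u') \<in> D" for u u'
  proof -
    \<comment> \<open>The first swap sends \<open>w\<close> to \<open>u\<close> and leaves
      \<open>w'\<close> at \<open>z\<close>; the second moves \<open>z\<close> to \<open>u'\<close>
      and fixes \<open>u\<close>, as \<open>z\<close> and \<open>u'\<close> both differ from
      \<open>u\<close>.\<close>
    define z where "z = Transposition.transpose w u w'"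
    define q where "q = Transposition.transpose z u' \<circ> Transposition.transpose w u"
    have uu: "u \<in> S" "u' \<in> S" "u \<noteq> u'" using that by (auto simp: D_def)
    have z: "z \<in> S" "z \<noteq> u" using assms uu by (auto simp: z_def Transposition.transpose_def)
    have q: "q permutes S" unfolding q_def
      using uu z assms by (intro permutes_compose permutes_swap_id)
    have qw: "q w = u" using uu z by (simp add: q_def Transposition.transpose_def)
    have qw': "q w' = u'" by (simp add: q_def z_def[symmetric])
    show ?thesis
      using sum_permutations_compose_right[OF q, of "\<lambda>p. F (p w) (p w')"]
      by (simp add: A_def qw qw')
  qed
  then have "(\<Sum>(u, u')\<in>D. A u u') = (\<Sum>(u, u')\<in>D. A w w')" by (intro sum.cong) auto
  then have "real (card D) * A w w' = (\<Sum>(u, u')\<in>D. A u u')" by (simp add: case_prod_unfold)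
  also have "\<dots> = (\<Sum>p | p permutes S. \<Sum>(u, u')\<in>D. F (p u) (p u'))"
    unfolding A_def case_prod_unfold by (rule sum.swap)
  also have "\<dots> \<le> (\<Sum>p | p permutes S. real (card S) * real (card S))"
  proof (rule sum_mono)
    fix p assume "p \<in> {p. p permutes S}"
    then have p: "p permutes S" by simp
    then have bij: "bij_betw p S S" by (rule permutes_imp_bij)
    have "(\<Sum>(u, u')\<in>D. F (p u) (p u')) = (\<Sum>u\<in>S. \<Sum>u'\<in>S - {u}. F (p u) (p u'))"
      unfolding D_def using assms(1) by (subst sum.Sigma) auto
    also have "\<dots> \<le> (\<Sum>u\<in>S. \<Sum>u'\<in>S. F (p u) (p u'))"
      using assms(1) p by (intro sum_mono sum_mono2) (auto intro!: nonneg simp: permutes_in_image)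
    also have "\<dots> = (\<Sum>u\<in>S. \<Sum>u'\<in>S. F (p u) u')"
      by (intro sum.cong refl sum.reindex_bij_betw[OF bij])
    also have "\<dots> = (\<Sum>u\<in>S. \<Sum>u'\<in>S. F u u')"
      by (rule sum.reindex_bij_betw[OF bij])
    also have "\<dots> \<le> (\<Sum>u\<in>S. real (card S))" by (intro sum_mono bound)
    finally show "(\<Sum>(u, u')\<in>D. F (p u) (p u')) \<le> real (card S) * real (card S)" by simp
  qed
  finally have le: "real (card D) * A w w' \<le> real (card {p. p permutes S}) * (real (card S) * real (card S))"
    by simp
  have "card {w, w'} \<le> card S" using assms by (intro card_mono) auto
  then have S2: "card S \<ge> 2" using assms by simp
  have "real (card D) = real (card S) * (real (card S) - 1)"
    unfolding D_def using assms(1) S2 by (subst card_SigmaI) (auto simp: of_nat_diff)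
  then have "real (card S) * ((real (card S) - 1) * A w w')
      \<le> real (card S) * (real (card {p. p permutes S}) * real (card S))"
    using le by (simp add: mult_ac)
  then have "(real (card S) - 1) * A w w' \<le> real (card {p. p permutes S}) * real (card S)"
    using S2 by (subst (asm) mult_le_cancel_left_pos) auto
  then show ?thesis using S2 by (simp add: A_def field_simps)
qed

lemma sum_PiE_single:
  fixes F :: "'b \<Rightarrow> real"
  assumes "finite I" "finite P" "i \<in> I"
  shows "real (card P) * (\<Sum>p\<in>I \<rightarrow>\<^sub>E P. F (p i)) = real (card (I \<rightarrow>\<^sub>E P)) * (\<Sum>x\<in>P. F x)"
proof -
  have "(\<Sum>p\<in>I \<rightarrow>\<^sub>E P. F (p i)) = (\<Sum>p\<in>I \<rightarrow>\<^sub>E P. \<Prod>k\<in>I. if k = i then F (p k) else 1)"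
    using assms by (intro sum.cong refl) (simp add: prod.delta)
  also have "\<dots> = (\<Prod>k\<in>I. \<Sum>x\<in>P. if k = i then F x else 1)"
    using assms by (subst prod_sum_PiE) auto
  also have "\<dots> = (\<Sum>x\<in>P. F x) * (\<Prod>k\<in>I - {i}. real (card P))"
    using assms by (subst prod.remove[of _ i]) auto
  finally have "(\<Sum>p\<in>I \<rightarrow>\<^sub>E P. F (p i)) = (\<Sum>x\<in>P. F x) * real (card P) ^ (card I - 1)"
    using assms by simp
  moreover have "real (card (I \<rightarrow>\<^sub>E P)) = real (card P) * real (card P) ^ (card I - 1)"
    using assms by (cases "card I") (auto simp: card_funcsetE)
  ultimately show ?thesis by simp
qed

text \<open>Coordinates of a uniformly random tuple are independent, so one centred factor
  annihilates the mixed moment.\<close>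

lemma sum_PiE_pair_zero:
  fixes F G :: "'b \<Rightarrow> real"
  assumes "finite I" "finite P" "i \<in> I" "j \<in> I" "i \<noteq> j" and zero: "(\<Sum>x\<in>P. F x) = 0"
  shows "(\<Sum>p\<in>I \<rightarrow>\<^sub>E P. F (p i) * G (p j)) = 0"
proof -
  let ?f = "\<lambda>k x. if k = i then F x else if k = j then G x else 1"
  have "(\<Prod>k\<in>I. ?f k (p k)) = F (p i) * G (p j)" for p
  proof -
    have "(\<Prod>k\<in>I. ?f k (p k)) = F (p i) * (G (p j) * (\<Prod>k\<in>I - {i} - {j}. 1))"
      using assms by (subst prod.remove[of _ i], simp, simp, subst prod.remove[of _ j]) auto
    then show ?thesis by simp
  qed
  then have "(\<Sum>p\<in>I \<rightarrow>\<^sub>E P. F (p i) * G (p j)) = (\<Sum>p\<in>I \<rightarrow>\<^sub>E P. \<Prod>k\<in>I. ?f k (p k))" by simp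
  also have "\<dots> = (\<Prod>k\<in>I. \<Sum>x\<in>P. ?f k x)"
    using assms by (subst prod_sum_PiE) auto
  also have "\<dots> = 0" using assms zero by (intro prod_zero) (auto intro!: bexI[of _ i])
  finally show ?thesis .
qed

lemma (in prob_space) integrable_product_of_squares:
  fixes X Y :: "'a \<Rightarrow> real"
  assumes [measurable]: "X \<in> borel_measurable M" "Y \<in> borel_measurable M"
    and "integrable M (\<lambda>\<omega>. (X \<omega>)\<^sup>2)" "integrable M (\<lambda>\<omega>. (Y \<omega>)\<^sup>2)"
  shows "integrable M (\<lambda>\<omega>. X \<omega> * Y \<omega>)"
proof (rule Bochner_Integration.integrable_bound)
  show "integrable M (\<lambda>\<omega>. (X \<omega>)\<^sup>2 + (Y \<omega>)\<^sup>2)" using assms by simp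
  show "AE \<omega> in M. norm (X \<omega> * Y \<omega>) \<le> norm ((X \<omega>)\<^sup>2 + (Y \<omega>)\<^sup>2)"
  proof (rule AE_I2)
    fix \<omega>
    have "2 * (\<bar>X \<omega>\<bar> * \<bar>Y \<omega>\<bar>) \<le> \<bar>X \<omega>\<bar>\<^sup>2 + \<bar>Y \<omega>\<bar>\<^sup>2"
      using sum_squares_bound[of "\<bar>X \<omega>\<bar>" "\<bar>Y \<omega>\<bar>"] by (simp add: mult.assoc)
    moreover have "0 \<le> \<bar>X \<omega>\<bar> * \<bar>Y \<omega>\<bar>" by simp
    ultimately have "\<bar>X \<omega>\<bar> * \<bar>Y \<omega>\<bar> \<le> (X \<omega>)\<^sup>2 + (Y \<omega>)\<^sup>2" unfolding power2_abs by linarith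
    then show "norm (X \<omega> * Y \<omega>) \<le> norm ((X \<omega>)\<^sup>2 + (Y \<omega>)\<^sup>2)" by (simp add: abs_mult)
  qed
qed simp

text \<open>Random coding with an arbitrary decoding metric.  The codeword of message \<open>w\<close> uses input
  \<open>p i w\<close> at use \<open>i\<close>, for independent uniformly random permutations \<open>p i\<close>; permutations instead
  of independent inputs make every use of every codebook exactly uniform.  \<open>T i u u'\<close> is the score
  of input \<open>u'\<close> at use \<open>i\<close> when \<open>u\<close> was sent.\<close>

locale random_coding = prob_space M for M :: "'a measure" +
  fixes I :: "'i set" and K :: nat and T :: "'i \<Rightarrow> nat \<Rightarrow> nat \<Rightarrow> 'a \<Rightarrow> real"
    and V :: real and \<mu> :: "'i \<Rightarrow> real"
  assumes fin: "finite I" and K: "2 \<le> K"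
    and meas: "\<And>i u u'. i \<in> I \<Longrightarrow> u < K \<Longrightarrow> u' < K \<Longrightarrow> T i u u' \<in> borel_measurable M"
    and tilt: "\<And>i u \<omega>. i \<in> I \<Longrightarrow> u < K \<Longrightarrow> \<omega> \<in> space M \<Longrightarrow> (\<Sum>u'<K. exp (T i u u' \<omega>)) \<le> real K"
    and square: "\<And>i u. i \<in> I \<Longrightarrow> u < K \<Longrightarrow> integrable M (\<lambda>\<omega>. (T i u u \<omega>)\<^sup>2)"
    and second: "\<And>i u. i \<in> I \<Longrightarrow> u < K \<Longrightarrow> expectation (\<lambda>\<omega>. (T i u u \<omega>)\<^sup>2) \<le> V"
    and uncor: "\<And>i j u u'. i \<in> I \<Longrightarrow> j \<in> I \<Longrightarrow> i \<noteq> j \<Longrightarrow> u < K \<Longrightarrow> u' < K \<Longrightarrow>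
      expectation (\<lambda>\<omega>. T i u u \<omega> * T j u' u' \<omega>) = expectation (T i u u) * expectation (T j u' u')"
    and mean: "\<And>i. i \<in> I \<Longrightarrow> (\<Sum>u<K. expectation (T i u u)) = real K * \<mu> i"
begin

abbreviation perms :: "(nat \<Rightarrow> nat) set" where
  "perms \<equiv> {p. p permutes {..<K}}"

abbreviation codes :: "('i \<Rightarrow> nat \<Rightarrow> nat) set" where
  "codes \<equiv> I \<rightarrow>\<^sub>E perms"

lemma finite_perms: "finite perms"
  by (simp add: finite_permutations)

lemma perms_less: "p \<in> perms \<Longrightarrow> w < K \<Longrightarrow> p w < K"
  using permutes_in_image[of p "{..<K}" w] by auto

lemma codes_less: "p \<in> codes \<Longrightarrow> i \<in> I \<Longrightarrow> w < K \<Longrightarrow> p i w < K"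
  using perms_less by (auto simp: PiE_iff)

text \<open>Centred at the mean over all inputs. A single input may keep a bias, which disappears
  only when the permutation is averaged.\<close>

definition dev :: "'i \<Rightarrow> nat \<Rightarrow> 'a \<Rightarrow> real" where
  "dev i u \<omega> = T i u u \<omega> - \<mu> i"

lemma T_integrable: "i \<in> I \<Longrightarrow> u < K \<Longrightarrow> integrable M (T i u u)"
  using square_integrable_imp_integrable[OF meas square] by blast

lemma dev_meas: "i \<in> I \<Longrightarrow> u < K \<Longrightarrow> dev i u \<in> borel_measurable M"
  unfolding dev_def[abs_def] using meas by (intro borel_measurable_diff) auto

lemma dev_square_integrable: "i \<in> I \<Longrightarrow> u < K \<Longrightarrow> integrable M (\<lambda>\<omega>. (dev i u \<omega>)\<^sup>2)"
  unfolding dev_def power2_diff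
  using square T_integrable
  by (intro Bochner_Integration.integrable_diff Bochner_Integration.integrable_add integrable_mult_left integrable_mult_right) auto

lemma dev_prod_integrable:
  "i \<in> I \<Longrightarrow> j \<in> I \<Longrightarrow> u < K \<Longrightarrow> u' < K \<Longrightarrow> integrable M (\<lambda>\<omega>. dev i u \<omega> * dev j u' \<omega>)"
  by (intro integrable_product_of_squares dev_meas dev_square_integrable)

lemma dev_expectation: "i \<in> I \<Longrightarrow> u < K \<Longrightarrow> expectation (dev i u) = expectation (T i u u) - \<mu> i"
  unfolding dev_def[abs_def] using T_integrable by (simp add: prob_space)

lemma dev_uncor:
  assumes "i \<in> I" "j \<in> I" "i \<noteq> j" "u < K" "u' < K"
  shows "expectation (\<lambda>\<omega>. dev i u \<omega> * dev j u' \<omega>) = expectation (dev i u) * expectation (dev j u')"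
proof -
  have int: "integrable M (T i u u)" "integrable M (T j u' u')" "integrable M (\<lambda>\<omega>. T i u u \<omega> * T j u' u' \<omega>)"
    using assms by (auto intro!: T_integrable integrable_product_of_squares meas square)
  have "expectation (\<lambda>\<omega>. dev i u \<omega> * dev j u' \<omega>)
      = expectation (\<lambda>\<omega>. T i u u \<omega> * T j u' u' \<omega> - \<mu> j * T i u u \<omega> - \<mu> i * T j u' u' \<omega> + \<mu> i * \<mu> j)"
    by (simp add: dev_def algebra_simps)
  also have "\<dots> = expectation (T i u u) * expectation (T j u' u')
      - \<mu> j * expectation (T i u u) - \<mu> i * expectation (T j u' u') + \<mu> i * \<mu> j"
    using int uncor[OF assms] by (simp add: prob_space)
  finally show ?thesis using assms by (simp add: dev_expectation algebra_simps)
qed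

lemma sum_dev_expectation_permuted:
  assumes "i \<in> I" "w < K"
  shows "(\<Sum>p\<in>perms. expectation (dev i (p w))) = 0"
proof -
  have "real K * (\<Sum>p\<in>perms. expectation (dev i (p w))) = real (card perms) * (\<Sum>u<K. expectation (dev i u))"
    using sum_permutations_at[of "{..<K}" w "\<lambda>u. expectation (dev i u)"] assms by simp
  also have "(\<Sum>u<K. expectation (dev i u)) = 0"
    using assms mean by (simp add: dev_expectation sum_subtractf)
  finally show ?thesis using K by simp
qed

text \<open>Centring at the average over inputs subtracts \<open>(\<mu> i)\<^sup>2\<close> from the
  averaged second moment, so the bound \<open>V\<close> survives.\<close>

lemma sum_dev_square_permuted:
  assumes "i \<in> I" "w < K"
  shows "(\<Sum>p\<in>perms. expectation (\<lambda>\<omega>. (dev i (p w) \<omega>)\<^sup>2)) \<le> real (card perms) * V"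
proof -
  have "expectation (\<lambda>\<omega>. (dev i u \<omega>)\<^sup>2)
      = expectation (\<lambda>\<omega>. (T i u u \<omega>)\<^sup>2) - 2 * \<mu> i * expectation (T i u u) + (\<mu> i)\<^sup>2" if "u < K" for u
  proof -
    have "expectation (\<lambda>\<omega>. (dev i u \<omega>)\<^sup>2)
        = expectation (\<lambda>\<omega>. (T i u u \<omega>)\<^sup>2 - 2 * \<mu> i * T i u u \<omega> + (\<mu> i)\<^sup>2)"
      by (simp add: dev_def power2_eq_square algebra_simps)
    then show ?thesis using square T_integrable assms that by (simp add: prob_space)
  qed
  then have "(\<Sum>u<K. expectation (\<lambda>\<omega>. (dev i u \<omega>)\<^sup>2))
      = (\<Sum>u<K. expectation (\<lambda>\<omega>. (T i u u \<omega>)\<^sup>2)) - 2 * \<mu> i * (\<Sum>u<K. expectation (T i u u)) + real K * (\<mu> i)\<^sup>2"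
    by (simp add: sum.distrib sum_subtractf sum_distrib_left)
  also have "\<dots> = (\<Sum>u<K. expectation (\<lambda>\<omega>. (T i u u \<omega>)\<^sup>2)) - real K * (\<mu> i)\<^sup>2"
    using mean assms by (simp add: power2_eq_square)
  also have "\<dots> \<le> (\<Sum>u<K. expectation (\<lambda>\<omega>. (T i u u \<omega>)\<^sup>2))" by simp
  also have "\<dots> \<le> (\<Sum>u<K. V)" using second assms by (intro sum_mono) auto
  finally have le: "(\<Sum>u<K. expectation (\<lambda>\<omega>. (dev i u \<omega>)\<^sup>2)) \<le> real K * V" by simp
  have "real K * (\<Sum>p\<in>perms. expectation (\<lambda>\<omega>. (dev i (p w) \<omega>)\<^sup>2))
      = real (card perms) * (\<Sum>u<K. expectation (\<lambda>\<omega>. (dev i u \<omega>)\<^sup>2))"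
    using sum_permutations_at[of "{..<K}" w "\<lambda>u. expectation (\<lambda>\<omega>. (dev i u \<omega>)\<^sup>2)"] assms by simp
  also have "\<dots> \<le> real K * (real (card perms) * V)"
    using mult_left_mono[OF le, of "real (card perms)"] by (simp add: mult_ac)
  finally show ?thesis using K by simp
qed

lemma card_perms_pos: "card perms > 0"
  using finite_perms by (auto simp: card_gt_0_iff intro!: exI[of _ id] permutes_id)

text \<open>For a fixed code the deviations are uncorrelated but biased, and mixed terms need not
  vanish. Chebyshev's inequality is therefore applied code by code, and the mixed terms cancel when
  the second moments are summed over codes.\<close>

lemma miss_average:
  assumes "w < K" "\<Delta> > 0" and gap: "\<gamma> \<le> (\<Sum>i\<in>I. \<mu> i) - \<Delta>"
  shows "(\<Sum>p\<in>codes. prob {\<omega>\<in>space M. (\<Sum>i\<in>I. T i (p i w) (p i w) \<omega>) \<le> \<gamma>})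
    \<le> real (card codes) * (real (card I) * V / \<Delta>\<^sup>2)"
proof -
  let ?S = "\<lambda>p \<omega>. (\<Sum>i\<in>I. dev i (p i w) \<omega>)\<^sup>2"
  have S: "?S p \<omega> = (\<Sum>i\<in>I. \<Sum>j\<in>I. dev i (p i w) \<omega> * dev j (p j w) \<omega>)" for p \<omega>
    by (simp add: power2_eq_square sum_product)
  have intS: "integrable M (?S p)" if "p \<in> codes" for p
    unfolding S using codes_less[OF that _ assms(1)]
    by (intro Bochner_Integration.integrable_sum dev_prod_integrable)
  have cheb: "prob {\<omega>\<in>space M. (\<Sum>i\<in>I. T i (p i w) (p i w) \<omega>) \<le> \<gamma>} \<le> expectation (?S p) / \<Delta>\<^sup>2"
    if p: "p \<in> codes" for p
  proof -
    have [measurable]: "dev i (p i w) \<in> borel_measurable M" if "i \<in> I" for i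
      using codes_less[OF p that assms(1)] that by (intro dev_meas)
    have "prob {\<omega>\<in>space M. (\<Sum>i\<in>I. T i (p i w) (p i w) \<omega>) \<le> \<gamma>} \<le> prob {\<omega>\<in>space M. ?S p \<omega> \<ge> \<Delta>\<^sup>2}"
    proof (intro finite_measure_mono)
      show "{\<omega>\<in>space M. (\<Sum>i\<in>I. T i (p i w) (p i w) \<omega>) \<le> \<gamma>} \<subseteq> {\<omega>\<in>space M. ?S p \<omega> \<ge> \<Delta>\<^sup>2}"
      proof safe
        fix \<omega> assume "(\<Sum>i\<in>I. T i (p i w) (p i w) \<omega>) \<le> \<gamma>"
        then have "\<Delta> \<le> - (\<Sum>i\<in>I. dev i (p i w) \<omega>)"
          using gap by (simp add: dev_def sum_subtractf)
        then have "\<Delta>\<^sup>2 \<le> (- (\<Sum>i\<in>I. dev i (p i w) \<omega>))\<^sup>2" using assms(2) by (intro power_mono) auto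
        then show "\<Delta>\<^sup>2 \<le> ?S p \<omega>" by simp
      qed
      show "{\<omega>\<in>space M. ?S p \<omega> \<ge> \<Delta>\<^sup>2} \<in> events" by measurable
    qed
    also have "\<dots> \<le> expectation (?S p) / \<Delta>\<^sup>2"
      using assms(2) by (intro integral_Markov_inequality_measure[OF intS[OF p], of "{}"]) auto
    finally show ?thesis .
  qed
  have "(\<Sum>p\<in>codes. expectation (?S p))
      = (\<Sum>p\<in>codes. \<Sum>i\<in>I. \<Sum>j\<in>I. expectation (\<lambda>\<omega>. dev i (p i w) \<omega> * dev j (p j w) \<omega>))"
    unfolding S using codes_less[OF _ _ assms(1)]
    by (intro sum.cong refl) (simp add: dev_prod_integrable)
  also have "\<dots> = (\<Sum>i\<in>I. \<Sum>j\<in>I. \<Sum>p\<in>codes. expectation (\<lambda>\<omega>. dev i (p i w) \<omega> * dev j (p j w) \<omega>))"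
    by (subst sum.swap) (intro sum.cong refl sum.swap)
  also have "\<dots> \<le> (\<Sum>i\<in>I. real (card codes) * V)"
  proof (rule sum_mono)
    fix i assume i: "i \<in> I"
    \<comment> \<open>The channel expectation factors; the permutations at \<open>i\<close> and
      \<open>j\<close> are independent, and the factor at \<open>i\<close> averages to zero.\<close>
    have off: "(\<Sum>p\<in>codes. expectation (\<lambda>\<omega>. dev i (p i w) \<omega> * dev j (p j w) \<omega>)) = 0"
      if j: "j \<in> I" "j \<noteq> i" for j
    proof -
      have "(\<Sum>p\<in>codes. expectation (\<lambda>\<omega>. dev i (p i w) \<omega> * dev j (p j w) \<omega>))
          = (\<Sum>p\<in>codes. (\<lambda>q. expectation (dev i (q w))) (p i) * (\<lambda>q. expectation (dev j (q w))) (p j))"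
        using i j codes_less[OF _ _ assms(1)] by (intro sum.cong refl) (simp add: dev_uncor)
      also have "\<dots> = 0"
        using fin finite_perms i j sum_dev_expectation_permuted[OF i assms(1)]
        by (intro sum_PiE_pair_zero) auto
      finally show ?thesis .
    qed
    have "(\<Sum>j\<in>I. \<Sum>p\<in>codes. expectation (\<lambda>\<omega>. dev i (p i w) \<omega> * dev j (p j w) \<omega>))
        = (\<Sum>p\<in>codes. expectation (\<lambda>\<omega>. (dev i (p i w) \<omega>)\<^sup>2))"
      using fin i off by (subst sum.remove[of _ i]) (auto simp: power2_eq_square)
    also have "\<dots> \<le> real (card codes) * V"
    proof -
      have "real (card perms) * (\<Sum>p\<in>codes. (\<lambda>q. expectation (\<lambda>\<omega>. (dev i (q w) \<omega>)\<^sup>2)) (p i))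
          = real (card codes) * (\<Sum>q\<in>perms. expectation (\<lambda>\<omega>. (dev i (q w) \<omega>)\<^sup>2))"
        by (rule sum_PiE_single[OF fin finite_perms i])
      also have "\<dots> \<le> real (card codes) * (real (card perms) * V)"
        by (intro mult_left_mono sum_dev_square_permuted i assms) simp
      finally show ?thesis using card_perms_pos by (simp add: mult.left_commute)
    qed
    finally show "(\<Sum>j\<in>I. \<Sum>p\<in>codes. expectation (\<lambda>\<omega>. dev i (p i w) \<omega> * dev j (p j w) \<omega>))
        \<le> real (card codes) * V" .
  qed
  finally have le: "(\<Sum>p\<in>codes. expectation (?S p)) \<le> real (card codes) * (real (card I) * V)" by (simp add: mult_ac)
  have "(\<Sum>p\<in>codes. prob {\<omega>\<in>space M. (\<Sum>i\<in>I. T i (p i w) (p i w) \<omega>) \<le> \<gamma>})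
      \<le> (\<Sum>p\<in>codes. expectation (?S p) / \<Delta>\<^sup>2)" by (intro sum_mono cheb)
  also have "\<dots> = (\<Sum>p\<in>codes. expectation (?S p)) / \<Delta>\<^sup>2" by (simp add: sum_divide_distrib)
  also have "\<dots> \<le> real (card codes) * (real (card I) * V) / \<Delta>\<^sup>2"
    using le by (intro divide_right_mono) auto
  finally show ?thesis by simp
qed

text \<open>\<open>tilt\<close> holds for every channel outcome, so the average over codes is
  bounded pointwise in \<omega>, where the independent permutations turn it into a product over
  uses; the integral comes last.\<close>

lemma false_alarm_average:
  assumes "w < K" "w' < K" "w \<noteq> w'"
  shows "(\<Sum>p\<in>codes. prob {\<omega>\<in>space M. \<gamma> < (\<Sum>i\<in>I. T i (p i w) (p i w') \<omega>)})
    \<le> real (card codes) * ((real K / (real K - 1)) ^ card I * exp (- \<gamma>))"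
proof -
  let ?A = "\<lambda>p. {\<omega>\<in>space M. \<gamma> < (\<Sum>i\<in>I. T i (p i w) (p i w') \<omega>)}"
  have A: "?A p \<in> events" if p: "p \<in> codes" for p
  proof -
    have [measurable]: "T i (p i w) (p i w') \<in> borel_measurable M" if "i \<in> I" for i
      using codes_less[OF p that] that assms by (intro meas) auto
    show ?thesis by measurable
  qed
  have pw: "(\<Sum>p\<in>codes. indicat_real (?A p) \<omega>)
      \<le> real (card codes) * ((real K / (real K - 1)) ^ card I * exp (- \<gamma>))" if \<omega>: "\<omega> \<in> space M" for \<omega>
  proof -
    have "(\<Sum>p\<in>codes. indicat_real (?A p) \<omega>) \<le> (\<Sum>p\<in>codes. exp (- \<gamma>) * (\<Prod>i\<in>I. exp (T i (p i w) (p i w') \<omega>)))"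
    proof (rule sum_mono)
      fix p
      \<comment> \<open>Markov's inequality in pointwise form: an indicator of exceeding
        \<open>\<gamma>\<close> is at most the exponential of the excess.\<close>
      have "exp (- \<gamma>) * (\<Prod>i\<in>I. exp (T i (p i w) (p i w') \<omega>)) = exp ((\<Sum>i\<in>I. T i (p i w) (p i w') \<omega>) - \<gamma>)"
        using fin by (simp add: exp_diff exp_sum exp_minus field_simps)
      then show "indicat_real (?A p) \<omega> \<le> exp (- \<gamma>) * (\<Prod>i\<in>I. exp (T i (p i w) (p i w') \<omega>))"
        by (auto simp: indicator_def)
    qed
    also have "\<dots> = exp (- \<gamma>) * (\<Sum>p\<in>codes. \<Prod>i\<in>I. exp (T i (p i w) (p i w') \<omega>))"
      by (simp add: sum_distrib_left)
    also have "(\<Sum>p\<in>codes. \<Prod>i\<in>I. exp (T i (p i w) (p i w') \<omega>)) = (\<Prod>i\<in>I. \<Sum>q\<in>perms. exp (T i (q w) (q w') \<omega>))"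
      using fin finite_perms by (subst prod_sum_PiE) auto
    also have "\<dots> \<le> (\<Prod>i\<in>I. real (card perms) * (real K / (real K - 1)))"
    proof (intro prod_mono conjI sum_nonneg)
      fix i assume i: "i \<in> I"
      show "(\<Sum>q\<in>perms. exp (T i (q w) (q w') \<omega>)) \<le> real (card perms) * (real K / (real K - 1))"
        using sum_permutations_at_pair_le[of "{..<K}" w w' "\<lambda>u u'. exp (T i u u' \<omega>)"] assms tilt[OF i _ \<omega>]
        by simp
    qed simp
    also have "\<dots> = real (card codes) * (real K / (real K - 1)) ^ card I"
      using fin by (simp add: card_funcsetE power_mult_distrib power_divide)
    finally show ?thesis by (simp add: mult_ac)
  qed
  have "(\<Sum>p\<in>codes. prob (?A p)) = expectation (\<lambda>\<omega>. \<Sum>p\<in>codes. indicat_real (?A p) \<omega>)"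
    using A by (subst Bochner_Integration.integral_sum) (auto intro!: sum.cong integrable_real_indicator simp: emeasure_eq_measure)
  also have "\<dots> \<le> real (card codes) * ((real K / (real K - 1)) ^ card I * exp (- \<gamma>))"
  proof (rule integral_le_const)
    show "integrable M (\<lambda>\<omega>. \<Sum>p\<in>codes. indicat_real (?A p) \<omega>)"
      using A by (intro Bochner_Integration.integrable_sum integrable_real_indicator) (auto simp: emeasure_eq_measure)
  qed (use pw in auto)
  finally show ?thesis .
qed

theorem decoding_error_average:
  assumes "w < K" "\<Delta> > 0" "\<gamma> \<le> (\<Sum>i\<in>I. \<mu> i) - \<Delta>"
  shows "(\<Sum>p\<in>codes. prob {\<omega>\<in>space M. (\<Sum>i\<in>I. T i (p i w) (p i w) \<omega>) \<le> \<gamma> \<or>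
      (\<exists>w'<K. w' \<noteq> w \<and> \<gamma> < (\<Sum>i\<in>I. T i (p i w) (p i w') \<omega>))})
    \<le> real (card codes) * (real (card I) * V / \<Delta>\<^sup>2 + real K * (real K / (real K - 1)) ^ card I * exp (- \<gamma>))"
proof -
  let ?F = "\<lambda>p w'. {\<omega>\<in>space M. \<gamma> < (\<Sum>i\<in>I. T i (p i w) (p i w') \<omega>)}"
  let ?Mi = "\<lambda>p. {\<omega>\<in>space M. (\<Sum>i\<in>I. T i (p i w) (p i w) \<omega>) \<le> \<gamma>}"
  have Tm: "T i (p i w) (p i w') \<in> borel_measurable M" if "p \<in> codes" "i \<in> I" "w' < K" for p i w'
    using codes_less[OF that(1,2)] that assms by (intro meas) auto
  have "prob {\<omega>\<in>space M. (\<Sum>i\<in>I. T i (p i w) (p i w) \<omega>) \<le> \<gamma> \<or>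
      (\<exists>w'<K. w' \<noteq> w \<and> \<gamma> < (\<Sum>i\<in>I. T i (p i w) (p i w') \<omega>))}
      \<le> prob (?Mi p) + (\<Sum>w'\<in>{..<K} - {w}. prob (?F p w'))" if p: "p \<in> codes" for p
  proof -
    have "?F p w' \<in> events" if "w' < K" for w'
    proof -
      have [measurable]: "T i (p i w) (p i w') \<in> borel_measurable M" if "i \<in> I" for i
        using Tm p that \<open>w' < K\<close> by blast
      show ?thesis by measurable
    qed
    note F = this
    have Mi: "?Mi p \<in> events"
    proof -
      have [measurable]: "T i (p i w) (p i w) \<in> borel_measurable M" if "i \<in> I" for i
        using Tm p that assms(1) by blast
      show ?thesis by measurable
    qed
    have "{\<omega>\<in>space M. (\<Sum>i\<in>I. T i (p i w) (p i w) \<omega>) \<le> \<gamma> \<or>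
        (\<exists>w'<K. w' \<noteq> w \<and> \<gamma> < (\<Sum>i\<in>I. T i (p i w) (p i w') \<omega>))} = ?Mi p \<union> (\<Union>w'\<in>{..<K} - {w}. ?F p w')"
      by auto
    also have "prob \<dots> \<le> prob (?Mi p) + prob (\<Union>w'\<in>{..<K} - {w}. ?F p w')"
      using F Mi by (intro measure_Un_le) auto
    also have "prob (\<Union>w'\<in>{..<K} - {w}. ?F p w') \<le> (\<Sum>w'\<in>{..<K} - {w}. prob (?F p w'))"
      using F by (intro measure_UNION_le) auto
    finally show ?thesis by simp
  qed
  then have "(\<Sum>p\<in>codes. prob {\<omega>\<in>space M. (\<Sum>i\<in>I. T i (p i w) (p i w) \<omega>) \<le> \<gamma> \<or>
      (\<exists>w'<K. w' \<noteq> w \<and> \<gamma> < (\<Sum>i\<in>I. T i (p i w) (p i w') \<omega>))})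
      \<le> (\<Sum>p\<in>codes. prob (?Mi p) + (\<Sum>w'\<in>{..<K} - {w}. prob (?F p w')))" by (intro sum_mono) auto
  also have "\<dots> = (\<Sum>p\<in>codes. prob (?Mi p)) + (\<Sum>w'\<in>{..<K} - {w}. \<Sum>p\<in>codes. prob (?F p w'))"
    by (simp add: sum.distrib) (rule sum.swap)
  also have "\<dots> \<le> real (card codes) * (real (card I) * V / \<Delta>\<^sup>2)
      + (\<Sum>w'\<in>{..<K} - {w}. real (card codes) * ((real K / (real K - 1)) ^ card I * exp (- \<gamma>)))"
    using assms by (intro add_mono sum_mono miss_average false_alarm_average) auto
  \<comment> \<open>Counting the true message too rounds the number of competitors up to
    \<open>K\<close>.\<close>
  also have "(\<Sum>w'\<in>{..<K} - {w}. real (card codes) * ((real K / (real K - 1)) ^ card I * exp (- \<gamma>)))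
      \<le> (\<Sum>w'<K. real (card codes) * ((real K / (real K - 1)) ^ card I * exp (- \<gamma>)))"
    using K by (intro sum_mono2) auto
  finally show ?thesis by (simp add: algebra_simps)
qed

end

section \<open>Complex Gaussian laws\<close>

lemma cn_density_nonneg: "v > 0 \<Longrightarrow> cn_density \<mu> v z \<ge> 0"
  by (simp add: cn_density_def)

lemma cn_density_measurable [measurable]: "cn_density \<mu> v \<in> borel_measurable borel"
  unfolding cn_density_def[abs_def] by measurable

lemma sets_CN [measurable_cong, simp]: "sets (CN \<mu> v) = sets borel"
  by (simp add: CN_def)

lemma space_CN [simp]: "space (CN \<mu> v) = UNIV"
  by (simp add: CN_def)

lemma cn_density_normal_density:
  assumes "v > 0"
  shows "cn_density 0 v z = normal_density 0 (sqrt (v / 2)) (Re z) * normal_density 0 (sqrt (v / 2)) (Im z)"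
  using assms
  by (simp add: cn_density_def normal_density_def cmod_power2 add_divide_distrib diff_divide_distrib
      flip: exp_add)

lemma nn_integral_complex_product:
  fixes f g :: "real \<Rightarrow> ennreal"
  assumes [measurable]: "f \<in> borel_measurable borel" "g \<in> borel_measurable borel"
  shows "(\<integral>\<^sup>+z. f (Re z) * g (Im z) \<partial>lborel) = (\<integral>\<^sup>+x. f x \<partial>lborel) * (\<integral>\<^sup>+x. g x \<partial>lborel)"
proof -
  define h :: "complex \<Rightarrow> real \<Rightarrow> ennreal" where "h b = (if b = 1 then f else g)" for b
  have "(\<integral>\<^sup>+z. (\<Prod>b\<in>Basis. h b (z \<bullet> b)) \<partial>(lborel :: complex measure)) = (\<Prod>b\<in>Basis. \<integral>\<^sup>+x. h b x \<partial>lborel)"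
    by (rule nn_integral_lborel_prod) (auto simp: h_def)
  then show ?thesis by (simp add: Basis_complex_def h_def inner_complex_def complex_eq_iff)
qed

lemma nn_integral_normal_density:
  assumes "\<sigma> > 0"
  shows "(\<integral>\<^sup>+x. ennreal (normal_density 0 \<sigma> x) \<partial>lborel) = 1"
  using assms by (subst nn_integral_eq_integral) auto

lemma nn_integral_normal_density_square:
  assumes "\<sigma> > 0"
  shows "(\<integral>\<^sup>+x. ennreal (normal_density 0 \<sigma> x * x\<^sup>2) \<partial>lborel) = ennreal (\<sigma>\<^sup>2)"
proof -
  have "has_bochner_integral lborel (\<lambda>x. normal_density 0 \<sigma> x * (x - 0) ^ (2 * 1)) (fact (2 * 1) / ((2 / \<sigma>\<^sup>2) ^ 1 * fact 1))"
    by (rule normal_moment_even[OF assms])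
  then have "has_bochner_integral lborel (\<lambda>x. normal_density 0 \<sigma> x * x\<^sup>2) (\<sigma>\<^sup>2)"
    by (simp add: fact_2)
  then show ?thesis
    by (subst nn_integral_eq_integral) (auto simp: has_bochner_integral_iff intro!: AE_I2)
qed

lemma nn_integral_CN:
  assumes [measurable]: "f \<in> borel_measurable borel"
  shows "(\<integral>\<^sup>+z. f z \<partial>CN \<mu> v) = (\<integral>\<^sup>+z. ennreal (cn_density \<mu> v z) * f z \<partial>lborel)"
  unfolding CN_def by (subst nn_integral_density) auto

lemma nn_integral_cn_density:
  assumes "v > 0"
  shows "(\<integral>\<^sup>+z. ennreal (cn_density 0 v z) \<partial>lborel) = 1"
proof -
  have "(\<integral>\<^sup>+z. ennreal (cn_density 0 v z) \<partial>lborel)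
      = (\<integral>\<^sup>+z. ennreal (normal_density 0 (sqrt (v / 2)) (Re z)) * ennreal (normal_density 0 (sqrt (v / 2)) (Im z)) \<partial>lborel)"
    using assms by (simp add: cn_density_normal_density ennreal_mult)
  also have "\<dots> = 1"
    using assms by (subst nn_integral_complex_product) (auto simp: nn_integral_normal_density)
  finally show ?thesis .
qed

lemma prob_space_CN: "v > 0 \<Longrightarrow> prob_space (CN 0 v)"
  by (rule prob_spaceI) (simp add: CN_def emeasure_density nn_integral_cn_density)

lemma nn_integral_CN_square:
  assumes "v > 0"
  shows "(\<integral>\<^sup>+z. ennreal ((cmod z)\<^sup>2) \<partial>CN 0 v) = ennreal v"
proof -
  let ?d = "normal_density 0 (sqrt (v / 2))"
  have "(\<integral>\<^sup>+z. ennreal ((cmod z)\<^sup>2) \<partial>CN 0 v)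
      = (\<integral>\<^sup>+z. ennreal (?d (Re z) * (Re z)\<^sup>2) * ennreal (?d (Im z)) + ennreal (?d (Re z)) * ennreal (?d (Im z) * (Im z)\<^sup>2) \<partial>lborel)"
    using assms
    by (subst nn_integral_CN) (auto intro!: nn_integral_cong simp: cn_density_normal_density cmod_power2 algebra_simps
        simp flip: ennreal_mult ennreal_plus)
  also have "\<dots> = (\<integral>\<^sup>+z. ennreal (?d (Re z) * (Re z)\<^sup>2) * ennreal (?d (Im z)) \<partial>lborel)
      + (\<integral>\<^sup>+z. ennreal (?d (Re z)) * ennreal (?d (Im z) * (Im z)\<^sup>2) \<partial>lborel)"
    by (rule nn_integral_add) measurable
  also have "(\<integral>\<^sup>+z. ennreal (?d (Re z) * (Re z)\<^sup>2) * ennreal (?d (Im z)) \<partial>lborel) = ennreal (v / 2)"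
    using assms nn_integral_normal_density_square[of "sqrt (v / 2)"]
    by (subst nn_integral_complex_product[of "\<lambda>x. ennreal (?d x * x\<^sup>2)" "\<lambda>x. ennreal (?d x)"])
      (auto simp: nn_integral_normal_density)
  also have "(\<integral>\<^sup>+z. ennreal (?d (Re z)) * ennreal (?d (Im z) * (Im z)\<^sup>2) \<partial>lborel) = ennreal (v / 2)"
    using assms nn_integral_normal_density_square[of "sqrt (v / 2)"]
    by (subst nn_integral_complex_product[of "\<lambda>x. ennreal (?d x)" "\<lambda>x. ennreal (?d x * x\<^sup>2)"])
      (auto simp: nn_integral_normal_density)
  finally show ?thesis using assms by (simp flip: ennreal_plus)
qed

lemma CN_square:
  assumes "v > 0"
  shows "has_bochner_integral (CN 0 v) (\<lambda>z. (cmod z)\<^sup>2) v"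
  using assms nn_integral_CN_square[OF assms]
  by (intro has_bochner_integral_nn_integral) auto

text \<open>\<open>|z|\<^sup>4 \<le> 8 v\<^sup>2 exp (|z|\<^sup>2 / (2 v))\<close>, and the exponential turns the density of variance
  \<open>v\<close> into twice that of variance \<open>2 v\<close>.\<close>

lemma CN_integrable_fourth:
  assumes "v > 0"
  shows "integrable (CN 0 v) (\<lambda>z. (cmod z) ^ 4)"
proof (rule integrableI_bounded)
  have bound: "cn_density 0 v z * (cmod z) ^ 4 \<le> 16 * v\<^sup>2 * cn_density 0 (2 * v) z" for z
  proof -
    define a where "a = (cmod z)\<^sup>2 / (2 * v)"
    have a: "a \<ge> 0" using assms by (simp add: a_def)
    have "a\<^sup>2 / 2 \<le> exp a" using exp_lower_Taylor_quadratic[OF a] a by simp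
    then have "exp (- a) * (exp (- a) * a\<^sup>2) \<le> exp (- a) * (exp (- a) * (2 * exp a))"
      by (intro mult_left_mono) auto
    also have "\<dots> = 2 * exp (- a)" by (simp add: exp_minus)
    finally have *: "exp (- 2 * a) * a\<^sup>2 \<le> 2 * exp (- a)" by (simp add: exp_add[symmetric] mult.assoc[symmetric])
    have "cn_density 0 v z * (cmod z) ^ 4 = 4 * v\<^sup>2 / (pi * v) * (exp (- 2 * a) * a\<^sup>2)"
      using assms by (simp add: cn_density_def a_def power_divide field_simps flip: power_mult)
    also have "\<dots> \<le> 4 * v\<^sup>2 / (pi * v) * (2 * exp (- a))"
      using assms by (intro mult_left_mono *) auto
    also have "\<dots> = 16 * v\<^sup>2 * cn_density 0 (2 * v) z"
      using assms by (simp add: cn_density_def a_def)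
    finally show ?thesis .
  qed
  have "(\<integral>\<^sup>+z. ennreal (norm (cmod z ^ 4)) \<partial>CN 0 v) = (\<integral>\<^sup>+z. ennreal (cn_density 0 v z * (cmod z) ^ 4) \<partial>lborel)"
    using assms by (subst nn_integral_CN) (auto simp: ennreal_mult cn_density_nonneg intro!: nn_integral_cong)
  also have "\<dots> \<le> (\<integral>\<^sup>+z. ennreal (16 * v\<^sup>2) * ennreal (cn_density 0 (2 * v) z) \<partial>lborel)"
    using bound assms by (intro nn_integral_mono) (simp add: ennreal_mult[symmetric] cn_density_nonneg ennreal_leI)
  also have "\<dots> = ennreal (16 * v\<^sup>2)"
    using assms by (subst nn_integral_cmult) (auto simp: nn_integral_cn_density)
  also have "\<dots> < \<infinity>" by simp
  finally show "(\<integral>\<^sup>+z. ennreal (norm (cmod z ^ 4)) \<partial>CN 0 v) < \<infinity>" .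
qed simp

text \<open>Scaling by \<open>c\<close> has Jacobian \<open>\<bar>c\<bar>\<^sup>2\<close> in the
  plane. It serves the symmetry under negation, the gain of the estimator and the normalisation to
  unit variance.\<close>

lemma distr_CN_scaleR:
  assumes "v > 0" "c \<noteq> 0"
  shows "distr (CN 0 v) borel (\<lambda>z. c *\<^sub>R z) = CN 0 (c\<^sup>2 * v)"
proof (rule measure_eqI)
  fix A assume "A \<in> sets (distr (CN 0 v) borel (\<lambda>z. c *\<^sub>R z))"
  then have [measurable]: "A \<in> sets borel" by simp
  have dens: "ennreal \<bar>c\<bar> ^ 2 * ennreal (cn_density 0 (c\<^sup>2 * v) (c *\<^sub>R z)) = ennreal (cn_density 0 v z)" for z
  proof -
    have "\<bar>c\<bar> ^ 2 * cn_density 0 (c\<^sup>2 * v) (c *\<^sub>R z) = cn_density 0 v z"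
      using assms by (simp add: cn_density_def norm_mult power_mult_distrib)
    moreover have "cn_density 0 (c\<^sup>2 * v) (c *\<^sub>R z) \<ge> 0" using assms by (intro cn_density_nonneg) simp
    ultimately show ?thesis by (simp add: ennreal_mult[symmetric] ennreal_power)
  qed
  have "emeasure (CN 0 (c\<^sup>2 * v)) A = (\<integral>\<^sup>+z. ennreal (cn_density 0 (c\<^sup>2 * v) z) * indicator A z \<partial>lborel)"
    by (simp add: CN_def emeasure_density)
  also have "\<dots> = (\<integral>\<^sup>+z. ennreal (cn_density 0 (c\<^sup>2 * v) z) * indicator A z
      \<partial>density (distr lborel borel (\<lambda>x. 0 + c *\<^sub>R x)) (\<lambda>_. \<bar>c\<bar> ^ DIM(complex)))"
    using lborel_affine[OF assms(2), of "0::complex"] by simp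
  also have "\<dots> = (\<integral>\<^sup>+z. ennreal \<bar>c\<bar> ^ 2 * (ennreal (cn_density 0 (c\<^sup>2 * v) (c *\<^sub>R z)) * indicator A (c *\<^sub>R z)) \<partial>lborel)"
    by (subst nn_integral_density) (auto simp: nn_integral_distr ennreal_power)
  also have "\<dots> = (\<integral>\<^sup>+z. ennreal (cn_density 0 v z) * indicator ((\<lambda>z. c *\<^sub>R z) -` A) z \<partial>lborel)"
    unfolding mult.assoc[symmetric] dens by (simp add: indicator_def)
  also have "\<dots> = emeasure (CN 0 v) ((\<lambda>z. c *\<^sub>R z) -` A)"
    using measurable_sets_borel[of "\<lambda>z::complex. c *\<^sub>R z" borel A] by (simp add: CN_def emeasure_density)
  also have "\<dots> = emeasure (distr (CN 0 v) borel (\<lambda>z. c *\<^sub>R z)) A"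
    by (subst emeasure_distr) auto
  finally show "emeasure (distr (CN 0 v) borel (\<lambda>z. c *\<^sub>R z)) A = emeasure (CN 0 (c\<^sup>2 * v)) A" by simp
qed simp

lemma CN_integrable_id:
  assumes "v > 0"
  shows "integrable (CN 0 v) (\<lambda>z. z)"
proof (rule Bochner_Integration.integrable_bound)
  interpret prob_space "CN 0 v" using assms by (rule prob_space_CN)
  show "integrable (CN 0 v) (\<lambda>z. 1 + (cmod z)\<^sup>2)"
    using CN_square[OF assms] by (simp add: has_bochner_integral_iff)
  show "AE z in CN 0 v. norm z \<le> norm (1 + (cmod z)\<^sup>2)"
  proof (rule AE_I2)
    fix z :: complex
    have "2 * cmod z \<le> 1 + (cmod z)\<^sup>2" using sum_squares_bound[of 1 "cmod z"] by simp
    then have "cmod z \<le> 1 + (cmod z)\<^sup>2" using norm_ge_zero[of z] by linarith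
    then show "norm z \<le> norm (1 + (cmod z)\<^sup>2)" by simp
  qed
qed simp

text \<open>Reflection in the origin preserves the law, so the mean equals its own negative.\<close>

lemma CN_mean:
  assumes "v > 0"
  shows "(LINT z|CN 0 v. z) = 0"
proof -
  have "(LINT z|CN 0 v. z) = (LINT z|distr (CN 0 v) borel (\<lambda>z. (- 1) *\<^sub>R z). z)"
    using distr_CN_scaleR[OF assms, of "- 1"] by simp
  also have "\<dots> = (LINT z|CN 0 v. - z)" by (subst integral_distr) auto
  also have "\<dots> = - (LINT z|CN 0 v. z)" by simp
  finally show ?thesis by simp
qed

section \<open>Estimating a Gaussian coefficient from a noisy observation\<close>

lemma nn_integral_lborel_shift:
  fixes f :: "complex \<Rightarrow> ennreal"
  assumes [measurable]: "f \<in> borel_measurable borel"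
  shows "(\<integral>\<^sup>+z. f (z + c) \<partial>lborel) = (\<integral>\<^sup>+z. f z \<partial>lborel)"
proof -
  have "(\<integral>\<^sup>+z. f z \<partial>lborel) = (\<integral>\<^sup>+z. f z \<partial>distr lborel borel ((+) c))"
    by (simp add: lborel_distr_plus)
  also have "\<dots> = (\<integral>\<^sup>+z. f (z + c) \<partial>lborel)"
    by (subst nn_integral_distr) (auto simp: add.commute)
  finally show ?thesis by simp
qed

text \<open>Bayes' rule in the exponent: coefficient and noise on the left, observation and
  estimation error on the right. \<open>r * s / V\<close> is the linear MMSE coefficient and
  \<open>s * N / V\<close> the error variance.\<close>

lemma complete_square_real:
  fixes a b r s N :: real
  assumes "s > 0" "N > 0"
  defines "V \<equiv> r\<^sup>2 * s + N"
  shows "a\<^sup>2 / s + (b - r * a)\<^sup>2 / N = b\<^sup>2 / V + (a - r * s / V * b)\<^sup>2 / (s * N / V)"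
proof -
  have V: "V > 0" using assms by (simp add: V_def add_nonneg_pos)
  have "(a - r * s / V * b)\<^sup>2 / (s * N / V) = (V * (a - r * s / V * b))\<^sup>2 / (V * s * N)"
    using V by (simp add: power2_eq_square)
  also have "V * (a - r * s / V * b) = V * a - r * s * b" using V by (simp add: right_diff_distrib)
  finally have 1: "b\<^sup>2 / V + (a - r * s / V * b)\<^sup>2 / (s * N / V) = (b\<^sup>2 * (s * N) + (V * a - r * s * b)\<^sup>2) / (V * s * N)"
    using V assms(1,2) by (simp add: add_divide_distrib)
  have 2: "a\<^sup>2 / s + (b - r * a)\<^sup>2 / N = (a\<^sup>2 * (V * N) + (b - r * a)\<^sup>2 * (V * s)) / (V * s * N)"
    using V assms(1,2) by (simp add: add_divide_distrib)
  have "b\<^sup>2 * (s * N) + (V * a - r * s * b)\<^sup>2 = a\<^sup>2 * (V * N) + (b - r * a)\<^sup>2 * (V * s)"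
    unfolding V_def by algebra
  then show ?thesis unfolding 1 2 by simp
qed

lemma cn_density_complete_square:
  fixes r s N :: real
  assumes "s > 0" "N > 0"
  defines "V \<equiv> r\<^sup>2 * s + N"
  shows "cn_density 0 s h * cn_density 0 N (y - of_real r * h)
    = cn_density 0 V y * cn_density 0 (s * N / V) (h - of_real (r * s / V) * y)"
proof -
  have V: "V > 0" using assms by (simp add: V_def add_nonneg_pos)
  have "(cmod h)\<^sup>2 / s + (cmod (y - of_real r * h))\<^sup>2 / N
      = ((Re h)\<^sup>2 / s + (Re y - r * Re h)\<^sup>2 / N) + ((Im h)\<^sup>2 / s + (Im y - r * Im h)\<^sup>2 / N)"
    by (simp add: cmod_power2 add_divide_distrib)
  also have "\<dots> = (cmod y)\<^sup>2 / V + (cmod (h - of_real (r * s / V) * y))\<^sup>2 / (s * N / V)"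
    unfolding complete_square_real[OF assms(1,2)] V_def[symmetric]
    by (simp add: cmod_power2 add_divide_distrib distrib_right)
  finally have "exp (- ((cmod h)\<^sup>2 / s + (cmod (y - of_real r * h))\<^sup>2 / N))
      = exp (- ((cmod y)\<^sup>2 / V + (cmod (h - of_real (r * s / V) * y))\<^sup>2 / (s * N / V)))" by simp
  moreover have "exp (- (p + q)) / (pi * x * (pi * z)) = exp (- p) / (pi * x) * (exp (- q) / (pi * z))" for p q x z :: real
    by (simp add: exp_diff exp_minus field_simps)
  moreover have "pi * s * (pi * N) = pi * V * (pi * (s * N / V))" using V by simp
  ultimately show ?thesis unfolding cn_density_def diff_0_right minus_divide_left[symmetric] by metis
qed

text \<open>The observation \<open>y = r h + n\<close> and the estimation error of the linear MMSE estimate of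
  \<open>h\<close> are independent; both substitutions in the proof are translations.\<close>

lemma distr_CN_estimation:
  fixes r s N :: real
  assumes "s > 0" "N > 0"
  defines "V \<equiv> r\<^sup>2 * s + N"
  shows "distr (CN 0 s \<Otimes>\<^sub>M CN 0 N) (borel \<Otimes>\<^sub>M borel)
      (\<lambda>(h, n). (of_real r * h + n, h - of_real (r * s / V) * (of_real r * h + n)))
    = CN 0 V \<Otimes>\<^sub>M CN 0 (s * N / V)" (is "distr ?P ?B ?f = ?Q")
proof (rule measure_eqI)
  let ?c = "complex_of_real (r * s / V)" and ?r = "complex_of_real r"
  let ?t = "s * N / V"
  have V: "V > 0" using assms by (simp add: V_def add_nonneg_pos)
  then have t: "?t > 0" using assms by simp
  interpret S: prob_space "CN 0 s" using assms by (intro prob_space_CN)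
  interpret N: prob_space "CN 0 N" using assms by (intro prob_space_CN)
  interpret V: prob_space "CN 0 V" using V by (intro prob_space_CN)
  interpret T: prob_space "CN 0 ?t" using t by (intro prob_space_CN)
  interpret SN: pair_prob_space "CN 0 s" "CN 0 N" ..
  interpret VT: pair_prob_space "CN 0 V" "CN 0 ?t" ..
  have L: "pair_sigma_finite (lborel :: complex measure) (lborel :: complex measure)" ..
  show "sets (distr ?P ?B ?f) = sets ?Q"
    by (simp cong: sets_pair_measure_cong)
  fix A assume "A \<in> sets (distr ?P ?B ?f)"
  then have A[measurable]: "A \<in> sets (borel \<Otimes>\<^sub>M borel)" by simp
  let ?F = "\<lambda>y u. indicator A (y, u) :: ennreal"
  have "emeasure (distr ?P ?B ?f) A = (\<integral>\<^sup>+x. indicator A x \<partial>distr ?P ?B ?f)"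
    by simp
  also have "\<dots> = (\<integral>\<^sup>+x. indicator A (?f x) \<partial>?P)"
    by (rule nn_integral_distr) measurable
  also have "\<dots> = (\<integral>\<^sup>+h. \<integral>\<^sup>+n. ?F (?r * h + n) (h - ?c * (?r * h + n)) \<partial>CN 0 N \<partial>CN 0 s)"
    by (subst N.nn_integral_fst[symmetric]) (auto simp: case_prod_unfold)
  also have "\<dots> = (\<integral>\<^sup>+h. ennreal (cn_density 0 s h) *
      (\<integral>\<^sup>+n. ennreal (cn_density 0 N n) * ?F (?r * h + n) (h - ?c * (?r * h + n)) \<partial>lborel) \<partial>lborel)"
    by (subst nn_integral_CN, measurable, intro nn_integral_cong arg_cong2[where f="(*)"] refl nn_integral_CN) measurable
  also have "\<dots> = (\<integral>\<^sup>+h. ennreal (cn_density 0 s h) *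
      (\<integral>\<^sup>+y. ennreal (cn_density 0 N (y - ?r * h)) * ?F y (h - ?c * y) \<partial>lborel) \<partial>lborel)"
  proof (rule nn_integral_cong, rule arg_cong2[where f="(*)"], rule refl)
    fix h
    show "(\<integral>\<^sup>+n. ennreal (cn_density 0 N n) * ?F (?r * h + n) (h - ?c * (?r * h + n)) \<partial>lborel)
        = (\<integral>\<^sup>+y. ennreal (cn_density 0 N (y - ?r * h)) * ?F y (h - ?c * y) \<partial>lborel)"
      by (subst nn_integral_lborel_shift[symmetric, where c="?r * h"]) (auto simp: add.commute)
  qed
  also have "\<dots> = (\<integral>\<^sup>+h. \<integral>\<^sup>+y. ennreal (cn_density 0 s h * cn_density 0 N (y - ?r * h)) * ?F y (h - ?c * y) \<partial>lborel \<partial>lborel)"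
    using assms(1,2) by (intro nn_integral_cong) (simp add: nn_integral_cmult[symmetric] ennreal_mult cn_density_nonneg mult.assoc)
  \<comment> \<open>The first translation keeps \<open>h\<close> fixed and the second keeps
    \<open>y\<close> fixed, hence the exchange of integrals between them.\<close>
  also have "\<dots> = (\<integral>\<^sup>+y. \<integral>\<^sup>+h. ennreal (cn_density 0 s h * cn_density 0 N (y - ?r * h)) * ?F y (h - ?c * y) \<partial>lborel \<partial>lborel)"
    by (rule pair_sigma_finite.Fubini'[OF L]) measurable
  also have "\<dots> = (\<integral>\<^sup>+y. \<integral>\<^sup>+h. ennreal (cn_density 0 V y * cn_density 0 ?t (h - ?c * y)) * ?F y (h - ?c * y) \<partial>lborel \<partial>lborel)"
    unfolding cn_density_complete_square[OF assms(1,2)] V_def[symmetric] ..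
  also have "\<dots> = (\<integral>\<^sup>+y. \<integral>\<^sup>+u. ennreal (cn_density 0 V y * cn_density 0 ?t u) * ?F y u \<partial>lborel \<partial>lborel)"
  proof (rule nn_integral_cong)
    fix y
    show "(\<integral>\<^sup>+h. ennreal (cn_density 0 V y * cn_density 0 ?t (h - ?c * y)) * ?F y (h - ?c * y) \<partial>lborel)
        = (\<integral>\<^sup>+u. ennreal (cn_density 0 V y * cn_density 0 ?t u) * ?F y u \<partial>lborel)"
      by (subst nn_integral_lborel_shift[symmetric, where c="?c * y"]) auto
  qed
  also have "\<dots> = (\<integral>\<^sup>+y. ennreal (cn_density 0 V y) * (\<integral>\<^sup>+u. ennreal (cn_density 0 ?t u) * ?F y u \<partial>lborel) \<partial>lborel)"
    using V t by (intro nn_integral_cong) (simp add: nn_integral_cmult[symmetric] ennreal_mult cn_density_nonneg mult.assoc)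
  also have "\<dots> = (\<integral>\<^sup>+y. \<integral>\<^sup>+u. ?F y u \<partial>CN 0 ?t \<partial>CN 0 V)"
    by (rule sym, subst nn_integral_CN, measurable, intro nn_integral_cong arg_cong2[where f="(*)"] refl nn_integral_CN) measurable
  also have "\<dots> = (\<integral>\<^sup>+x. indicator A x \<partial>?Q)"
    by (subst T.nn_integral_fst[symmetric]) (auto simp: case_prod_unfold)
  also have "\<dots> = emeasure ?Q A" by simp
  finally show "emeasure (distr ?P ?B ?f) A = emeasure ?Q A" .
qed

section \<open>The channel estimates and the decoding metric\<close>

lemma (in prob_space) distr_pair_snd: "distr (M \<Otimes>\<^sub>M N) N snd = N" if "sigma_finite_measure N"
proof (intro measure_eqI)
  interpret N: sigma_finite_measure N by fact
  fix A assume A: "A \<in> sets (distr (M \<Otimes>\<^sub>M N) N snd)"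
  then have "emeasure (distr (M \<Otimes>\<^sub>M N) N snd) A = emeasure (M \<Otimes>\<^sub>M N) (space M \<times> A)"
    by (auto simp add: emeasure_distr space_pair_measure dest: sets.sets_into_space intro!: arg_cong2[where f=emeasure])
  with A show "emeasure (distr (M \<Otimes>\<^sub>M N) N snd) A = emeasure N A"
    by (simp add: N.emeasure_pair_measure_Times emeasure_space_1)
qed simp

lemma qam_slack_measurable [measurable]: "qam_slack \<nu> \<in> borel_measurable borel"
  unfolding qam_slack_def[abs_def] by measurable

lemma score_measurable [measurable (raw)]:
  assumes [measurable]: "f \<in> borel_measurable M" "g \<in> borel_measurable M"
  shows "(\<lambda>\<omega>. score E \<nu> v (f \<omega>) x (g \<omega>)) \<in> borel_measurable M"
  unfolding score_def Let_def by measurable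

lemma cmod_add_square_le: "(cmod (a + b))\<^sup>2 \<le> 2 * (cmod a)\<^sup>2 + 2 * (cmod b)\<^sup>2"
proof -
  have "(cmod (a + b))\<^sup>2 \<le> (cmod a + cmod b)\<^sup>2" by (intro power_mono norm_triangle_ineq) simp
  also have "\<dots> \<le> 2 * (cmod a)\<^sup>2 + 2 * (cmod b)\<^sup>2"
    using sum_squares_bound[of "cmod a" "cmod b"] by (simp add: power2_sum)
  finally show ?thesis .
qed

text \<open>Trading the square root for a linear function makes the penalty at most quadratic in the
  channel estimate.\<close>

lemma qam_slack_bounds:
  assumes "z \<ge> 0"
  shows "0 \<le> qam_slack \<nu> z"
    "qam_slack \<nu> z \<le> central_prob \<nu> * sqrt (pi * (real \<nu> + 1 / 2)) + 2 * central_prob \<nu> * (1 + z)"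
proof -
  have p: "0 \<le> central_prob \<nu>" using central_prob_pos[of \<nu>] by simp
  show "0 \<le> qam_slack \<nu> z" using p assms by (simp add: qam_slack_def)
  have "sqrt (1 + z) \<le> sqrt ((1 + z)\<^sup>2)"
    using assms by (intro real_sqrt_le_mono) (simp add: power2_eq_square algebra_simps)
  then have "sqrt (1 + z) \<le> 1 + z" using assms by simp
  then have "central_prob \<nu> * (sqrt (pi * (real \<nu> + 1 / 2)) + 2 * sqrt (1 + z))
      \<le> central_prob \<nu> * (sqrt (pi * (real \<nu> + 1 / 2)) + 2 * (1 + z))"
    using p by (intro mult_left_mono) auto
  then show "qam_slack \<nu> z \<le> central_prob \<nu> * sqrt (pi * (real \<nu> + 1 / 2)) + 2 * central_prob \<nu> * (1 + z)"
    by (simp add: qam_slack_def algebra_simps)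
qed

text \<open>Quadratic growth in the three Gaussian variables reduces square integrability of the
  score to fourth moments.\<close>

lemma score_quadratic_bound:
  assumes "E > 0" "v > 0"
  shows "\<exists>C\<ge>0. \<forall>g h n. \<bar>score E \<nu> v g x (h * x + n)\<bar> \<le> C * (1 + (cmod g)\<^sup>2 + (cmod h)\<^sup>2 + (cmod n)\<^sup>2)"
proof -
  define W where "W = wide_energy E \<nu>"
  define p q where "p = central_prob \<nu>" and "q = central_prob \<nu> * sqrt (pi * (real \<nu> + 1 / 2))"
  define X where "X = (cmod x)\<^sup>2"
  \<comment> \<open>The sum of the coefficients of \<open>G\<close>, \<open>H\<close>,
    \<open>N\<close> and 1 in the estimate below, hence a bound for each of them.\<close>
  define C where "C = (W / v + 4 * p * W / v + 4 * X / v) + (6 * X / v) + 4 / v + (2 + 2 * q + 4 * p)"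
  have W: "W > 0" using assms by (simp add: W_def wide_energy_pos)
  have pq: "p \<ge> 0" "q \<ge> 0" using central_prob_pos[of \<nu>] by (simp_all add: p_def q_def)
  have X: "X \<ge> 0" by (simp add: X_def)
  have C: "C \<ge> 0" using W pq X assms by (simp add: C_def)
  have "\<bar>score E \<nu> v g x (h * x + n)\<bar> \<le> C * (1 + (cmod g)\<^sup>2 + (cmod h)\<^sup>2 + (cmod n)\<^sup>2)" for g h n
  proof -
    define G H N where "G = (cmod g)\<^sup>2" and "H = (cmod h)\<^sup>2" and "N = (cmod n)\<^sup>2"
    define z where "z = G * W"
    have nn: "G \<ge> 0" "H \<ge> 0" "N \<ge> 0" by (simp_all add: G_def H_def N_def)
    have z: "z \<ge> 0" "z / v \<ge> 0" using nn W assms by (simp_all add: z_def)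
    have 1: "\<bar>ln (1 + z / v)\<bar> \<le> W / v * G"
    proof -
      have "0 \<le> ln (1 + z / v)" using z by simp
      moreover have "ln (1 + z / v) \<le> z / v" using z by (intro ln_add_one_self_le_self)
      ultimately show ?thesis by (simp add: z_def mult.commute)
    qed
    have 2: "(cmod (h * x + n - g * x))\<^sup>2 / v \<le> (4 * X * H + 4 * X * G + 2 * N) / v"
    proof (intro divide_right_mono)
      have "h * x + n - g * x = (h + - g) * x + n" by (simp add: algebra_simps)
      then have "(cmod (h * x + n - g * x))\<^sup>2 \<le> 2 * (cmod ((h + - g) * x))\<^sup>2 + 2 * N"
        unfolding N_def by (simp only: cmod_add_square_le)
      also have "(cmod ((h + - g) * x))\<^sup>2 = (cmod (h + - g))\<^sup>2 * X"
        by (simp add: norm_mult power_mult_distrib X_def)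
      also have "\<dots> \<le> (2 * H + 2 * G) * X"
        using cmod_add_square_le[of h "- g"] X by (intro mult_right_mono) (simp_all add: H_def G_def)
      finally show "(cmod (h * x + n - g * x))\<^sup>2 \<le> 4 * X * H + 4 * X * G + 2 * N"
        by (simp add: algebra_simps)
    qed (use assms in simp)
    have 3: "(cmod (h * x + n))\<^sup>2 / (z + v) \<le> (2 * X * H + 2 * N) / v"
    proof -
      have "(cmod (h * x + n))\<^sup>2 / (z + v) \<le> (cmod (h * x + n))\<^sup>2 / v"
        using z assms by (intro divide_left_mono) (auto intro: add_nonneg_pos)
      also have "\<dots> \<le> (2 * X * H + 2 * N) / v"
        using cmod_add_square_le[of "h * x" n] assms
        by (intro divide_right_mono) (simp_all add: norm_mult power_mult_distrib X_def H_def N_def mult_ac)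
      finally show ?thesis .
    qed
    have 4: "\<bar>2 * (qam_slack \<nu> (z / v) - 1)\<bar> \<le> 2 + 2 * q + 4 * p + 4 * p * W / v * G"
    proof -
      define u where "u = p * W / v * G"
      have "qam_slack \<nu> (z / v) \<le> q + 2 * p * (1 + z / v)"
        using qam_slack_bounds(2)[OF z(2), of \<nu>] by (simp add: p_def q_def)
      moreover have "2 * p * (1 + z / v) = 2 * p + 2 * u" by (simp add: z_def u_def algebra_simps)
      moreover have "4 * p * W / v * G = 4 * u" by (simp add: u_def)
      moreover have "0 \<le> u" using pq W assms nn by (simp add: u_def)
      moreover have "0 \<le> qam_slack \<nu> (z / v)" by (rule qam_slack_bounds(1)[OF z(2)])
      ultimately show ?thesis using pq by (smt (verit))
    qed
    have "\<bar>score E \<nu> v g x (h * x + n)\<bar>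
        \<le> \<bar>ln (1 + z / v)\<bar> + (cmod (h * x + n - g * x))\<^sup>2 / v + (cmod (h * x + n))\<^sup>2 / (z + v)
          + \<bar>2 * (qam_slack \<nu> (z / v) - 1)\<bar>"
    proof -
      have "0 \<le> (cmod (h * x + n - g * x))\<^sup>2 / v" "0 \<le> (cmod (h * x + n))\<^sup>2 / (z + v)"
        using z assms by (auto intro: divide_nonneg_nonneg add_nonneg_nonneg)
      then show ?thesis
        unfolding score_def Let_def W_def[symmetric] G_def[symmetric] z_def[symmetric] by linarith
    qed
    also have "\<dots> \<le> W / v * G + (4 * X * H + 4 * X * G + 2 * N) / v + (2 * X * H + 2 * N) / v
        + (2 + 2 * q + 4 * p + 4 * p * W / v * G)"
      by (intro add_mono 1 2 3 4)
    also have "\<dots> = (W / v + 4 * p * W / v + 4 * X / v) * G + (6 * X / v) * H + (4 / v) * N + (2 + 2 * q + 4 * p) * 1"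
      by (simp add: add_divide_distrib algebra_simps)
    also have "\<dots> \<le> C * G + C * H + C * N + C * 1"
    proof -
      have "0 \<le> W / v" "0 \<le> 4 * p * W / v" "0 \<le> 4 * X / v" "0 \<le> 6 * X / v" "0 \<le> 4 / v" "0 \<le> 2 + 2 * q + 4 * p"
        using W pq X assms by simp_all
      then have "W / v + 4 * p * W / v + 4 * X / v \<le> C" "6 * X / v \<le> C" "4 / v \<le> C" "2 + 2 * q + 4 * p \<le> C"
        unfolding C_def by linarith+
      then show ?thesis using nn by (intro add_mono mult_right_mono) auto
    qed
    finally show ?thesis by (simp add: G_def H_def N_def algebra_simps)
  qed
  then show ?thesis using C by blast
qed

section \<open>The channel space and the channel estimates\<close>

locale training_channel =
  fixes c :: relay_net
  assumes var_pos: "\<And>l. fade_dev c l > 0" and noise_pos: "noise_var c > 0"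
    and pilot_pos: "\<And>l. pilot_energy c l > 0"
    and symbol_pos: "\<And>l. symbol_energy c l > 0"
begin

abbreviation \<Omega> :: "(rvar \<Rightarrow> complex) measure" where
  "\<Omega> \<equiv> channel_space c"

lemma rvar_var_pos: "rvar_var c a > 0"
  using zero_less_power[OF var_pos, of _ 2] noise_pos by (cases a) (simp_all only: rvar_var.simps)

sublocale coords: product_prob_space "\<lambda>a. CN 0 (rvar_var c a)" UNIV
  by (simp add: product_prob_space_def product_prob_space_axioms_def product_sigma_finite_def
      prob_space_imp_sigma_finite prob_space_CN rvar_var_pos)

sublocale prob_space \<Omega>
  unfolding channel_space_def by (rule coords.prob_space_axioms)

lemma space_channel [simp]: "space \<Omega> = UNIV"
  by (simp add: channel_space_def space_PiM PiE_UNIV_domain)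

lemma cnj_measurable [measurable, simp]: "cnj \<in> borel_measurable borel"
  by (intro borel_measurable_continuous_onI continuous_intros)

lemma prob_UNIV [simp]: "prob UNIV = 1"
  using prob_space by simp

lemma coord_measurable [measurable]: "(\<lambda>\<omega>. \<omega> a) \<in> borel_measurable \<Omega>"
proof -
  have "(\<lambda>\<omega>. \<omega> a) \<in> \<Omega> \<rightarrow>\<^sub>M CN 0 (rvar_var c a)"
    unfolding channel_space_def by (rule measurable_component_singleton) simp
  then show ?thesis by (simp add: measurable_cong_sets[OF refl sets_CN])
qed

lemma distr_coord: "distr \<Omega> borel (\<lambda>\<omega>. \<omega> a) = CN 0 (rvar_var c a)"
proof -
  have "distr \<Omega> borel (\<lambda>\<omega>. \<omega> a) = distr \<Omega> (CN 0 (rvar_var c a)) (\<lambda>\<omega>. \<omega> a)"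
    by (intro distr_cong) auto
  then show ?thesis
    using coords.PiM_component[of a] by (simp add: channel_space_def)
qed

lemma sets_channel: "sets \<Omega> = sets (Pi\<^sub>M UNIV (\<lambda>_. borel))"
  unfolding channel_space_def by (intro sets_PiM_cong) auto

lemma indep_coords: "indep_vars (\<lambda>_. borel) (\<lambda>a \<omega>. \<omega> a) UNIV"
proof (subst indep_vars_iff_distr_eq_PiM)
  have "distr \<Omega> (Pi\<^sub>M UNIV (\<lambda>_. borel)) (\<lambda>x. \<lambda>i\<in>UNIV. x i) = distr \<Omega> \<Omega> (\<lambda>x. x)"
    by (intro distr_cong) (auto simp: sets_channel)
  also have "\<dots> = \<Omega>" by (rule distr_id)
  also have "\<dots> = Pi\<^sub>M UNIV (\<lambda>i. distr \<Omega> borel (\<lambda>\<omega>. \<omega> i))"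
    by (simp add: distr_coord) (simp add: channel_space_def)
  finally show "distr \<Omega> (Pi\<^sub>M UNIV (\<lambda>_. borel)) (\<lambda>x. \<lambda>i\<in>UNIV. x i) = Pi\<^sub>M UNIV (\<lambda>i. distr \<Omega> borel (\<lambda>\<omega>. \<omega> i))" .
qed auto

text \<open>Source of the independence between blocks, links and noise samples. Estimate and
  estimation error share coordinates, so their independence must come from the Gaussian computation
  instead.\<close>

lemma indep_disjoint_coords:
  assumes "A \<inter> B = {}"
    and "F \<in> Pi\<^sub>M A (\<lambda>_. borel) \<rightarrow>\<^sub>M M1" "G \<in> Pi\<^sub>M B (\<lambda>_. borel) \<rightarrow>\<^sub>M M2"
  shows "indep_var M1 (\<lambda>\<omega>. F (restrict \<omega> A)) M2 (\<lambda>\<omega>. G (restrict \<omega> B))"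
  using indep_var_compose[OF indep_var_restrict[OF indep_coords assms(1)] assms(2,3)]
  by (simp add: o_def)

definition fade_var :: "link \<Rightarrow> real" where
  "fade_var l = (fade_dev c l)\<^sup>2"

definition obs_var :: "link \<Rightarrow> real" where
  "obs_var l = pilot_energy c l * fade_var l + noise_var c"

definition gain :: "link \<Rightarrow> real" where
  "gain l = sqrt (pilot_energy c l) * fade_var l / obs_var l"

definition est_var :: "link \<Rightarrow> real" where
  "est_var l = (gain l)\<^sup>2 * obs_var l"

definition err_var :: "link \<Rightarrow> real" where
  "err_var l = fade_var l * noise_var c / obs_var l"

definition eff_noise :: "link \<Rightarrow> real" where
  "eff_noise l = err_var l * symbol_energy c l + noise_var c"

definition est_err :: "link \<Rightarrow> nat \<Rightarrow> (rvar \<Rightarrow> complex) \<Rightarrow> complex" where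
  "est_err l t \<omega> = \<omega> (Fade l t) - mmse_est c l t \<omega>"

lemma fade_var_pos: "fade_var l > 0"
  using var_pos[of l] by (simp add: fade_var_def)

lemma obs_var_pos: "obs_var l > 0"
  using fade_var_pos[of l] pilot_pos[of l] noise_pos by (simp add: obs_var_def add_pos_pos)

lemma gain_pos: "gain l > 0"
  using fade_var_pos[of l] pilot_pos[of l] obs_var_pos[of l] by (simp add: gain_def)

lemma est_var_pos: "est_var l > 0"
  using gain_pos[of l] obs_var_pos[of l] by (simp add: est_var_def)

lemma err_var_pos: "err_var l > 0"
  using fade_var_pos[of l] noise_pos obs_var_pos[of l] by (simp add: err_var_def)

lemma eff_noise_pos: "eff_noise l > 0"
  using err_var_pos[of l] symbol_pos[of l] noise_pos by (simp add: eff_noise_def add_pos_pos)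

lemma pilot_obs_measurable [measurable]: "pilot_obs c l t \<in> borel_measurable \<Omega>"
  unfolding pilot_obs_def[abs_def] by measurable

lemma mmse_est_eq: "mmse_est c l t \<omega> = of_real (gain l) * pilot_obs c l t \<omega>"
  by (simp add: mmse_est_def gain_def fade_var_def obs_var_def mult.commute)

lemma mmse_est_measurable [measurable]: "mmse_est c l t \<in> borel_measurable \<Omega>"
  unfolding mmse_est_eq[abs_def] by measurable

lemma est_err_measurable [measurable]: "est_err l t \<in> borel_measurable \<Omega>"
  unfolding est_err_def[abs_def] by measurable

lemma distr_pilot_pair:
  "distr \<Omega> (borel \<Otimes>\<^sub>M borel) (\<lambda>\<omega>. (\<omega> (Fade l t), \<omega> (PilotNoise l t))) = CN 0 (fade_var l) \<Otimes>\<^sub>M CN 0 (noise_var c)"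
proof -
  have "indep_var borel (\<lambda>\<omega>. \<omega> (Fade l t)) borel (\<lambda>\<omega>. \<omega> (PilotNoise l t))"
    using indep_disjoint_coords[of "{Fade l t}" "{PilotNoise l t}" "\<lambda>x. x (Fade l t)" borel "\<lambda>x. x (PilotNoise l t)" borel]
    by simp
  then show ?thesis
    unfolding indep_var_distribution_eq by (simp add: distr_coord fade_var_def)
qed

lemma distr_obs_err:
  "distr \<Omega> (borel \<Otimes>\<^sub>M borel) (\<lambda>\<omega>. (pilot_obs c l t \<omega>, est_err l t \<omega>)) = CN 0 (obs_var l) \<Otimes>\<^sub>M CN 0 (err_var l)"
proof -
  let ?r = "sqrt (pilot_energy c l)"
  let ?f = "\<lambda>(h, n). (of_real ?r * h + n, h - of_real (?r * fade_var l / obs_var l) * (of_real ?r * h + n)) :: complex \<times> complex"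
  have r2: "?r\<^sup>2 = pilot_energy c l" using pilot_pos[of l] by simp
  have "distr \<Omega> (borel \<Otimes>\<^sub>M borel) (\<lambda>\<omega>. (pilot_obs c l t \<omega>, est_err l t \<omega>))
      = distr \<Omega> (borel \<Otimes>\<^sub>M borel) (?f \<circ> (\<lambda>\<omega>. (\<omega> (Fade l t), \<omega> (PilotNoise l t))))"
    by (simp add: o_def est_err_def mmse_est_eq gain_def pilot_obs_def mult.commute)
  also have "\<dots> = distr (distr \<Omega> (borel \<Otimes>\<^sub>M borel) (\<lambda>\<omega>. (\<omega> (Fade l t), \<omega> (PilotNoise l t)))) (borel \<Otimes>\<^sub>M borel) ?f"
    by (subst distr_distr) (auto simp: case_prod_unfold)
  also have "\<dots> = CN 0 (obs_var l) \<Otimes>\<^sub>M CN 0 (err_var l)"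
    using distr_CN_estimation[OF fade_var_pos[of l] noise_pos, of ?r]
    unfolding distr_pilot_pair r2 obs_var_def[symmetric] err_var_def[symmetric] .
  finally show ?thesis .
qed

lemma distr_pilot_obs: "distr \<Omega> borel (pilot_obs c l t) = CN 0 (obs_var l)"
proof -
  interpret E: prob_space "CN 0 (err_var l)" using err_var_pos by (rule prob_space_CN)
  have "distr \<Omega> borel (pilot_obs c l t) = distr (distr \<Omega> (borel \<Otimes>\<^sub>M borel) (\<lambda>\<omega>. (pilot_obs c l t \<omega>, est_err l t \<omega>))) borel fst"
    by (subst distr_distr) (auto simp: o_def)
  also have "\<dots> = distr (CN 0 (obs_var l) \<Otimes>\<^sub>M CN 0 (err_var l)) (CN 0 (obs_var l)) fst"
    unfolding distr_obs_err by (intro distr_cong) auto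
  finally show ?thesis by (simp add: E.distr_pair_fst)
qed

lemma distr_est_err: "distr \<Omega> borel (est_err l t) = CN 0 (err_var l)"
proof -
  interpret Y: prob_space "CN 0 (obs_var l)" using obs_var_pos by (rule prob_space_CN)
  have "distr \<Omega> borel (est_err l t) = distr (distr \<Omega> (borel \<Otimes>\<^sub>M borel) (\<lambda>\<omega>. (pilot_obs c l t \<omega>, est_err l t \<omega>))) borel snd"
    by (subst distr_distr) (auto simp: o_def)
  also have "\<dots> = distr (CN 0 (obs_var l) \<Otimes>\<^sub>M CN 0 (err_var l)) (CN 0 (err_var l)) snd"
    unfolding distr_obs_err by (intro distr_cong) auto
  finally show ?thesis
    using prob_space_imp_sigma_finite[OF prob_space_CN[OF err_var_pos]] by (simp add: Y.distr_pair_snd)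
qed

lemma indep_obs_err: "indep_var borel (pilot_obs c l t) borel (est_err l t)"
  unfolding indep_var_distribution_eq distr_obs_err distr_pilot_obs distr_est_err by simp

lemma distr_mmse_est: "distr \<Omega> borel (mmse_est c l t) = CN 0 (est_var l)"
proof -
  have "distr \<Omega> borel (mmse_est c l t) = distr (distr \<Omega> borel (pilot_obs c l t)) borel (\<lambda>z. gain l *\<^sub>R z)"
    by (subst distr_distr) (auto simp: o_def mmse_est_eq[abs_def] scaleR_conv_of_real)
  then show ?thesis
    using distr_CN_scaleR[OF obs_var_pos, of "gain l" l] gain_pos[of l] by (simp add: distr_pilot_obs est_var_def)
qed

lemma indep_est_err: "indep_var borel (mmse_est c l t) borel (est_err l t)"
proof -
  have "indep_var borel ((\<lambda>z. of_real (gain l) * z) \<circ> pilot_obs c l t) borel ((\<lambda>z. z) \<circ> est_err l t)"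
    by (rule indep_var_compose[OF indep_obs_err]) measurable
  moreover have "(\<lambda>z. of_real (gain l) * z) \<circ> pilot_obs c l t = mmse_est c l t"
    by (rule ext) (simp only: o_def mmse_est_eq)
  moreover have "(\<lambda>z. z) \<circ> est_err l t = est_err l t" by (rule ext) (simp only: o_def)
  ultimately show ?thesis by (simp only:)
qed

lemma CN_distr_integral:
  fixes f :: "complex \<Rightarrow> 'b::{banach, second_countable_topology}"
  assumes "distr \<Omega> borel X = CN 0 v" "X \<in> borel_measurable \<Omega>" "f \<in> borel_measurable borel"
  shows "integrable \<Omega> (\<lambda>\<omega>. f (X \<omega>)) \<longleftrightarrow> integrable (CN 0 v) f"
    "expectation (\<lambda>\<omega>. f (X \<omega>)) = (LINT z|CN 0 v. f z)"
  using integrable_distr_eq[OF assms(2,3)] integral_distr[OF assms(2,3)] unfolding assms(1) by simp_all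

lemma CN_distr_moments:
  assumes "distr \<Omega> borel X = CN 0 v" "X \<in> borel_measurable \<Omega>" "v > 0"
  shows "integrable \<Omega> X" "expectation X = 0"
    "integrable \<Omega> (\<lambda>\<omega>. (cmod (X \<omega>))\<^sup>2)" "expectation (\<lambda>\<omega>. (cmod (X \<omega>))\<^sup>2) = v"
    "integrable \<Omega> (\<lambda>\<omega>. cmod (X \<omega>) ^ 4)"
proof -
  have m: "(\<lambda>z. (cmod z)\<^sup>2) \<in> borel_measurable borel" "(\<lambda>z. cmod z ^ 4) \<in> borel_measurable borel" by measurable
  show "integrable \<Omega> X"
    by (rule CN_distr_integral(1)[OF assms(1,2) measurable_ident_sets[OF refl], THEN iffD2]) (rule CN_integrable_id[OF assms(3)])
  show "expectation X = 0"
    by (rule trans[OF CN_distr_integral(2)[OF assms(1,2) measurable_ident_sets[OF refl]]]) (rule CN_mean[OF assms(3)])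
  show "integrable \<Omega> (\<lambda>\<omega>. (cmod (X \<omega>))\<^sup>2)"
    by (rule CN_distr_integral(1)[OF assms(1,2) m(1), THEN iffD2])
      (rule CN_square[OF assms(3), THEN has_bochner_integral_iff[THEN iffD1], THEN conjunct1])
  show "expectation (\<lambda>\<omega>. (cmod (X \<omega>))\<^sup>2) = v"
    by (rule trans[OF CN_distr_integral(2)[OF assms(1,2) m(1)]])
      (rule CN_square[OF assms(3), THEN has_bochner_integral_iff[THEN iffD1], THEN conjunct2])
  show "integrable \<Omega> (\<lambda>\<omega>. cmod (X \<omega>) ^ 4)"
    by (rule CN_distr_integral(1)[OF assms(1,2) m(2), THEN iffD2]) (rule CN_integrable_fourth[OF assms(3)])
qed

lemmas est_moments = CN_distr_moments[OF distr_mmse_est mmse_est_measurable est_var_pos]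
lemmas err_moments = CN_distr_moments[OF distr_est_err est_err_measurable err_var_pos]
lemmas coord_moments = CN_distr_moments[OF distr_coord coord_measurable rvar_var_pos]

section \<open>Product moments and the mean score\<close>

lemma est_err_product:
  fixes f g :: "complex \<Rightarrow> 'b::{real_normed_field, banach, second_countable_topology}"
  assumes "f \<in> borel_measurable borel" "g \<in> borel_measurable borel"
    and fg: "has_bochner_integral \<Omega> (\<lambda>\<omega>. f (mmse_est c l t \<omega>)) x" "has_bochner_integral \<Omega> (\<lambda>\<omega>. g (est_err l t \<omega>)) y"
  shows "has_bochner_integral \<Omega> (\<lambda>\<omega>. f (mmse_est c l t \<omega>) * g (est_err l t \<omega>)) (x * y)"
proof -
  have "indep_var borel (\<lambda>\<omega>. f (mmse_est c l t \<omega>)) borel (\<lambda>\<omega>. g (est_err l t \<omega>))"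
    using indep_var_compose[OF indep_est_err[of l t] assms(1,2)] by (simp add: o_def)
  from indep_var_integrable[OF this] indep_var_lebesgue_integral[OF this] show ?thesis
    using fg by (simp add: has_bochner_integral_iff)
qed

text \<open>Estimate and error of a block are functions of its fading coefficient and pilot noise,
  coordinates disjoint from the data noise.\<close>

lemma block_noise_product:
  fixes f :: "complex \<Rightarrow> complex \<Rightarrow> 'b::{real_normed_field, banach, second_countable_topology}"
  assumes "(\<lambda>(x, y). f x y) \<in> borel_measurable (borel \<Otimes>\<^sub>M borel)" "g \<in> borel_measurable borel"
    and fg: "has_bochner_integral \<Omega> (\<lambda>\<omega>. f (mmse_est c l t \<omega>) (est_err l t \<omega>)) x"
      "has_bochner_integral \<Omega> (\<lambda>\<omega>. g (\<omega> (DataNoise l t s))) y"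
  shows "has_bochner_integral \<Omega> (\<lambda>\<omega>. f (mmse_est c l t \<omega>) (est_err l t \<omega>) * g (\<omega> (DataNoise l t s))) (x * y)"
proof -
  let ?A = "{Fade l t, PilotNoise l t}" and ?B = "{DataNoise l t s}"
  have "indep_var borel (\<lambda>\<omega>. (\<lambda>x. f (mmse_est c l t x) (est_err l t x)) (restrict \<omega> ?A))
      borel (\<lambda>\<omega>. (\<lambda>x. g (x (DataNoise l t s))) (restrict \<omega> ?B))"
  proof (rule indep_disjoint_coords)
    have "(\<lambda>x. (mmse_est c l t x, est_err l t x)) \<in> Pi\<^sub>M ?A (\<lambda>_. borel) \<rightarrow>\<^sub>M borel \<Otimes>\<^sub>M borel"
      unfolding mmse_est_def est_err_def pilot_obs_def by measurable
    from measurable_compose[OF this assms(1)]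
    show "(\<lambda>x. f (mmse_est c l t x) (est_err l t x)) \<in> Pi\<^sub>M ?A (\<lambda>_. borel) \<rightarrow>\<^sub>M borel" by simp
    show "(\<lambda>x. g (x (DataNoise l t s))) \<in> Pi\<^sub>M ?B (\<lambda>_. borel) \<rightarrow>\<^sub>M borel"
      by (rule measurable_compose[OF _ assms(2)]) simp
  qed simp
  then have "indep_var borel (\<lambda>\<omega>. f (mmse_est c l t \<omega>) (est_err l t \<omega>)) borel (\<lambda>\<omega>. g (\<omega> (DataNoise l t s)))"
    by (simp add: mmse_est_def est_err_def pilot_obs_def)
  from indep_var_integrable[OF this] indep_var_lebesgue_integral[OF this] show ?thesis
    using fg by (simp add: has_bochner_integral_iff)
qed

abbreviation (input) wide :: "link \<Rightarrow> nat \<Rightarrow> real" where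
  "wide l \<nu> \<equiv> wide_energy (symbol_energy c l) \<nu>"

definition link_score :: "link \<Rightarrow> nat \<Rightarrow> nat \<Rightarrow> nat \<Rightarrow> complex \<Rightarrow> (rvar \<Rightarrow> complex) \<Rightarrow> real" where
  "link_score l \<nu> t s x \<omega> = score (symbol_energy c l) \<nu> (eff_noise l) (mmse_est c l t \<omega>) x
     (\<omega> (Fade l t) * x + \<omega> (DataNoise l t s))"

lemma link_score_measurable [measurable]: "link_score l \<nu> t s x \<in> borel_measurable \<Omega>"
  unfolding link_score_def[abs_def] by measurable

text \<open>The three laws involved do not depend on the block or the symbol, so one bound serves
  all \<open>t\<close> and \<open>s\<close>, as Chebyshev's inequality over many blocks
  requires.\<close>

lemma link_score_square_bound:
  "\<exists>V. \<forall>t s. integrable \<Omega> (\<lambda>\<omega>. (link_score l \<nu> t s x \<omega>)\<^sup>2) \<and> expectation (\<lambda>\<omega>. (link_score l \<nu> t s x \<omega>)\<^sup>2) \<le> V"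
proof -
  obtain C where C: "\<And>g h n. \<bar>score (symbol_energy c l) \<nu> (eff_noise l) g x (h * x + n)\<bar>
      \<le> C * (1 + (cmod g)\<^sup>2 + (cmod h)\<^sup>2 + (cmod n)\<^sup>2)" "C \<ge> 0"
    using score_quadratic_bound[OF symbol_pos[of l] eff_noise_pos[of l]] by metis
  let ?m4 = "\<lambda>v. LINT z|CN 0 v. cmod z ^ 4"
  let ?B = "\<lambda>t s \<omega>. 4 * C\<^sup>2 * (1 + cmod (mmse_est c l t \<omega>) ^ 4 + cmod (\<omega> (Fade l t)) ^ 4 + cmod (\<omega> (DataNoise l t s)) ^ 4)"
  let ?V = "4 * C\<^sup>2 * (1 + ?m4 (est_var l) + ?m4 (fade_var l) + ?m4 (noise_var c))"
  have le: "(link_score l \<nu> t s x \<omega>)\<^sup>2 \<le> ?B t s \<omega>" for t s \<omega>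
  proof -
    \<comment> \<open>Cauchy-Schwarz for four summands; the defect is the sum of the squared
      pairwise differences.\<close>
    have four: "(1 + a + b + d)\<^sup>2 \<le> 4 * (1 + a\<^sup>2 + b\<^sup>2 + d\<^sup>2)" for a b d :: real
    proof -
      have "4 * (1 + a\<^sup>2 + b\<^sup>2 + d\<^sup>2) - (1 + a + b + d)\<^sup>2
          = (1 - a)\<^sup>2 + (1 - b)\<^sup>2 + (1 - d)\<^sup>2 + (a - b)\<^sup>2 + (a - d)\<^sup>2 + (b - d)\<^sup>2"
        by (simp add: power2_eq_square algebra_simps)
      then show ?thesis by (smt (verit) zero_le_power2)
    qed
    have "\<bar>link_score l \<nu> t s x \<omega>\<bar>\<^sup>2
        \<le> (C * (1 + (cmod (mmse_est c l t \<omega>))\<^sup>2 + (cmod (\<omega> (Fade l t)))\<^sup>2 + (cmod (\<omega> (DataNoise l t s)))\<^sup>2))\<^sup>2"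
      unfolding link_score_def by (intro power_mono C) simp
    also have "\<dots> \<le> C\<^sup>2 * (4 * (1 + ((cmod (mmse_est c l t \<omega>))\<^sup>2)\<^sup>2 + ((cmod (\<omega> (Fade l t)))\<^sup>2)\<^sup>2 + ((cmod (\<omega> (DataNoise l t s)))\<^sup>2)\<^sup>2))"
      unfolding power_mult_distrib by (intro mult_left_mono four) simp
    finally show ?thesis by (simp add: algebra_simps flip: power_mult)
  qed
  have B: "integrable \<Omega> (?B t s)" "expectation (?B t s) = ?V" for t s
  proof -
    have m4: "expectation (\<lambda>\<omega>. cmod (mmse_est c l t \<omega>) ^ 4) = ?m4 (est_var l)"
      "expectation (\<lambda>\<omega>. cmod (\<omega> (Fade l t)) ^ 4) = ?m4 (fade_var l)"
      "expectation (\<lambda>\<omega>. cmod (\<omega> (DataNoise l t s)) ^ 4) = ?m4 (noise_var c)"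
      using CN_distr_integral(2)[OF distr_mmse_est mmse_est_measurable, of "\<lambda>z. cmod z ^ 4" l t]
        CN_distr_integral(2)[OF distr_coord coord_measurable, of "\<lambda>z. cmod z ^ 4"]
      by (simp_all add: fade_var_def)
    show "integrable \<Omega> (?B t s)" using est_moments(5) coord_moments(5) by simp
    show "expectation (?B t s) = ?V"
      using est_moments(5)[of l t] coord_moments(5) m4 by (simp add: prob_space)
  qed
  have int: "integrable \<Omega> (\<lambda>\<omega>. (link_score l \<nu> t s x \<omega>)\<^sup>2)" for t s
  proof (rule Bochner_Integration.integrable_bound[OF B(1)])
    have "norm ((link_score l \<nu> t s x \<omega>)\<^sup>2) \<le> norm (?B t s \<omega>)" for \<omega>
      using le[of t s \<omega>] by (smt (verit) real_norm_def zero_le_power2)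
    then show "AE \<omega> in \<Omega>. norm ((link_score l \<nu> t s x \<omega>)\<^sup>2) \<le> norm (?B t s \<omega>)" by simp
  qed simp
  have "expectation (\<lambda>\<omega>. (link_score l \<nu> t s x \<omega>)\<^sup>2) \<le> ?V" for t s
  proof -
    have "expectation (\<lambda>\<omega>. (link_score l \<nu> t s x \<omega>)\<^sup>2) \<le> expectation (?B t s)"
      by (rule integral_mono[OF int B(1) le])
    then show ?thesis unfolding B(2) .
  qed
  then show ?thesis using int by blast
qed

text \<open>With \<open>inv_power\<close>, the ingredients of the score that depend on the estimate
  alone: the score is \<open>log_part\<close>, minus the scaled squared residual, plus
  \<open>inv_power\<close> times the output energy.\<close>

definition log_part :: "link \<Rightarrow> nat \<Rightarrow> complex \<Rightarrow> real" where
  "log_part l \<nu> g = ln (1 + (cmod g)\<^sup>2 * wide l \<nu> / eff_noise l)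
     - 2 * (qam_slack \<nu> ((cmod g)\<^sup>2 * wide l \<nu> / eff_noise l) - 1)"

definition inv_power :: "link \<Rightarrow> nat \<Rightarrow> complex \<Rightarrow> real" where
  "inv_power l \<nu> g = 1 / ((cmod g)\<^sup>2 * wide l \<nu> + eff_noise l)"

lemma wide_pos: "wide l \<nu> > 0"
  using symbol_pos[of l] by (rule wide_energy_pos)

lemma log_part_measurable [measurable]: "log_part l \<nu> \<in> borel_measurable borel"
  unfolding log_part_def[abs_def] by measurable

lemma inv_power_measurable [measurable]: "inv_power l \<nu> \<in> borel_measurable borel"
  unfolding inv_power_def[abs_def] by measurable

lemma inv_power_bounds: "0 \<le> inv_power l \<nu> g" "inv_power l \<nu> g \<le> 1 / eff_noise l"
proof -
  have z: "0 \<le> (cmod g)\<^sup>2 * wide l \<nu>" using wide_pos[of l \<nu>] by simp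
  then show "0 \<le> inv_power l \<nu> g" using eff_noise_pos[of l] by (simp add: inv_power_def)
  show "inv_power l \<nu> g \<le> 1 / eff_noise l"
    using z eff_noise_pos[of l] unfolding inv_power_def by (intro divide_left_mono) (auto intro: add_nonneg_pos)
qed

lemma est_expectation:
  fixes f :: "complex \<Rightarrow> real"
  assumes [measurable]: "f \<in> borel_measurable borel" and "\<And>g. \<bar>f g\<bar> \<le> A + B * (cmod g)\<^sup>2"
  shows "has_bochner_integral \<Omega> (\<lambda>\<omega>. f (mmse_est c l t \<omega>)) (LINT g|CN 0 (est_var l). f g)"
    "integrable (CN 0 (est_var l)) f"
proof -
  have int: "integrable \<Omega> (\<lambda>\<omega>. f (mmse_est c l t \<omega>))" for t
  proof (rule Bochner_Integration.integrable_bound)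
    show "integrable \<Omega> (\<lambda>\<omega>. A + B * (cmod (mmse_est c l t \<omega>))\<^sup>2)" using est_moments(3) by simp
    have "norm (f g) \<le> norm (A + B * (cmod g)\<^sup>2)" for g
      using assms(2)[of g] by simp
    then show "AE \<omega> in \<Omega>. norm (f (mmse_est c l t \<omega>)) \<le> norm (A + B * (cmod (mmse_est c l t \<omega>))\<^sup>2)" by simp
  qed measurable
  show "has_bochner_integral \<Omega> (\<lambda>\<omega>. f (mmse_est c l t \<omega>)) (LINT g|CN 0 (est_var l). f g)"
    using int CN_distr_integral(2)[OF distr_mmse_est mmse_est_measurable assms(1)] by (simp add: has_bochner_integral_iff)
  show "integrable (CN 0 (est_var l)) f"
    using int CN_distr_integral(1)[OF distr_mmse_est mmse_est_measurable assms(1)] by simp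
qed

lemma ln_snr_bounds:
  assumes "E \<ge> 0"
  shows "0 \<le> ln (1 + (cmod g)\<^sup>2 * E / eff_noise l)"
    "ln (1 + (cmod g)\<^sup>2 * E / eff_noise l) \<le> E / eff_noise l * (cmod g)\<^sup>2"
proof -
  have z: "0 \<le> (cmod g)\<^sup>2 * E / eff_noise l" using assms eff_noise_pos[of l] by simp
  then show "0 \<le> ln (1 + (cmod g)\<^sup>2 * E / eff_noise l)" by simp
  show "ln (1 + (cmod g)\<^sup>2 * E / eff_noise l) \<le> E / eff_noise l * (cmod g)\<^sup>2"
    using ln_add_one_self_le_self[OF z] by (simp add: mult.commute)
qed

lemma qam_slack_quadratic_bound:
  "\<bar>qam_slack \<nu> ((cmod g)\<^sup>2 * wide l \<nu> / eff_noise l)\<bar>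
    \<le> (central_prob \<nu> * sqrt (pi * (real \<nu> + 1 / 2)) + 2 * central_prob \<nu>)
      + 2 * central_prob \<nu> * wide l \<nu> / eff_noise l * (cmod g)\<^sup>2"
proof -
  have z: "0 \<le> (cmod g)\<^sup>2 * wide l \<nu> / eff_noise l" using wide_pos[of l \<nu>] eff_noise_pos[of l] by simp
  show ?thesis using qam_slack_bounds[OF z, of \<nu>] by (simp add: algebra_simps)
qed

lemma log_part_bound:
  "\<exists>A B. \<forall>g. \<bar>log_part l \<nu> g\<bar> \<le> A + B * (cmod g)\<^sup>2"
proof -
  define q p r where "q = central_prob \<nu> * sqrt (pi * (real \<nu> + 1 / 2)) + 2 * central_prob \<nu>"
    and "p = 2 * central_prob \<nu> * wide l \<nu> / eff_noise l" and "r = wide l \<nu> / eff_noise l"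
  have "\<bar>log_part l \<nu> g\<bar> \<le> (2 + 2 * q) + (r + 2 * p) * (cmod g)\<^sup>2" for g
    using ln_snr_bounds[of "wide l \<nu>" g l] qam_slack_quadratic_bound[of \<nu> g l] wide_pos[of l \<nu>]
    unfolding log_part_def p_def[symmetric] q_def[symmetric] r_def[symmetric] distrib_right by simp
  then show ?thesis by blast
qed

lemma inv_power_square_bound: "\<bar>inv_power l \<nu> g * (cmod g)\<^sup>2\<bar> \<le> 0 + 1 / eff_noise l * (cmod g)\<^sup>2"
proof -
  have "inv_power l \<nu> g * (cmod g)\<^sup>2 \<le> 1 / eff_noise l * (cmod g)\<^sup>2"
    by (intro mult_right_mono inv_power_bounds) simp
  moreover have "0 \<le> inv_power l \<nu> g * (cmod g)\<^sup>2" using inv_power_bounds(1)[of l \<nu> g] by simp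
  ultimately show ?thesis by simp
qed

end

lemma cmod_add_power2: "(cmod (a + b))\<^sup>2 = (cmod a)\<^sup>2 + (cmod b)\<^sup>2 + 2 * Re (a * cnj b)"
  unfolding cmod_power2 by (simp add: power2_eq_square algebra_simps)

context training_channel
begin

lemma est_functions_expectation:
  "has_bochner_integral \<Omega> (\<lambda>\<omega>. log_part l \<nu> (mmse_est c l t \<omega>)) (LINT g|CN 0 (est_var l). log_part l \<nu> g)"
  "has_bochner_integral \<Omega> (\<lambda>\<omega>. inv_power l \<nu> (mmse_est c l t \<omega>)) (LINT g|CN 0 (est_var l). inv_power l \<nu> g)"
  "has_bochner_integral \<Omega> (\<lambda>\<omega>. inv_power l \<nu> (mmse_est c l t \<omega>) * (cmod (mmse_est c l t \<omega>))\<^sup>2)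
    (LINT g|CN 0 (est_var l). inv_power l \<nu> g * (cmod g)\<^sup>2)"
  and est_functions_integrable:
  "integrable (CN 0 (est_var l)) (log_part l \<nu>)" "integrable (CN 0 (est_var l)) (inv_power l \<nu>)"
  "integrable (CN 0 (est_var l)) (\<lambda>g. inv_power l \<nu> g * (cmod g)\<^sup>2)"
proof -
  obtain A B where "\<And>g. \<bar>log_part l \<nu> g\<bar> \<le> A + B * (cmod g)\<^sup>2" using log_part_bound[of l \<nu>] by blast
  note log = est_expectation[OF log_part_measurable this]
  have "\<bar>inv_power l \<nu> g\<bar> \<le> 1 / eff_noise l + 0 * (cmod g)\<^sup>2" for g
    using inv_power_bounds[of l \<nu> g] by simp
  note inv = est_expectation[OF inv_power_measurable this]
  have "(\<lambda>g. inv_power l \<nu> g * (cmod g)\<^sup>2) \<in> borel_measurable borel" by measurable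
  note sq = est_expectation[OF this inv_power_square_bound]
  show "has_bochner_integral \<Omega> (\<lambda>\<omega>. log_part l \<nu> (mmse_est c l t \<omega>)) (LINT g|CN 0 (est_var l). log_part l \<nu> g)"
    "integrable (CN 0 (est_var l)) (log_part l \<nu>)" by (fact log)+
  show "has_bochner_integral \<Omega> (\<lambda>\<omega>. inv_power l \<nu> (mmse_est c l t \<omega>)) (LINT g|CN 0 (est_var l). inv_power l \<nu> g)"
    "integrable (CN 0 (est_var l)) (inv_power l \<nu>)" by (fact inv)+
  show "has_bochner_integral \<Omega> (\<lambda>\<omega>. inv_power l \<nu> (mmse_est c l t \<omega>) * (cmod (mmse_est c l t \<omega>))\<^sup>2)
      (LINT g|CN 0 (est_var l). inv_power l \<nu> g * (cmod g)\<^sup>2)"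
    "integrable (CN 0 (est_var l)) (\<lambda>g. inv_power l \<nu> g * (cmod g)\<^sup>2)" by (fact sq)+
qed

text \<open>Expanding the squares leaves the energies of estimate, error and noise, and cross terms
  that each contain error or noise as an independent centred factor. The input survives only through
  \<open>(cmod x)\<^sup>2\<close>.\<close>

lemma link_score_mean:
  defines "L \<equiv> \<lambda>l \<nu>. LINT g|CN 0 (est_var l). log_part l \<nu> g"
    and "S \<equiv> \<lambda>l \<nu>. LINT g|CN 0 (est_var l). inv_power l \<nu> g * (cmod g)\<^sup>2"
    and "F \<equiv> \<lambda>l \<nu>. LINT g|CN 0 (est_var l). inv_power l \<nu> g"
  shows "expectation (link_score l \<nu> t s x)
    = L l \<nu> - ((cmod x)\<^sup>2 * err_var l + noise_var c) / eff_noise l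
      + ((cmod x)\<^sup>2 * S l \<nu> + ((cmod x)\<^sup>2 * err_var l + noise_var c) * F l \<nu>)"
proof -
  let ?v = "eff_noise l" and ?X = "(cmod x)\<^sup>2"
  let ?g = "mmse_est c l t" and ?u = "est_err l t" and ?n = "\<lambda>\<omega>. \<omega> (DataNoise l t s) :: complex"
  let ?F = "\<lambda>g. inv_power l \<nu> g"
  note hbi = has_bochner_integral_iff
  have hL: "has_bochner_integral \<Omega> (\<lambda>\<omega>. log_part l \<nu> (?g \<omega>)) (L l \<nu>)"
    and hF: "has_bochner_integral \<Omega> (\<lambda>\<omega>. ?F (?g \<omega>)) (F l \<nu>)"
    and hS: "has_bochner_integral \<Omega> (\<lambda>\<omega>. ?F (?g \<omega>) * (cmod (?g \<omega>))\<^sup>2) (S l \<nu>)"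
    unfolding L_def F_def S_def by (rule est_functions_expectation)+
  have hu: "has_bochner_integral \<Omega> (\<lambda>\<omega>. (cmod (?u \<omega>))\<^sup>2) (err_var l)"
    using err_moments by (simp add: hbi)
  have hn: "has_bochner_integral \<Omega> (\<lambda>\<omega>. (cmod (?n \<omega>))\<^sup>2) (noise_var c)"
    using coord_moments(3,4)[of "DataNoise l t s"] by (simp add: hbi)
  have hFu: "has_bochner_integral \<Omega> (\<lambda>\<omega>. ?F (?g \<omega>) * (cmod (?u \<omega>))\<^sup>2) (F l \<nu> * err_var l)"
    using est_err_product[of ?F "\<lambda>u. (cmod u)\<^sup>2", OF _ _ hF hu] by simp
  have hFn: "has_bochner_integral \<Omega> (\<lambda>\<omega>. ?F (?g \<omega>) * (cmod (?n \<omega>))\<^sup>2) (F l \<nu> * noise_var c)"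
    using block_noise_product[of "\<lambda>g u. ?F g" "\<lambda>n. (cmod n)\<^sup>2", OF _ _ hF hn] by simp
  have hcn: "has_bochner_integral \<Omega> (\<lambda>\<omega>. cnj (?n \<omega>)) 0"
    using coord_moments(1,2)[of "DataNoise l t s"] by (simp add: hbi)
  have hcu: "has_bochner_integral \<Omega> (\<lambda>\<omega>. cnj (?u \<omega>)) 0"
    using err_moments(1,2)[of l t] by (simp add: hbi)
  \<comment> \<open>\<open>inv_power\<close> is bounded, so weighting by it keeps
    integrability.\<close>
  have Fbd: "integrable \<Omega> (\<lambda>\<omega>. of_real (?F (?g \<omega>)) * Z \<omega> :: complex)" if "integrable \<Omega> Z" for Z
  proof (rule Bochner_Integration.integrable_bound[OF integrable_mult_right])
    show "integrable \<Omega> Z" by fact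
    have "cmod (of_real (?F g) * z) \<le> cmod (of_real (1 / ?v) * z)" for g z
      using inv_power_bounds[of l \<nu> g] eff_noise_pos[of l]
      by (simp only: norm_mult norm_of_real) (intro mult_right_mono, auto)
    then show "AE \<omega> in \<Omega>. norm (of_real (?F (?g \<omega>)) * Z \<omega>) \<le> norm (complex_of_real (1 / ?v) * Z \<omega>)"
      by simp
  qed (use borel_measurable_integrable[OF that] in measurable)
  have hun: "has_bochner_integral \<Omega> (\<lambda>\<omega>. ?u \<omega> * cnj (?n \<omega>)) 0"
    using block_noise_product[of "\<lambda>g u. u" cnj l t 0 s 0] err_moments(1,2)[of l t] hcn by (simp add: hbi)
  have Fg: "has_bochner_integral \<Omega> (\<lambda>\<omega>. of_real (?F (?g \<omega>)) * ?g \<omega>) (expectation (\<lambda>\<omega>. of_real (?F (?g \<omega>)) * ?g \<omega>))"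
    and Fu: "has_bochner_integral \<Omega> (\<lambda>\<omega>. of_real (?F (?g \<omega>)) * ?u \<omega>) (expectation (\<lambda>\<omega>. of_real (?F (?g \<omega>)) * ?u \<omega>))"
    by (intro has_bochner_integral_integrable Fbd est_moments err_moments)+
  have hFgu: "has_bochner_integral \<Omega> (\<lambda>\<omega>. of_real (?F (?g \<omega>)) * ?g \<omega> * cnj (?u \<omega>)) 0"
    using est_err_product[of "\<lambda>g. of_real (?F g) * g" cnj, OF _ _ Fg hcu] by simp
  have hFgn: "has_bochner_integral \<Omega> (\<lambda>\<omega>. of_real (?F (?g \<omega>)) * ?g \<omega> * cnj (?n \<omega>)) 0"
    using block_noise_product[of "\<lambda>g u. of_real (?F g) * g" cnj, OF _ _ Fg hcn] by simp
  have hFun: "has_bochner_integral \<Omega> (\<lambda>\<omega>. of_real (?F (?g \<omega>)) * ?u \<omega> * cnj (?n \<omega>)) 0"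
    using block_noise_product[of "\<lambda>g u. of_real (?F g) * u" cnj, OF _ _ Fu hcn] by simp
  \<comment> \<open>Common shape of all cross terms, with \<open>Z\<close> of mean zero; the literal
    factor 1 in \<open>split\<close> serves to match it.\<close>
  have re: "has_bochner_integral \<Omega> (\<lambda>\<omega>. 2 * Re (x * Z \<omega>)) (2 * Re (x * 0))" if "has_bochner_integral \<Omega> Z 0" for x Z
  proof -
    have "has_bochner_integral \<Omega> (\<lambda>\<omega>. x * Z \<omega>) (x * 0)"
      by (rule has_bochner_integral_mult_right) (rule that)
    then have "has_bochner_integral \<Omega> (\<lambda>\<omega>. Re (x * Z \<omega>)) (Re (x * 0))"
      by (rule has_bochner_integral_bounded_linear[OF bounded_linear_Re])
    then show ?thesis by (intro has_bochner_integral_mult_right)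
  qed
  have split: "link_score l \<nu> t s x \<omega> = log_part l \<nu> (?g \<omega>)
      - (?X * (cmod (?u \<omega>))\<^sup>2 + (cmod (?n \<omega>))\<^sup>2 + 2 * Re (x * (?u \<omega> * cnj (?n \<omega>)))) / ?v
      + (?X * (?F (?g \<omega>) * (cmod (?g \<omega>))\<^sup>2) + ?X * (?F (?g \<omega>) * (cmod (?u \<omega>))\<^sup>2) + ?F (?g \<omega>) * (cmod (?n \<omega>))\<^sup>2
        + ?X * (2 * Re (1 * (of_real (?F (?g \<omega>)) * ?g \<omega> * cnj (?u \<omega>))))
        + 2 * Re (x * (of_real (?F (?g \<omega>)) * ?g \<omega> * cnj (?n \<omega>)))
        + 2 * Re (x * (of_real (?F (?g \<omega>)) * ?u \<omega> * cnj (?n \<omega>))))" for \<omega>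
  proof -
    define g u n where "g = ?g \<omega>" and "u = ?u \<omega>" and "n = ?n \<omega>"
    have h: "\<omega> (Fade l t) = g + u" by (simp add: g_def u_def est_err_def)
    have w: "(cmod (u * x + n))\<^sup>2 = ?X * (cmod u)\<^sup>2 + (cmod n)\<^sup>2 + 2 * Re (x * (u * cnj n))"
      unfolding cmod_add_power2 norm_mult power_mult_distrib by (simp add: algebra_simps)
    have y: "(cmod ((g + u) * x + n))\<^sup>2 = ?X * (cmod g)\<^sup>2 + ?X * (2 * Re (g * cnj u)) + 2 * Re (x * (g * cnj n)) + (cmod (u * x + n))\<^sup>2"
    proof -
      have "(g + u) * x + n = g * x + (u * x + n)" by (simp add: algebra_simps)
      then have "(cmod ((g + u) * x + n))\<^sup>2 = (cmod (g * x))\<^sup>2 + (cmod (u * x + n))\<^sup>2 + 2 * Re (g * x * cnj (u * x + n))"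
        by (simp only: cmod_add_power2)
      also have "g * x * cnj (u * x + n) = (x * cnj x) * (g * cnj u) + x * (g * cnj n)"
        by (simp add: algebra_simps)
      also have "x * cnj x = of_real ?X" by (rule complex_norm_square[symmetric])
      finally show ?thesis by (simp add: norm_mult power_mult_distrib algebra_simps)
    qed
    have eq: "(g + u) * x + n - g * x = u * x + n" by (simp add: algebra_simps)
    have "link_score l \<nu> t s x \<omega> = log_part l \<nu> g - (cmod (u * x + n))\<^sup>2 / ?v + ?F g * (cmod ((g + u) * x + n))\<^sup>2"
      by (simp only: link_score_def score_def Let_def h g_def[symmetric] n_def[symmetric] eq log_part_def inv_power_def) simp
    also have "\<dots> = log_part l \<nu> g - (?X * (cmod u)\<^sup>2 + (cmod n)\<^sup>2 + 2 * Re (x * (u * cnj n))) / ?v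
      + (?X * (?F g * (cmod g)\<^sup>2) + ?X * (?F g * (cmod u)\<^sup>2) + ?F g * (cmod n)\<^sup>2
        + ?X * (2 * (?F g * Re (g * cnj u))) + 2 * (?F g * Re (x * (g * cnj n))) + 2 * (?F g * Re (x * (u * cnj n))))"
      unfolding y w by (simp add: algebra_simps)
    also have "?F g * Re (g * cnj u) = Re (1 * (of_real (?F g) * g * cnj u))" by (simp add: algebra_simps)
    also have "?F g * Re (x * (g * cnj n)) = Re (x * (of_real (?F g) * g * cnj n))"
      by (simp add: algebra_simps)
    also have "?F g * Re (x * (u * cnj n)) = Re (x * (of_real (?F g) * u * cnj n))"
      by (simp add: algebra_simps)
    finally show ?thesis unfolding g_def u_def n_def .
  qed
  have "has_bochner_integral \<Omega> (link_score l \<nu> t s x)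
    (L l \<nu> - (?X * err_var l + noise_var c + 2 * Re (x * 0)) / ?v
      + (?X * S l \<nu> + ?X * (F l \<nu> * err_var l) + F l \<nu> * noise_var c
        + ?X * (2 * Re (1 * 0)) + 2 * Re (x * 0) + 2 * Re (x * 0)))"
    unfolding split[abs_def]
    by (rule has_bochner_integral_add has_bochner_integral_diff has_bochner_integral_divide_zero
        re[OF hun] re[OF hFgu] re[OF hFgn] re[OF hFun] hL hS hF hFu hFn hu hn has_bochner_integral_mult_right)+
  then have "expectation (link_score l \<nu> t s x) = (L l \<nu> - (?X * err_var l + noise_var c + 2 * Re (x * 0)) / ?v
      + (?X * S l \<nu> + ?X * (F l \<nu> * err_var l) + F l \<nu> * noise_var c
        + ?X * (2 * Re (1 * 0)) + 2 * Re (x * 0) + 2 * Re (x * 0)))"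
    by (rule has_bochner_integral_integral_eq)
  then show ?thesis by (simp add: algebra_simps)
qed

text \<open>Mean score per data symbol, averaged over the constellation. The \<open>- 1\<close> is
  the mean of the scaled residual; the bracket is the mean output energy given the estimate
  \<open>g\<close>. As \<open>inv_power\<close> is built with the slightly larger wide energy, the
  two almost cancel.\<close>

definition rate :: "link \<Rightarrow> nat \<Rightarrow> real" where
  "rate l \<nu> = (LINT g|CN 0 (est_var l). log_part l \<nu> g - 1
     + ((cmod g)\<^sup>2 * symbol_energy c l + eff_noise l) * inv_power l \<nu> g)"

text \<open>Ergodic rate, in nats per data symbol, of a Gaussian input over a known coefficient with
  Gaussian noise of variance \<open>eff_noise\<close>.\<close>

definition capacity :: "link \<Rightarrow> real" where
  "capacity l = (LINT g|CN 0 (est_var l). ln (1 + (cmod g)\<^sup>2 * symbol_energy c l / eff_noise l))"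

text \<open>The mean score is affine in \<open>(cmod x)\<^sup>2\<close>, so the constellation enters
  only through its total energy, which is exact.\<close>

lemma sum_link_score_mean:
  assumes "\<nu> > 0"
  shows "(\<Sum>d<16 ^ \<nu>. expectation (link_score l \<nu> t s (qam (symbol_energy c l) \<nu> d))) = 16 ^ \<nu> * rate l \<nu>"
proof -
  define L S F where "L = (LINT g|CN 0 (est_var l). log_part l \<nu> g)"
    and "S = (LINT g|CN 0 (est_var l). inv_power l \<nu> g * (cmod g)\<^sup>2)"
    and "F = (LINT g|CN 0 (est_var l). inv_power l \<nu> g)"
  define E where "E = symbol_energy c l"
  interpret P: prob_space "CN 0 (est_var l)" using est_var_pos by (rule prob_space_CN)
  have "rate l \<nu> = (LINT g|CN 0 (est_var l). log_part l \<nu> g - 1 + (E * (inv_power l \<nu> g * (cmod g)\<^sup>2) + eff_noise l * inv_power l \<nu> g))"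
    unfolding rate_def E_def by (intro Bochner_Integration.integral_cong) (auto simp: algebra_simps)
  then have rate: "rate l \<nu> = L - 1 + (E * S + eff_noise l * F)"
    using P.prob_space est_functions_integrable[of l \<nu>] by (simp add: L_def S_def F_def)
  have energy: "(\<Sum>d<16 ^ \<nu>. (cmod (qam E \<nu> d))\<^sup>2) = 16 ^ \<nu> * E"
    using assms symbol_pos by (intro qam_energy) (simp_all add: E_def)
  have mean: "expectation (link_score l \<nu> t s x)
      = (L - noise_var c / eff_noise l + noise_var c * F) + (cmod x)\<^sup>2 * (S + err_var l * F - err_var l / eff_noise l)" for x
    unfolding link_score_mean L_def[symmetric] S_def[symmetric] F_def[symmetric]
    by (simp add: add_divide_distrib algebra_simps)
  have "(\<Sum>d<16 ^ \<nu>. expectation (link_score l \<nu> t s (qam E \<nu> d)))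
      = 16 ^ \<nu> * ((L - noise_var c / eff_noise l + noise_var c * F) + E * (S + err_var l * F - err_var l / eff_noise l))"
    unfolding mean by (simp only: sum.distrib sum_distrib_right[symmetric] energy) (simp add: distrib_left)
  also have "(L - noise_var c / eff_noise l + noise_var c * F) + E * (S + err_var l * F - err_var l / eff_noise l)
      = L - (noise_var c / eff_noise l + E * err_var l / eff_noise l) + (E * S + (noise_var c + E * err_var l) * F)"
    by (simp add: algebra_simps)
  also have "noise_var c + E * err_var l = eff_noise l" by (simp add: eff_noise_def E_def)
  also have "noise_var c / eff_noise l + E * err_var l / eff_noise l = eff_noise l / eff_noise l"
    unfolding add_divide_distrib[symmetric] by (simp add: eff_noise_def E_def)
  also have "L - eff_noise l / eff_noise l + (E * S + eff_noise l * F) = rate l \<nu>" using eff_noise_pos[of l] by (simp add: rate)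
  finally show ?thesis by (simp add: E_def)
qed

text \<open>The subtracted terms are the two parts of \<open>qam_slack\<close>, the second made
  linear, and the mismatch between the symbol energy and the wide energy. Each tends to 0.\<close>

lemma rate_lower_bound:
  "rate l \<nu> \<ge> capacity l - 2 * (central_prob \<nu> * sqrt (pi * (real \<nu> + 1 / 2)) - 1)
     - 4 * central_prob \<nu> * (1 + est_var l * wide l \<nu> / eff_noise l) - (1 - symbol_energy c l / wide l \<nu>)"
proof -
  define E W v p q where "E = symbol_energy c l" and "W = wide l \<nu>" and "v = eff_noise l"
    and "p = central_prob \<nu>" and "q = central_prob \<nu> * sqrt (pi * (real \<nu> + 1 / 2))"
  have pos: "E > 0" "W > 0" "v > 0" using symbol_pos wide_pos eff_noise_pos by (simp_all add: E_def W_def v_def)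
  have EW: "E \<le> W" using pos by (simp add: E_def W_def wide_energy_def)
  interpret P: prob_space "CN 0 (est_var l)" using est_var_pos by (rule prob_space_CN)
  have sq: "integrable (CN 0 (est_var l)) (\<lambda>g. (cmod g)\<^sup>2)" "(LINT g|CN 0 (est_var l). (cmod g)\<^sup>2) = est_var l"
    using CN_square[OF est_var_pos[of l]] by (auto simp: has_bochner_integral_iff)
  have cap: "integrable (CN 0 (est_var l)) (\<lambda>g. ln (1 + (cmod g)\<^sup>2 * E / v))"
    by (rule est_expectation(2)[where A=0 and B="E / v"])
      (use ln_snr_bounds[of E _ l] pos in \<open>auto simp: v_def\<close>)
  have "integrable (CN 0 (est_var l)) (\<lambda>g. log_part l \<nu> g - 1 + (E * (inv_power l \<nu> g * (cmod g)\<^sup>2) + v * inv_power l \<nu> g))"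
    using est_functions_integrable[of l \<nu>] by simp
  then have int: "integrable (CN 0 (est_var l)) (\<lambda>g. log_part l \<nu> g - 1 + ((cmod g)\<^sup>2 * E + v) * inv_power l \<nu> g)"
    by (simp add: algebra_simps)
  let ?low = "\<lambda>g. ln (1 + (cmod g)\<^sup>2 * E / v) - 2 * (q - 1) - 4 * p * (1 + (cmod g)\<^sup>2 * (W / v)) - (1 - E / W)"
  have "(LINT g|CN 0 (est_var l). ?low g) \<le> rate l \<nu>"
    unfolding rate_def E_def[symmetric] v_def[symmetric]
  proof (intro integral_mono int)
    show "integrable (CN 0 (est_var l)) ?low" using cap sq by simp
    fix g
    define z where "z = (cmod g)\<^sup>2"
    have z: "z \<ge> 0" "0 \<le> z * W / v" using pos by (simp_all add: z_def)
    have "ln (1 + z * E / v) \<le> ln (1 + z * W / v)"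
      using z pos EW by (subst ln_le_cancel_iff) (auto intro!: add_pos_nonneg divide_right_mono mult_left_mono)
    moreover have "qam_slack \<nu> (z * W / v) \<le> q + 2 * (p * (1 + z * (W / v)))"
      using qam_slack_bounds(2)[OF z(2), of \<nu>] by (simp add: p_def q_def)
    \<comment> \<open>As \<open>E \<le> W\<close>, the ratio decreases in \<open>z\<close> towards
      its limit \<open>E / W\<close>.\<close>
    moreover have "E / W \<le> (z * E + v) * (1 / (z * W + v))"
    proof -
      have "E * (z * W + v) \<le> (z * E + v) * W"
        using pos EW by (simp add: algebra_simps)
      moreover have "z * W + v > 0" using z pos by (simp add: add_nonneg_pos)
      ultimately show ?thesis using pos by (simp add: frac_le_eq field_simps)
    qed
    moreover have aux: "a - 2 * (q - 1) - 4 * k - (1 - e) \<le> b - 2 * (s - 1) - 1 + r"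
      if "a \<le> b" "s \<le> q + 2 * k" "e \<le> r" for a b s k e r :: real
      using that by (simp add: algebra_simps)
    ultimately have "ln (1 + z * E / v) - 2 * (q - 1) - 4 * (p * (1 + z * (W / v))) - (1 - E / W)
        \<le> ln (1 + z * W / v) - 2 * (qam_slack \<nu> (z * W / v) - 1) - 1 + (z * E + v) * (1 / (z * W + v))"
      by - (rule aux; assumption)
    then show "?low g \<le> log_part l \<nu> g - 1 + ((cmod g)\<^sup>2 * E + v) * inv_power l \<nu> g"
      by (simp add: log_part_def inv_power_def z_def W_def v_def mult.assoc)
  qed
  also have "(LINT g|CN 0 (est_var l). ?low g) = capacity l - 2 * (q - 1) - 4 * p * (1 + est_var l * (W / v)) - (1 - E / W)"
    using cap sq P.prob_space by (simp add: capacity_def E_def v_def)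
  finally show ?thesis by (simp add: E_def W_def v_def p_def q_def)
qed

lemma rate_eventually:
  assumes "\<epsilon> > 0"
  shows "\<forall>\<^sub>F \<nu> in sequentially. capacity l - \<epsilon> < rate l \<nu>"
proof -
  let ?low = "\<lambda>\<nu>. capacity l - 2 * (central_prob \<nu> * sqrt (pi * (real \<nu> + 1 / 2)) - 1)
     - 4 * central_prob \<nu> * (1 + est_var l * wide l \<nu> / eff_noise l) - (1 - symbol_energy c l / wide l \<nu>)"
  have "(\<lambda>\<nu>. symbol_energy c l * (1 + 1 / (2 * real \<nu>))) \<longlonglongrightarrow> symbol_energy c l"
    using symbol_pos[of l] by real_asymp
  then have W: "(\<lambda>\<nu>. wide l \<nu>) \<longlonglongrightarrow> symbol_energy c l" by (simp add: wide_energy_def[abs_def])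
  have "?low \<longlonglongrightarrow> capacity l - 2 * (1 - 1) - 4 * 0 * (1 + est_var l * symbol_energy c l / eff_noise l) - (1 - symbol_energy c l / symbol_energy c l)"
    using symbol_pos[of l] eff_noise_pos[of l]
    by (intro tendsto_intros central_prob_limit central_prob_tendsto_0 W) auto
  then have "?low \<longlonglongrightarrow> capacity l" using symbol_pos[of l] by simp
  then have "\<forall>\<^sub>F \<nu> in sequentially. capacity l - \<epsilon> < ?low \<nu>"
    using assms by (intro order_tendstoD) auto
  then show ?thesis
  proof (rule eventually_mono)
    fix \<nu>
    assume "capacity l - \<epsilon> < ?low \<nu>"
    then show "capacity l - \<epsilon> < rate l \<nu>" using rate_lower_bound[of l \<nu>] by (rule less_le_trans)
  qed
qed

end

section \<open>Codebooks from digits\<close>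

definition digit :: "nat \<Rightarrow> nat \<Rightarrow> nat \<Rightarrow> nat" where
  "digit q s u = u div q ^ s mod q"

lemma digit_less: "q > 0 \<Longrightarrow> digit q s u < q"
  by (simp add: digit_def)

lemma digit_0: "digit q 0 u = u mod q"
  by (simp add: digit_def)

lemma digit_Suc: "digit q (Suc s) u = digit q s (u div q)"
  by (simp add: digit_def div_mult2_eq)

text \<open>The \<open>K\<close> lowest digits of a uniform index are independent and uniform. The
  surplus factor \<open>r\<close> counts indices with equal digits and lets one message set serve
  data vectors of different lengths.\<close>

lemma sum_prod_digits:
  fixes G :: "nat \<Rightarrow> nat \<Rightarrow> 'a::comm_semiring_1"
  assumes "q > 0"
  shows "(\<Sum>u<q ^ K * r. \<Prod>s<K. G s (digit q s u)) = of_nat r * (\<Prod>s<K. \<Sum>d<q. G s d)"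
proof (induction K arbitrary: G)
  case (Suc K)
  have "(\<Sum>u<q ^ Suc K * r. \<Prod>s<Suc K. G s (digit q s u))
      = (\<Sum>u<q * (q ^ K * r). G 0 (u mod q) * (\<Prod>s<K. G (Suc s) (digit q s (u div q))))"
    by (simp only: prod.lessThan_Suc_shift digit_0 digit_Suc power_Suc mult.assoc)
  also have "\<dots> = (\<Sum>d<q. \<Sum>u<q ^ K * r. G 0 d * (\<Prod>s<K. G (Suc s) (digit q s u)))"
    by (rule sum_mod_div[OF assms, of "\<lambda>d u. G 0 d * (\<Prod>s<K. G (Suc s) (digit q s u))"])
  also have "\<dots> = (\<Sum>d<q. G 0 d) * (of_nat r * (\<Prod>s<K. \<Sum>d<q. G (Suc s) d))"
    by (simp only: sum_distrib_left[symmetric] Suc.IH[of "\<lambda>s. G (Suc s)"] sum_distrib_right)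
  also have "\<dots> = of_nat r * (\<Prod>s<Suc K. \<Sum>d<q. G s d)"
    by (simp only: prod.lessThan_Suc_shift mult.left_commute)
  finally show ?case .
qed simp

lemma sum_digit:
  fixes F :: "nat \<Rightarrow> real"
  assumes "q > 0" "s < K" "q ^ K dvd M"
  shows "real q * (\<Sum>u<M. F (digit q s u)) = real M * (\<Sum>d<q. F d)"
proof -
  obtain r where M: "M = q ^ K * r" using assms by (auto simp: dvd_def)
  have s: "s \<in> {..<K}" "finite {..<K}" using assms by auto
  have "(\<Sum>u<M. F (digit q s u)) = (\<Sum>u<q ^ K * r. \<Prod>s'<K. if s' = s then F (digit q s' u) else 1)"
    using assms by (simp add: M prod.delta)
  also have "\<dots> = real r * (\<Prod>s'<K. \<Sum>d<q. if s' = s then F d else 1)"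
    by (rule sum_prod_digits[OF assms(1), of "\<lambda>s' d. if s' = s then F d else 1"])
  also have "(\<Prod>s'<K. \<Sum>d<q. if s' = s then F d else 1) = (\<Sum>d<q. F d) * real q ^ (K - 1)"
    using s by (subst prod.remove[OF s(2,1)]) simp
  also have "real q * (real r * ((\<Sum>d<q. F d) * real q ^ (K - 1))) = real M * (\<Sum>d<q. F d)"
    using assms(2) by (cases K) (simp_all add: M)
  finally show ?thesis .
qed

text \<open>Indices that agree in the digits used share a word; messages are told apart by the
  different permutations of the blocks.\<close>

definition qam_word :: "real \<Rightarrow> nat \<Rightarrow> nat \<Rightarrow> nat \<Rightarrow> complex" where
  "qam_word E \<nu> u s = qam E \<nu> (digit (16 ^ \<nu>) s u)"

text \<open>A uniform message stays uniform under a permutation, so the moments of a block do not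
  see \<open>p\<close>, and every draw of the random code is admissible.\<close>

lemma sum_pmf_permuted:
  fixes F :: "nat \<Rightarrow> 'b::{banach, second_countable_topology}"
  assumes "M > 0" "p permutes {..<M}"
  shows "(LINT w|measure_pmf (pmf_of_set {..<M}). F (p w)) = (\<Sum>u<M. F u) /\<^sub>R real M"
proof -
  have "(LINT w|measure_pmf (pmf_of_set {..<M}). F (p w)) = (\<Sum>w<M. pmf (pmf_of_set {..<M}) w *\<^sub>R F (p w))"
    using assms(1) by (intro integral_measure_pmf) (auto simp: set_pmf_of_set lessThan_empty_iff)
  also have "\<dots> = (\<Sum>w<M. F (p w)) /\<^sub>R real M"
    using assms(1) by (simp add: scaleR_sum_right pmf_of_set[of "{..<M}"] lessThan_empty_iff inverse_eq_divide)
  also have "(\<Sum>w<M. F (p w)) = (\<Sum>u<M. F u)"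
    using assms(2) by (intro sum.reindex_bij_betw permutes_imp_bij)
  finally show ?thesis .
qed

lemma prob_qam_word:
  fixes E :: real and \<nu> :: nat
  defines "q \<equiv> 16 ^ \<nu>"
  assumes "M > 0" "p permutes {..<M}" "q ^ K dvd M" "J \<subseteq> {..<K}"
  shows "measure (measure_pmf (pmf_of_set {..<M})) {w. \<forall>s\<in>J. qam_word E \<nu> (p w) s \<in> B s}
    = (\<Prod>s\<in>J. (\<Sum>d<q. indicat_real (B s) (qam E \<nu> d)) / real q)"
proof -
  let ?U = "measure_pmf (pmf_of_set {..<M})"
  let ?G = "\<lambda>s d. if s \<in> J then indicat_real (B s) (qam E \<nu> d) else 1"
  obtain r where M: "M = q ^ K * r" using assms by (auto simp: dvd_def)
  have q: "q > 0" by (simp add: q_def)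
  have r: "r > 0" using M assms(2) by (cases r) auto
  have fJ: "finite J" using assms(5) finite_subset by blast
  have ind: "indicat_real {u. \<forall>s\<in>J. qam_word E \<nu> u s \<in> B s} u = (\<Prod>s<K. ?G s (digit q s u))" for u
  proof -
    have "(\<Prod>s<K. ?G s (digit q s u)) = (\<Prod>s\<in>J. indicat_real (B s) (qam_word E \<nu> u s))"
      using assms(5) by (simp add: prod.If_cases Int_absorb1 qam_word_def q_def)
    also have "\<dots> = indicat_real {u. \<forall>s\<in>J. qam_word E \<nu> u s \<in> B s} u"
      using fJ by (auto simp: indicator_def prod_zero_iff)
    finally show ?thesis by simp
  qed
  have "measure ?U {w. \<forall>s\<in>J. qam_word E \<nu> (p w) s \<in> B s}
      = (LINT w|?U. indicat_real {w. \<forall>s\<in>J. qam_word E \<nu> (p w) s \<in> B s} w)" by simp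
  also have "\<dots> = (LINT w|?U. (\<Prod>s<K. ?G s (digit q s (p w))))"
    unfolding ind[symmetric] by (intro Bochner_Integration.integral_cong) (auto simp: indicator_def)
  also have "\<dots> = (\<Sum>u<M. \<Prod>s<K. ?G s (digit q s u)) /\<^sub>R real M"
    by (rule sum_pmf_permuted[OF assms(2,3)])
  also have "\<dots> = (real r * (\<Prod>s<K. \<Sum>d<q. ?G s d)) / (real r * real q ^ K)"
  proof -
    have "(\<Sum>u<M. \<Prod>s<K. ?G s (digit q s u)) = real r * (\<Prod>s<K. \<Sum>d<q. ?G s d)"
      unfolding M by (rule sum_prod_digits[OF q, of ?G])
    then show ?thesis by (simp add: M divide_inverse mult.commute)
  qed
  also have "\<dots> = (\<Prod>s<K. \<Sum>d<q. ?G s d) / (\<Prod>s<K. real q)" using r by simp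
  also have "\<dots> = (\<Prod>s<K. (\<Sum>d<q. ?G s d) / real q)" by (simp only: prod_dividef)
  also have "\<dots> = (\<Prod>s<K. if s \<in> J then (\<Sum>d<q. indicat_real (B s) (qam E \<nu> d)) / real q else 1)"
    using q by (intro prod.cong) auto
  also have "\<dots> = (\<Prod>s\<in>J. (\<Sum>d<q. indicat_real (B s) (qam E \<nu> d)) / real q)"
    using assms(5) by (simp add: prod.If_cases Int_absorb1)
  finally show ?thesis .
qed

lemma indep_qam_word:
  assumes "M > 0" "p permutes {..<M}" "(16 ^ \<nu>) ^ K dvd M"
  shows "prob_space.indep_vars (measure_pmf (pmf_of_set {..<M})) (\<lambda>_. borel) (\<lambda>s w. qam_word E \<nu> (p w) s) {..<K}"
proof -
  let ?U = "measure_pmf (pmf_of_set {..<M})"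
  note ps = prob_space_measure_pmf[of "pmf_of_set {..<M}"]
  show ?thesis
    unfolding prob_space.indep_vars_def2[OF ps]
  proof (intro conjI ballI prob_space.indep_setsI[OF ps])
    fix A J
    assume J: "J \<noteq> {}" "J \<subseteq> {..<K}" "finite J"
      and A: "\<forall>s\<in>J. A s \<in> {(\<lambda>w. qam_word E \<nu> (p w) s) -` B \<inter> space ?U |B. B \<in> sets borel}"
    have "\<forall>s\<in>J. \<exists>B. A s = {w. qam_word E \<nu> (p w) s \<in> B}" using A by (auto simp: vimage_def)
    then obtain B where B: "\<And>s. s \<in> J \<Longrightarrow> A s = {w. qam_word E \<nu> (p w) s \<in> B s}" by metis
    have "(\<Inter>s\<in>J. A s) = {w. \<forall>s\<in>J. qam_word E \<nu> (p w) s \<in> B s}" using B by auto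
    then have "measure ?U (\<Inter>s\<in>J. A s) = (\<Prod>s\<in>J. (\<Sum>d<16 ^ \<nu>. indicat_real (B s) (qam E \<nu> d)) / real (16 ^ \<nu>))"
      using prob_qam_word[OF assms J(2)] by simp
    \<comment> \<open>The product formula for the singleton of \<open>s\<close> identifies each
      factor as a marginal probability.\<close>
    also have "\<dots> = (\<Prod>s\<in>J. measure ?U (A s))"
    proof (intro prod.cong refl)
      fix s assume s: "s \<in> J"
      then have "{s} \<subseteq> {..<K}" using J by auto
      from prob_qam_word[OF assms this, of E B]
      show "(\<Sum>d<16 ^ \<nu>. indicat_real (B s) (qam E \<nu> d)) / real (16 ^ \<nu>) = measure ?U (A s)"
        using B[OF s] by simp
    qed
    finally show "measure ?U (\<Inter>s\<in>J. A s) = (\<Prod>s\<in>J. measure ?U (A s))" .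
  qed auto
qed

lemma qam_word_correlation:
  assumes "M > 0" "p permutes {..<M}" "(16 ^ \<nu>) ^ K dvd M" "\<nu> > 0" "E > 0" "s < K" "s' < K"
  shows "(LINT w|measure_pmf (pmf_of_set {..<M}). qam_word E \<nu> (p w) s * cnj (qam_word E \<nu> (p w) s'))
    = (if s = s' then of_real E else 0)"
proof -
  define q :: nat where "q = 16 ^ \<nu>"
  \<comment> \<open>Two conditional factors: for \<open>s = s'\<close> both hit the same digit and
    give its energy, otherwise digit \<open>s\<close> contributes the mean of the constellation,
    which is 0.\<close>
  let ?G = "\<lambda>k d. (if k = s then qam E \<nu> d else 1) * (if k = s' then cnj (qam E \<nu> d) else 1)"
  obtain r where M: "M = q ^ K * r" using assms by (auto simp: dvd_def q_def)
  have q: "q > 0" by (simp add: q_def)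
  have r: "r > 0" using M assms(1) by (cases r) auto
  have "qam_word E \<nu> u s * cnj (qam_word E \<nu> u s') = (\<Prod>k<K. ?G k (digit q k u))" for u
    using assms by (simp add: prod.distrib prod.delta qam_word_def q_def)
  then have "(LINT w|measure_pmf (pmf_of_set {..<M}). qam_word E \<nu> (p w) s * cnj (qam_word E \<nu> (p w) s'))
      = (\<Sum>u<M. \<Prod>k<K. ?G k (digit q k u)) /\<^sub>R real M"
    using sum_pmf_permuted[OF assms(1,2), of "\<lambda>u. \<Prod>k<K. ?G k (digit q k u)"] by simp
  also have "\<dots> = (of_nat r * (\<Prod>k<K. \<Sum>d<q. ?G k d)) /\<^sub>R real M"
    unfolding M by (subst sum_prod_digits[OF q, of ?G]) (rule refl)
  also have "\<dots> = (if s = s' then of_real E else 0)"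
  proof (cases "s = s'")
    case False
    then have "(\<Sum>d<q. ?G s d) = 0" using qam_mean[OF assms(4,5)] by (simp add: q_def)
    then have "(\<Prod>k<K. \<Sum>d<q. ?G k d) = 0" using assms(6) by (intro prod_zero bexI[of _ s]) auto
    then show ?thesis using False by simp
  next
    case True
    have "(\<Sum>d<q. ?G k d) = (if k = s then of_real (real q * E) else of_nat q)" for k
    proof (cases "k = s")
      case True
      have "(\<Sum>d<q. qam E \<nu> d * cnj (qam E \<nu> d)) = of_real (\<Sum>d<q. (cmod (qam E \<nu> d))\<^sup>2)"
        by (simp add: complex_norm_square[symmetric])
      then show ?thesis using True \<open>s = s'\<close> qam_energy[OF assms(4,5)] by (simp add: q_def)
    qed (use True in simp)
    then have "(\<Prod>k<K. \<Sum>d<q. ?G k d) = (\<Prod>k<K. of_nat q * (if k = s then of_real E else 1))"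
      by (intro prod.cong) auto
    also have "\<dots> = of_nat q ^ K * of_real E"
      using assms(6) by (simp add: prod.distrib prod.delta)
    finally have "of_nat r * (\<Prod>k<K. \<Sum>d<q. ?G k d) = of_nat M * of_real E" by (simp add: M)
    then show ?thesis using True assms(1) by (simp add: scaleR_conv_of_real)
  qed
  finally show ?thesis .
qed

lemma admissible_qam_codebook:
  assumes "M > 0" "\<And>i. i < n \<Longrightarrow> p i permutes {..<M}" "(16 ^ \<nu>) ^ data_len c l dvd M" "\<nu> > 0"
    and "symbol_energy c l > 0"
    and energy: "pilot_energy c l + real (data_len c l) * symbol_energy c l \<le> real (block_len c) * tx_power c l"
  shows "admissible_codebook c l n M (\<lambda>w i s. qam_word (symbol_energy c l) \<nu> (p i w) s)"
proof -
  let ?U = "measure_pmf (pmf_of_set {..<M})" and ?E = "symbol_energy c l" and ?K = "data_len c l"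
  have "(LINT w|?U. (\<Sum>s<?K. (cmod (qam_word ?E \<nu> (p i w) s))\<^sup>2)) = real ?K * ?E" if i: "i < n" for i
  proof -
    have int: "integrable ?U f" for f :: "nat \<Rightarrow> complex"
      using assms(1) by (intro integrable_measure_pmf_finite) (simp add: set_pmf_of_set lessThan_empty_iff)
    \<comment> \<open>The energy is the trace of the correlation matrix, which has been computed
      over the complex numbers.\<close>
    have "complex_of_real (LINT w|?U. (\<Sum>s<?K. (cmod (qam_word ?E \<nu> (p i w) s))\<^sup>2))
        = (LINT w|?U. (\<Sum>s<?K. qam_word ?E \<nu> (p i w) s * cnj (qam_word ?E \<nu> (p i w) s)))"
      by (simp add: integral_complex_of_real[symmetric] complex_norm_square[symmetric] del: integral_complex_of_real)
    also have "\<dots> = (\<Sum>s<?K. LINT w|?U. qam_word ?E \<nu> (p i w) s * cnj (qam_word ?E \<nu> (p i w) s))"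
      by (intro Bochner_Integration.integral_sum int)
    also have "\<dots> = (\<Sum>s<?K. of_real ?E)"
      using qam_word_correlation[OF assms(1) assms(2)[OF i] assms(3-5)] by (intro sum.cong) auto
    also have "\<dots> = complex_of_real (real ?K * ?E)" by simp
    finally show ?thesis by (simp only: of_real_eq_iff)
  qed
  then show ?thesis
    unfolding admissible_codebook_def Let_def
    using indep_qam_word[OF assms(1) assms(2) assms(3)] qam_word_correlation[OF assms(1) assms(2) assms(3-5)] energy
    by auto
qed

text \<open>The alternative \<open>w' = M - 1\<close> makes the search succeed even if no score
  passes, and keeps the decision below \<open>M\<close>. It cannot preempt a correct
  \<open>w\<close>, which is at most \<open>M - 1\<close>.\<close>

lemma Least_threshold_decision:
  fixes S :: "nat \<Rightarrow> real"
  assumes "w < M" "\<gamma> < S w" "\<And>w'. w' < M \<Longrightarrow> w' \<noteq> w \<Longrightarrow> S w' \<le> \<gamma>"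
  shows "(LEAST w'. \<gamma> < S w' \<or> w' = M - 1) = w"
proof (rule Least_equality)
  fix y assume "\<gamma> < S y \<or> y = M - 1"
  then show "w \<le> y"
    using assms by (metis Suc_pred' less_Suc_eq_le linorder_not_less gr_zeroI less_zeroE order.strict_implies_order order_le_less_trans)
qed (use assms in simp)

lemma Least_threshold_less: "M > 0 \<Longrightarrow> (LEAST w'. \<gamma> < S w' \<or> w' = M - 1) < M" for S :: "nat \<Rightarrow> real"
  by (rule order.strict_trans1[OF Least_le[of _ "M - 1"]]) auto

lemma exists_le_average:
  fixes f :: "'a \<Rightarrow> real"
  assumes "finite S" "S \<noteq> {}" "(\<Sum>p\<in>S. f p) \<le> real (card S) * b"
  shows "\<exists>p\<in>S. f p \<le> b"
proof (rule ccontr)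
  assume "\<not> (\<exists>p\<in>S. f p \<le> b)"
  then have "(\<Sum>p\<in>S. b) < (\<Sum>p\<in>S. f p)" using assms by (intro sum_strict_mono) auto
  then show False using assms(3) by simp
qed

section \<open>Scores of whole blocks\<close>

context training_channel
begin

text \<open>Index \<open>u\<close> is sent and \<open>u'\<close> is the candidate. A block is the
  unit of the probabilistic argument because its symbols share one fading coefficient and one
  estimate.\<close>

definition word_score :: "link \<Rightarrow> nat \<Rightarrow> nat \<Rightarrow> nat \<Rightarrow> nat \<Rightarrow> (rvar \<Rightarrow> complex) \<Rightarrow> real" where
  "word_score l \<nu> t u u' \<omega> = (\<Sum>s<data_len c l. score (symbol_energy c l) \<nu> (eff_noise l) (mmse_est c l t \<omega>)
     (qam_word (symbol_energy c l) \<nu> u' s)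
     (\<omega> (Fade l t) * qam_word (symbol_energy c l) \<nu> u s + \<omega> (DataNoise l t s)))"

lemma word_score_self:
  "word_score l \<nu> t u u = (\<lambda>\<omega>. \<Sum>s<data_len c l. link_score l \<nu> t s (qam_word (symbol_energy c l) \<nu> u s) \<omega>)"
  by (rule ext) (simp add: word_score_def link_score_def)

lemma word_score_measurable [measurable]: "word_score l \<nu> t u u' \<in> borel_measurable \<Omega>"
  unfolding word_score_def[abs_def] by measurable

text \<open>For a fixed observation the exponential is a product over symbols whose candidate digits
  range independently, so the bound for one symbol multiplies up.\<close>

lemma sum_exp_word_score_le:
  assumes "\<nu> > 0" "(16 ^ \<nu>) ^ data_len c l dvd M"
  shows "(\<Sum>u'<M. exp (word_score l \<nu> t u u' \<omega>)) \<le> real M"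
proof -
  define q :: nat where "q = 16 ^ \<nu>"
  let ?K = "data_len c l"
  define y where "y s = \<omega> (Fade l t) * qam_word (symbol_energy c l) \<nu> u s + \<omega> (DataNoise l t s)" for s
  let ?G = "\<lambda>s d. exp (score (symbol_energy c l) \<nu> (eff_noise l) (mmse_est c l t \<omega>) (qam (symbol_energy c l) \<nu> d) (y s))"
  obtain r where M: "M = q ^ ?K * r" using assms by (auto simp: dvd_def q_def)
  have "(\<Sum>u'<M. exp (word_score l \<nu> t u u' \<omega>)) = (\<Sum>u'<q ^ ?K * r. \<Prod>s<?K. ?G s (digit q s u'))"
    by (simp add: M word_score_def exp_sum qam_word_def q_def y_def)
  also have "\<dots> = real r * (\<Prod>s<?K. \<Sum>d<q. ?G s d)"
    by (rule sum_prod_digits[of q ?G]) (simp add: q_def)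
  also have "\<dots> \<le> real r * (\<Prod>s<?K. real q)"
  proof (intro mult_left_mono prod_mono conjI sum_nonneg)
    fix s
    show "(\<Sum>d<q. ?G s d) \<le> real q"
      using sum_exp_score_le[OF assms(1) symbol_pos[of l] eff_noise_pos[of l]] by (simp add: q_def)
  qed auto
  also have "\<dots> = real M" by (simp add: M)
  finally show ?thesis .
qed

text \<open>Words use finitely many digit values and there are three links, so finite sums of the
  individual bounds cover all of them at once.\<close>

lemma word_score_square_bound:
  "\<exists>V. \<forall>l t u. integrable \<Omega> (\<lambda>\<omega>. (word_score l \<nu> t u u \<omega>)\<^sup>2) \<and> expectation (\<lambda>\<omega>. (word_score l \<nu> t u u \<omega>)\<^sup>2) \<le> V"
proof -
  have "\<forall>l d. \<exists>V. \<forall>t s. integrable \<Omega> (\<lambda>\<omega>. (link_score l \<nu> t s (qam (symbol_energy c l) \<nu> d) \<omega>)\<^sup>2)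
      \<and> expectation (\<lambda>\<omega>. (link_score l \<nu> t s (qam (symbol_energy c l) \<nu> d) \<omega>)\<^sup>2) \<le> V"
    using link_score_square_bound by blast
  then obtain V where V: "\<And>l d t s. integrable \<Omega> (\<lambda>\<omega>. (link_score l \<nu> t s (qam (symbol_energy c l) \<nu> d) \<omega>)\<^sup>2)"
    "\<And>l d t s. expectation (\<lambda>\<omega>. (link_score l \<nu> t s (qam (symbol_energy c l) \<nu> d) \<omega>)\<^sup>2) \<le> V l d"
    by metis
  define Vs where "Vs l = (\<Sum>d<16 ^ \<nu>. \<bar>V l d\<bar>)" for l
  define VV where "VV l = (\<Sum>s<data_len c l. Vs l) * real (data_len c l)" for l
  have VV0: "0 \<le> VV l" for l by (simp add: VV_def Vs_def sum_nonneg)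
  have "integrable \<Omega> (\<lambda>\<omega>. (word_score l \<nu> t u u \<omega>)\<^sup>2) \<and> expectation (\<lambda>\<omega>. (word_score l \<nu> t u u \<omega>)\<^sup>2) \<le> VV l" for l t u
  proof -
    let ?K = "data_len c l"
    let ?x = "\<lambda>s. qam_word (symbol_energy c l) \<nu> u s"
    let ?B = "\<lambda>\<omega>. (\<Sum>s<?K. (link_score l \<nu> t s (?x s) \<omega>)\<^sup>2) * real ?K"
    have x: "integrable \<Omega> (\<lambda>\<omega>. (link_score l \<nu> t s (?x s) \<omega>)\<^sup>2)"
      "expectation (\<lambda>\<omega>. (link_score l \<nu> t s (?x s) \<omega>)\<^sup>2) \<le> Vs l" for s
    proof -
      show "integrable \<Omega> (\<lambda>\<omega>. (link_score l \<nu> t s (?x s) \<omega>)\<^sup>2)" unfolding qam_word_def by (rule V(1))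
      let ?d = "digit (16 ^ \<nu>) s u"
      have "expectation (\<lambda>\<omega>. (link_score l \<nu> t s (?x s) \<omega>)\<^sup>2) \<le> V l ?d" unfolding qam_word_def by (rule V(2))
      also have "\<dots> \<le> \<bar>V l ?d\<bar>" by simp
      also have "\<dots> \<le> Vs l" unfolding Vs_def
        by (rule member_le_sum[of ?d]) (auto intro: digit_less)
      finally show "expectation (\<lambda>\<omega>. (link_score l \<nu> t s (?x s) \<omega>)\<^sup>2) \<le> Vs l" .
    qed
    have le: "(word_score l \<nu> t u u \<omega>)\<^sup>2 \<le> ?B \<omega>" for \<omega>
      unfolding word_score_self using sum_squared_le_sum_of_squares[of _ "{..<?K}"] by simp
    have B: "integrable \<Omega> ?B" using x(1) by (intro integrable_mult_left Bochner_Integration.integrable_sum)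
    have int: "integrable \<Omega> (\<lambda>\<omega>. (word_score l \<nu> t u u \<omega>)\<^sup>2)"
    proof (rule Bochner_Integration.integrable_bound[OF B])
      have "norm ((word_score l \<nu> t u u \<omega>)\<^sup>2) \<le> norm (?B \<omega>)" for \<omega>
        using order_trans[OF le[of \<omega>] abs_ge_self] by simp
      then show "AE \<omega> in \<Omega>. norm ((word_score l \<nu> t u u \<omega>)\<^sup>2) \<le> norm (?B \<omega>)" by simp
    qed measurable
    have "expectation (\<lambda>\<omega>. (word_score l \<nu> t u u \<omega>)\<^sup>2) \<le> expectation ?B"
      by (rule integral_mono[OF int B le])
    also have "\<dots> = (\<Sum>s<?K. expectation (\<lambda>\<omega>. (link_score l \<nu> t s (?x s) \<omega>)\<^sup>2)) * real ?K"
      using x(1) by (subst integral_mult_left_zero) (simp add: Bochner_Integration.integral_sum)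
    also have "\<dots> \<le> VV l" unfolding VV_def using x(2) by (intro mult_right_mono sum_mono) auto
    finally show ?thesis using int by blast
  qed
  moreover have "VV l \<le> VV SR + VV SD + VV RD" for l
    using VV0[of SR] VV0[of SD] VV0[of RD] by (cases l) simp_all
  ultimately show ?thesis by (meson order_trans)
qed

lemma link_score_integrable: "integrable \<Omega> (link_score l \<nu> t s x)"
  using link_score_square_bound[of l \<nu> x] square_integrable_imp_integrable[OF link_score_measurable] by blast

lemma sum_word_score_mean:
  assumes "\<nu> > 0" "(16 ^ \<nu>) ^ data_len c l dvd M"
  shows "(\<Sum>u<M. expectation (word_score l \<nu> t u u)) = real M * (real (data_len c l) * rate l \<nu>)"
proof -
  define q :: nat where "q = 16 ^ \<nu>"
  let ?K = "data_len c l" and ?E = "symbol_energy c l"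
  have q: "q > 0" by (simp add: q_def)
  have "expectation (word_score l \<nu> t u u) = (\<Sum>s<?K. expectation (link_score l \<nu> t s (qam_word ?E \<nu> u s)))" for u
    unfolding word_score_self by (intro Bochner_Integration.integral_sum link_score_integrable)
  then have "(\<Sum>u<M. expectation (word_score l \<nu> t u u))
      = (\<Sum>s<?K. \<Sum>u<M. expectation (link_score l \<nu> t s (qam ?E \<nu> (digit q s u))))"
    by (simp only: qam_word_def q_def) (rule sum.swap)
  also have "\<dots> = (\<Sum>s<?K. real M * rate l \<nu>)"
  proof (intro sum.cong refl)
    fix s assume s: "s \<in> {..<?K}"
    have "real q * (\<Sum>u<M. expectation (link_score l \<nu> t s (qam ?E \<nu> (digit q s u))))
        = real M * (\<Sum>d<q. expectation (link_score l \<nu> t s (qam ?E \<nu> d)))"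
      using s assms(2) q by (intro sum_digit[of q s ?K]) (auto simp: q_def)
    also have "(\<Sum>d<q. expectation (link_score l \<nu> t s (qam ?E \<nu> d))) = real q * rate l \<nu>"
      using sum_link_score_mean[OF assms(1)] by (simp add: q_def)
    finally show "(\<Sum>u<M. expectation (link_score l \<nu> t s (qam ?E \<nu> (digit q s u)))) = real M * rate l \<nu>"
      using q by simp
  qed
  finally show ?thesis by simp
qed

text \<open>Each link and block has its own fading, pilot noise and data noise coordinates; this
  separates even the two receivers of one source block.\<close>

lemma word_score_uncorrelated:
  assumes "(l, t) \<noteq> (l', t')"
  shows "expectation (\<lambda>\<omega>. word_score l \<nu> t u u \<omega> * word_score l' \<nu> t' u' u' \<omega>)
    = expectation (word_score l \<nu> t u u) * expectation (word_score l' \<nu> t' u' u')"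
proof -
  let ?A = "\<lambda>l t. insert (Fade l t) (insert (PilotNoise l t) (range (DataNoise l t)))"
  have m: "word_score l \<nu> t u u \<in> borel_measurable (Pi\<^sub>M (?A l t) (\<lambda>_. borel))" for l t u
    unfolding word_score_def[abs_def] mmse_est_def pilot_obs_def by measurable
  have r: "word_score l \<nu> t u u (restrict \<omega> (?A l t)) = word_score l \<nu> t u u \<omega>" for l t u \<omega>
    by (simp add: word_score_def mmse_est_def pilot_obs_def)
  have "indep_var borel (\<lambda>\<omega>. word_score l \<nu> t u u (restrict \<omega> (?A l t)))
      borel (\<lambda>\<omega>. word_score l' \<nu> t' u' u' (restrict \<omega> (?A l' t')))"
    using assms by (intro indep_disjoint_coords m) auto
  then have ind: "indep_var borel (word_score l \<nu> t u u) borel (word_score l' \<nu> t' u' u')"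
    unfolding r .
  have int: "integrable \<Omega> (word_score l \<nu> t u u)" for l t u
    unfolding word_score_self by (intro Bochner_Integration.integrable_sum link_score_integrable)
  show ?thesis by (rule indep_var_lebesgue_integral[OF ind int int])
qed

text \<open>Block \<open>i\<close> of a superblock has two codebook uses, \<open>(i, False)\<close> of the source and \<open>(i, True)\<close>
  of the relay.  \<open>\<phi>\<close> gives the link and the block in which a receiver observes a use, if it does.\<close>

definition use_score :: "nat \<Rightarrow> ('i \<Rightarrow> (link \<times> nat) option) \<Rightarrow> 'i \<Rightarrow> nat \<Rightarrow> nat \<Rightarrow> (rvar \<Rightarrow> complex) \<Rightarrow> real" where
  "use_score \<nu> \<phi> a = (case \<phi> a of None \<Rightarrow> (\<lambda>_ _ _. 0) | Some (l, t) \<Rightarrow> word_score l \<nu> t)"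

definition use_mean :: "nat \<Rightarrow> ('i \<Rightarrow> (link \<times> nat) option) \<Rightarrow> 'i \<Rightarrow> real" where
  "use_mean \<nu> \<phi> a = (case \<phi> a of None \<Rightarrow> 0 | Some (l, t) \<Rightarrow> real (data_len c l) * rate l \<nu>)"

text \<open>\<open>inj\<close> makes different observed uses rely on different links or blocks,
  which is what decorrelates their scores.\<close>

lemma random_coding_uses:
  fixes \<phi> :: "'i \<Rightarrow> (link \<times> nat) option"
  assumes "finite I" "2 \<le> M" "\<nu> > 0" and dvd: "\<And>l. (16 ^ \<nu>) ^ data_len c l dvd M"
    and inj: "\<And>a b x. a \<in> I \<Longrightarrow> b \<in> I \<Longrightarrow> \<phi> a = Some x \<Longrightarrow> \<phi> b = Some x \<Longrightarrow> a = b"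
    and V: "V \<ge> 0" "\<And>l t u. integrable \<Omega> (\<lambda>\<omega>. (word_score l \<nu> t u u \<omega>)\<^sup>2)"
      "\<And>l t u. expectation (\<lambda>\<omega>. (word_score l \<nu> t u u \<omega>)\<^sup>2) \<le> V"
  shows "random_coding \<Omega> I M (use_score \<nu> \<phi>) V (use_mean \<nu> \<phi>)"
proof unfold_locales
  fix a u u' assume "a \<in> I" "u < M" "u' < M"
  show "use_score \<nu> \<phi> a u u' \<in> borel_measurable \<Omega>"
    by (auto simp: use_score_def split: option.split)
next
  fix a u \<omega>
  \<comment> \<open>An unobserved use scores 0, and its \<open>M\<close> exponentials sum to exactly
    \<open>M\<close>.\<close>
  show "(\<Sum>u'<M. exp (use_score \<nu> \<phi> a u u' \<omega>)) \<le> real M"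
    using sum_exp_word_score_le[OF assms(3) dvd] by (auto simp: use_score_def split: option.split)
next
  fix a u
  show "integrable \<Omega> (\<lambda>\<omega>. (use_score \<nu> \<phi> a u u \<omega>)\<^sup>2)"
    using V(2) by (auto simp: use_score_def split: option.split)
  show "expectation (\<lambda>\<omega>. (use_score \<nu> \<phi> a u u \<omega>)\<^sup>2) \<le> V"
    using V(1,3) by (auto simp: use_score_def split: option.split)
next
  fix a b u u' assume ab: "a \<in> I" "b \<in> I" "a \<noteq> b"
  show "expectation (\<lambda>\<omega>. use_score \<nu> \<phi> a u u \<omega> * use_score \<nu> \<phi> b u' u' \<omega>)
      = expectation (use_score \<nu> \<phi> a u u) * expectation (use_score \<nu> \<phi> b u' u')"
  proof (cases "\<phi> a")
    case None
    then show ?thesis by (simp add: use_score_def)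
  next
    case (Some x)
    obtain l t where x: "x = (l, t)" by (cases x)
    show ?thesis
    proof (cases "\<phi> b")
      case None
      then show ?thesis by (simp add: use_score_def)
    next
      case (Some y)
      obtain l' t' where y: "y = (l', t')" by (cases y)
      have "(l, t) \<noteq> (l', t')" using inj ab \<open>\<phi> a = Some x\<close> Some x y by blast
      from word_score_uncorrelated[OF this] show ?thesis
        by (simp add: use_score_def Some \<open>\<phi> a = Some x\<close> x y)
    qed
  qed
next
  fix a
  show "(\<Sum>u<M. expectation (use_score \<nu> \<phi> a u u)) = real M * use_mean \<nu> \<phi> a"
    using sum_word_score_mean[OF assms(3) dvd] by (auto simp: use_score_def use_mean_def split: option.split)
qed (use assms in auto)

end

section \<open>Threshold codes\<close>

context training_channel
begin

definition obs_score :: "link \<Rightarrow> nat \<Rightarrow> nat \<Rightarrow> (nat \<Rightarrow> nat \<Rightarrow> complex) \<Rightarrow> observation \<Rightarrow> real" where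
  "obs_score l \<nu> n x z = (\<Sum>i<n. \<Sum>s<data_len c l.
     score (symbol_energy c l) \<nu> (eff_noise l) (fst z i) (x i s) (snd z (i, s)))"

lemma obs_score_observe:
  "obs_score l \<nu> n (\<lambda>i s. qam_word (symbol_energy c l) \<nu> (p i w') s)
     (observe c l n j (\<lambda>i s. qam_word (symbol_energy c l) \<nu> (p i w) s) \<omega>)
   = (\<Sum>i<n. word_score l \<nu> (j * n + i) (p i w) (p i w') \<omega>)"
  by (simp add: obs_score_def observe_def word_score_def)

lemma obs_score_measurable: "obs_score l \<nu> n x \<in> borel_measurable (obs_space c l n)"
proof -
  have "(\<lambda>z. fst z i) \<in> borel_measurable (obs_space c l n)" if "i < n" for i
    unfolding obs_space_def using that
    by (intro measurable_compose[OF measurable_fst measurable_component_singleton]) auto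
  moreover have "(\<lambda>z. snd z (i, s)) \<in> borel_measurable (obs_space c l n)" if "i < n" "s < data_len c l" for i s
    unfolding obs_space_def using that
    by (intro measurable_compose[OF measurable_snd measurable_component_singleton]) auto
  ultimately show ?thesis
    unfolding obs_score_def[abs_def] by (intro borel_measurable_sum score_measurable) auto
qed

text \<open>One threshold serves both receivers because it will lie below both mean scores. The
  destination adds the scores of its two links, which is the joint decoding over parallel channels.
  All superblocks reuse the same permutations.\<close>

definition threshold_code ::
  "nat \<Rightarrow> real \<Rightarrow> nat \<Rightarrow> nat \<Rightarrow> nat \<Rightarrow> (nat \<times> bool \<Rightarrow> nat \<Rightarrow> nat) \<Rightarrow> df_code" where
  "threshold_code \<nu> \<gamma> B n M p =
     (let xs = (\<lambda>w i s. qam_word (symbol_energy c SR) \<nu> (p (i, False) w) s);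
          xr = (\<lambda>w i s. qam_word (symbol_energy c RD) \<nu> (p (i, True) w) s) in
      \<lparr>num_superblocks = B, superblock_len = n, num_messages = M, src_enc = xs, rel_enc = xr,
       rel_dec = (\<lambda>z. LEAST w. \<gamma> < obs_score SR \<nu> n (xs w) z \<or> w = M - 1),
       dst_dec = (\<lambda>z. LEAST w. \<gamma> < obs_score SD \<nu> n (xs w) (fst z) + obs_score RD \<nu> n (xr w) (snd z) \<or> w = M - 1)\<rparr>)"

lemma source_links:
  "symbol_energy c SD = symbol_energy c SR" "pilot_energy c SD = pilot_energy c SR" "data_len c SD = data_len c SR"
  by (simp_all add: symbol_energy_def pilot_energy_def data_len_def)

lemma admissible_threshold_code:
  assumes "B > 0" "n > 0" "M > 0" "\<nu> > 0" and dvd: "\<And>l. (16 ^ \<nu>) ^ data_len c l dvd M"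
    and p: "\<And>a. a \<in> {..<n} \<times> UNIV \<Longrightarrow> p a permutes {..<M}"
    and energy: "\<And>l. pilot_energy c l + real (data_len c l) * symbol_energy c l \<le> real (block_len c) * tx_power c l"
  shows "admissible_code c (threshold_code \<nu> \<gamma> B n M p)"
proof -
  have pred: "(\<lambda>z. LEAST w. \<gamma> < f w z \<or> w = M - 1) \<in> N \<rightarrow>\<^sub>M count_space UNIV"
    if [measurable]: "\<And>w. f w \<in> borel_measurable N" for f :: "nat \<Rightarrow> 'n \<Rightarrow> real" and N :: "'n measure"
    by measurable
  have cb: "admissible_codebook c SR n M (\<lambda>w i s. qam_word (symbol_energy c SR) \<nu> (p (i, False) w) s)"
    "admissible_codebook c RD n M (\<lambda>w i s. qam_word (symbol_energy c RD) \<nu> (p (i, True) w) s)"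
    using assms p symbol_pos by (auto intro!: admissible_qam_codebook)
  have m1: "(\<lambda>z. LEAST w. \<gamma> < obs_score SR \<nu> n (x w) z \<or> w = M - 1) \<in> obs_space c SR n \<rightarrow>\<^sub>M count_space UNIV" for x
    by (intro pred obs_score_measurable)
  have m2: "(\<lambda>z. LEAST w. \<gamma> < obs_score SD \<nu> n (x w) (fst z) + obs_score RD \<nu> n (x' w) (snd z) \<or> w = M - 1)
      \<in> obs_space c SD n \<Otimes>\<^sub>M obs_space c RD n \<rightarrow>\<^sub>M count_space UNIV" for x x'
    by (intro pred borel_measurable_add measurable_compose[OF measurable_fst obs_score_measurable]
        measurable_compose[OF measurable_snd obs_score_measurable])
  show ?thesis
    unfolding admissible_code_def threshold_code_def Let_def df_code.select_convs
    by (intro conjI allI Least_threshold_less assms(1-3) cb m1 m2)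
qed

text \<open>Marking the relay's own transmissions as unobserved keeps one index set, hence one
  random code, for both receivers.\<close>

definition rel_uses :: "nat \<Rightarrow> nat \<Rightarrow> nat \<times> bool \<Rightarrow> (link \<times> nat) option" where
  "rel_uses n j a = (if snd a then None else Some (SR, j * n + fst a))"

text \<open>The relay forwards message \<open>j\<close> one superblock later, hence
  \<open>j + 1\<close>.\<close>

definition dst_uses :: "nat \<Rightarrow> nat \<Rightarrow> nat \<times> bool \<Rightarrow> (link \<times> nat) option" where
  "dst_uses n j a = Some (if snd a then (RD, (j + 1) * n + fst a) else (SD, j * n + fst a))"

text \<open>The event of \<open>decoding_error_average\<close>, stated in scores alone; outside it
  the threshold search finds the right message.\<close>

definition confusion :: "nat \<Rightarrow> real \<Rightarrow> nat \<Rightarrow> nat \<Rightarrow> (nat \<times> bool \<Rightarrow> (link \<times> nat) option) \<Rightarrow>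
    (nat \<times> bool \<Rightarrow> nat \<Rightarrow> nat) \<Rightarrow> nat \<Rightarrow> (rvar \<Rightarrow> complex) set" where
  "confusion \<nu> \<gamma> n M \<phi> p w = {\<omega>\<in>space \<Omega>. (\<Sum>a\<in>{..<n} \<times> UNIV. use_score \<nu> \<phi> a (p a w) (p a w) \<omega>) \<le> \<gamma> \<or>
      (\<exists>w'<M. w' \<noteq> w \<and> \<gamma> < (\<Sum>a\<in>{..<n} \<times> UNIV. use_score \<nu> \<phi> a (p a w) (p a w') \<omega>))}"

lemma sum_uses:
  fixes f :: "nat \<times> bool \<Rightarrow> real"
  shows "(\<Sum>a\<in>{..<n} \<times> UNIV. f a) = (\<Sum>i<n. f (i, False)) + (\<Sum>i<n. f (i, True))"
  by (simp add: sum.cartesian_product' UNIV_bool sum.distrib)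

lemma use_score_measurable [measurable]: "use_score \<nu> \<phi> a u u' \<in> borel_measurable \<Omega>"
  by (auto simp: use_score_def split: option.split)

lemma confusion_measurable: "confusion \<nu> \<gamma> n M \<phi> p w \<in> sets \<Omega>"
  unfolding confusion_def by measurable

lemma relay_decision_correct:
  assumes "w j < M" "\<omega> \<notin> confusion \<nu> \<gamma> n M (rel_uses n j) p (w j)"
  shows "relay_decision c (threshold_code \<nu> \<gamma> B n M p) w j \<omega> = w j"
proof -
  define S where "S w' = (\<Sum>i<n. word_score SR \<nu> (j * n + i) (p (i, False) (w j)) (p (i, False) w') \<omega>)" for w'
  have "(\<Sum>a\<in>{..<n} \<times> UNIV. use_score \<nu> (rel_uses n j) a (p a (w j)) (p a w') \<omega>) = S w'" for w'
    by (simp add: sum_uses use_score_def rel_uses_def S_def)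
  then have "\<gamma> < S (w j)" "\<And>w'. w' < M \<Longrightarrow> w' \<noteq> w j \<Longrightarrow> S w' \<le> \<gamma>"
    using assms(2) unfolding confusion_def by (auto simp: not_le not_less) (meson not_le)
  from Least_threshold_decision[where S=S, OF assms(1) this] show ?thesis
    using obs_score_observe[of SR \<nu> n "\<lambda>i. p (i, False)" _ j "w j" \<omega>]
    by (simp add: relay_decision_def threshold_code_def Let_def S_def)
qed

lemma dest_decision_correct:
  assumes "w j < M" "\<omega> \<notin> confusion \<nu> \<gamma> n M (rel_uses n j) p (w j)"
    "\<omega> \<notin> confusion \<nu> \<gamma> n M (dst_uses n j) p (w j)"
  shows "dest_decision c (threshold_code \<nu> \<gamma> B n M p) w j \<omega> = w j"
proof -
  define S where "S w' = (\<Sum>i<n. word_score SD \<nu> (j * n + i) (p (i, False) (w j)) (p (i, False) w') \<omega>)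
      + (\<Sum>i<n. word_score RD \<nu> ((j + 1) * n + i) (p (i, True) (w j)) (p (i, True) w') \<omega>)" for w'
  have "(\<Sum>a\<in>{..<n} \<times> UNIV. use_score \<nu> (dst_uses n j) a (p a (w j)) (p a w') \<omega>) = S w'" for w'
    by (simp add: sum_uses use_score_def dst_uses_def S_def)
  then have "\<gamma> < S (w j)" "\<And>w'. w' < M \<Longrightarrow> w' \<noteq> w j \<Longrightarrow> S w' \<le> \<gamma>"
    using assms(3) unfolding confusion_def by (auto simp: not_le not_less) (meson not_le)
  \<comment> \<open>The relay has to be right first: only then does superblock \<open>j + 1\<close>
    carry the codeword of the true message that \<open>S\<close> presumes.\<close>
  from Least_threshold_decision[where S=S, OF assms(1) this] show ?thesis
    using obs_score_observe[of SD \<nu> n "\<lambda>i. p (i, False)" _ j "w j" \<omega>]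
      obs_score_observe[of RD \<nu> n "\<lambda>i. p (i, True)" _ "j + 1" "w j" \<omega>]
      relay_decision_correct[where w=w and j=j, OF assms(1,2), of B]
    unfolding dest_decision_def
    by (simp add: threshold_code_def Let_def S_def source_links)
qed

section \<open>Error probability averaged over the random code\<close>

lemma error_prob_threshold_code:
  assumes "M > 0"
  shows "error_prob c (threshold_code \<nu> \<gamma> B n M p) \<le> (\<Sum>w\<in>{..<B} \<rightarrow>\<^sub>E {..<M}. \<Sum>j<B.
    prob (confusion \<nu> \<gamma> n M (rel_uses n j) p (w j)) + prob (confusion \<nu> \<gamma> n M (dst_uses n j) p (w j))) / real M ^ B"
proof -
  let ?C = "threshold_code \<nu> \<gamma> B n M p"
  have C: "num_superblocks ?C = B" "num_messages ?C = M" by (simp_all add: threshold_code_def Let_def)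
  let ?F = "\<lambda>w j. confusion \<nu> \<gamma> n M (rel_uses n j) p (w j) \<union> confusion \<nu> \<gamma> n M (dst_uses n j) p (w j)"
  have F: "?F w j \<in> sets \<Omega>" for w j by (intro sets.Un confusion_measurable)
  have "measure \<Omega> {\<omega>. \<exists>j<B. relay_decision c ?C w j \<omega> \<noteq> w j \<or> dest_decision c ?C w j \<omega> \<noteq> w j}
      \<le> (\<Sum>j<B. prob (confusion \<nu> \<gamma> n M (rel_uses n j) p (w j)) + prob (confusion \<nu> \<gamma> n M (dst_uses n j) p (w j)))"
    if w: "w \<in> {..<B} \<rightarrow>\<^sub>E {..<M}" for w
  proof -
    have "{\<omega>. \<exists>j<B. relay_decision c ?C w j \<omega> \<noteq> w j \<or> dest_decision c ?C w j \<omega> \<noteq> w j} \<subseteq> (\<Union>j<B. ?F w j)"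
    proof clarify
      fix \<omega> j assume j: "j < B" "relay_decision c ?C w j \<omega> \<noteq> w j \<or> dest_decision c ?C w j \<omega> \<noteq> w j"
      have "w j < M" using w j by auto
      then have "\<omega> \<in> ?F w j" using relay_decision_correct[where w=w and j=j] dest_decision_correct[where w=w and j=j] j by blast
      then show "\<omega> \<in> (\<Union>j<B. ?F w j)" using j by blast
    qed
    then have "measure \<Omega> {\<omega>. \<exists>j<B. relay_decision c ?C w j \<omega> \<noteq> w j \<or> dest_decision c ?C w j \<omega> \<noteq> w j} \<le> prob (\<Union>j<B. ?F w j)"
      using F by (intro finite_measure_mono) auto
    also have "\<dots> \<le> (\<Sum>j<B. prob (?F w j))" using F by (intro measure_UNION_le) auto
    also have "\<dots> \<le> (\<Sum>j<B. prob (confusion \<nu> \<gamma> n M (rel_uses n j) p (w j)) + prob (confusion \<nu> \<gamma> n M (dst_uses n j) p (w j)))"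
      by (intro sum_mono measure_Un_le confusion_measurable)
    finally show ?thesis .
  qed
  then show ?thesis
    unfolding error_prob_def C by (intro divide_right_mono sum_mono) auto
qed

lemma sum_use_means:
  "(\<Sum>a\<in>{..<n} \<times> UNIV. use_mean \<nu> (rel_uses n j) a) = real n * (real (data_len c SR) * rate SR \<nu>)"
  "(\<Sum>a\<in>{..<n} \<times> UNIV. use_mean \<nu> (dst_uses n j) a)
    = real n * (real (data_len c SD) * rate SD \<nu> + real (data_len c RD) * rate RD \<nu>)"
  by (simp_all add: sum_uses use_mean_def rel_uses_def dst_uses_def distrib_left)

text \<open>One draw of the permutations must suit both receivers in all superblocks, so the sum of
  all their error probabilities is averaged; this gives the factors \<open>B\<close> and 2, while
  \<open>2 * n\<close> counts source and relay uses. \<open>V\<close> is fixed before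
  \<open>n\<close> and \<open>M\<close>, since \<open>n\<close> will grow.\<close>

lemma exists_threshold_code:
  assumes "\<nu> > 0" and energy: "\<And>l. pilot_energy c l + real (data_len c l) * symbol_energy c l \<le> real (block_len c) * tx_power c l"
  obtains V where "\<And>B n M \<gamma> \<Delta>. B > 0 \<Longrightarrow> n > 0 \<Longrightarrow> 2 \<le> M \<Longrightarrow> (\<And>l. (16 ^ \<nu>) ^ data_len c l dvd M) \<Longrightarrow> \<Delta> > 0 \<Longrightarrow>
    \<gamma> \<le> real n * (real (data_len c SR) * rate SR \<nu>) - \<Delta> \<Longrightarrow>
    \<gamma> \<le> real n * (real (data_len c SD) * rate SD \<nu> + real (data_len c RD) * rate RD \<nu>) - \<Delta> \<Longrightarrow>
    \<exists>C. admissible_code c C \<and> num_superblocks C = B \<and> superblock_len C = n \<and> num_messages C = M \<and>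
      error_prob c C \<le> real B * (2 * (real (2 * n) * V / \<Delta>\<^sup>2 + real M * (real M / (real M - 1)) ^ (2 * n) * exp (- \<gamma>)))"
proof -
  obtain V0 where V0: "\<And>l t u. integrable \<Omega> (\<lambda>\<omega>. (word_score l \<nu> t u u \<omega>)\<^sup>2)"
    "\<And>l t u. expectation (\<lambda>\<omega>. (word_score l \<nu> t u u \<omega>)\<^sup>2) \<le> V0"
    using word_score_square_bound[of \<nu>] by metis
  define V where "V = \<bar>V0\<bar>"
  have V: "V \<ge> 0" "\<And>l t u. expectation (\<lambda>\<omega>. (word_score l \<nu> t u u \<omega>)\<^sup>2) \<le> V"
    using V0(2) by (simp_all add: V_def) (meson abs_ge_self order_trans)
  show thesis
  proof (rule that)
    fix B n M :: nat and \<gamma> \<Delta> :: real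
    assume B: "B > 0" and n: "n > 0" and M: "2 \<le> M" and dvd: "\<And>l. (16 ^ \<nu>) ^ data_len c l dvd M" and \<Delta>: "\<Delta> > 0"
      and g1: "\<gamma> \<le> real n * (real (data_len c SR) * rate SR \<nu>) - \<Delta>"
      and g2: "\<gamma> \<le> real n * (real (data_len c SD) * rate SD \<nu> + real (data_len c RD) * rate RD \<nu>) - \<Delta>"
    let ?I = "{..<n} \<times> (UNIV :: bool set)" and ?P = "{p. p permutes {..<M}}"
    let ?codes = "?I \<rightarrow>\<^sub>E ?P"
    define \<tau> where "\<tau> = real (2 * n) * V / \<Delta>\<^sup>2 + real M * (real M / (real M - 1)) ^ (2 * n) * exp (- \<gamma>)"
    have cI: "card ?I = 2 * n" by (simp add: card_cartesian_product)
    have rc: "random_coding \<Omega> ?I M (use_score \<nu> \<phi>) V (use_mean \<nu> \<phi>)"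
      if "\<And>a b x. a \<in> ?I \<Longrightarrow> b \<in> ?I \<Longrightarrow> \<phi> a = Some x \<Longrightarrow> \<phi> b = Some x \<Longrightarrow> a = b" for \<phi>
      using M assms(1) dvd that V V0(1) by (intro random_coding_uses) auto
    have rel: "(\<Sum>p\<in>?codes. prob (confusion \<nu> \<gamma> n M (rel_uses n j) p w)) \<le> real (card ?codes) * \<tau>" if "w < M" for w j
    proof -
      interpret R: random_coding \<Omega> ?I M "use_score \<nu> (rel_uses n j)" V "use_mean \<nu> (rel_uses n j)"
        by (rule rc) (auto simp: rel_uses_def split: if_splits)
      show ?thesis
        using R.decoding_error_average[OF that \<Delta>, of \<gamma>] g1 unfolding sum_use_means cI confusion_def \<tau>_def by blast
    qed
    have dst: "(\<Sum>p\<in>?codes. prob (confusion \<nu> \<gamma> n M (dst_uses n j) p w)) \<le> real (card ?codes) * \<tau>" if "w < M" for w j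
    proof -
      interpret R: random_coding \<Omega> ?I M "use_score \<nu> (dst_uses n j)" V "use_mean \<nu> (dst_uses n j)"
        by (rule rc) (auto simp: dst_uses_def split: if_splits)
      show ?thesis
        using R.decoding_error_average[OF that \<Delta>, of \<gamma>] g2 unfolding sum_use_means cI confusion_def \<tau>_def by blast
    qed
    let ?W = "{..<B} \<rightarrow>\<^sub>E {..<M}"
    have "(\<Sum>p\<in>?codes. error_prob c (threshold_code \<nu> \<gamma> B n M p))
        \<le> (\<Sum>p\<in>?codes. (\<Sum>w\<in>?W. \<Sum>j<B. prob (confusion \<nu> \<gamma> n M (rel_uses n j) p (w j))
          + prob (confusion \<nu> \<gamma> n M (dst_uses n j) p (w j))) / real M ^ B)"
      using M by (intro sum_mono error_prob_threshold_code) auto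
    also have "\<dots> = (\<Sum>w\<in>?W. \<Sum>j<B. (\<Sum>p\<in>?codes. prob (confusion \<nu> \<gamma> n M (rel_uses n j) p (w j)))
          + (\<Sum>p\<in>?codes. prob (confusion \<nu> \<gamma> n M (dst_uses n j) p (w j)))) / real M ^ B"
      unfolding sum_divide_distrib[symmetric] sum.distrib[symmetric]
      by (subst sum.swap, subst sum.swap[of _ "{..<B}"]) (rule refl)
    also have "\<dots> \<le> (\<Sum>w\<in>?W. \<Sum>j<B. real (card ?codes) * \<tau> + real (card ?codes) * \<tau>) / real M ^ B"
    proof (intro divide_right_mono sum_mono add_mono)
      fix w j assume "w \<in> ?W" "j \<in> {..<B}"
      then have "w j < M" by auto
      then show "(\<Sum>p\<in>?codes. prob (confusion \<nu> \<gamma> n M (rel_uses n j) p (w j))) \<le> real (card ?codes) * \<tau>"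
        "(\<Sum>p\<in>?codes. prob (confusion \<nu> \<gamma> n M (dst_uses n j) p (w j))) \<le> real (card ?codes) * \<tau>"
        by (intro rel dst; assumption)+
    qed simp
    also have "\<dots> = real (card ?codes) * (real B * (2 * \<tau>))"
      using M by (simp add: card_funcsetE)
    finally have avg: "(\<Sum>p\<in>?codes. error_prob c (threshold_code \<nu> \<gamma> B n M p)) \<le> real (card ?codes) * (real B * (2 * \<tau>))" .
    have "finite ?codes" by (intro finite_PiE) (auto simp: finite_permutations)
    moreover have "?codes \<noteq> {}" by (auto simp: PiE_eq_empty_iff intro!: exI[of _ id] permutes_id)
    ultimately obtain p where p: "p \<in> ?codes" "error_prob c (threshold_code \<nu> \<gamma> B n M p) \<le> real B * (2 * \<tau>)"
      using exists_le_average[OF _ _ avg] by blast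
    have perm: "p a permutes {..<M}" if "a \<in> ?I" for a using p(1) that by (auto simp: PiE_iff)
    have "admissible_code c (threshold_code \<nu> \<gamma> B n M p)"
      using B n M assms dvd perm by (intro admissible_threshold_code) auto
    then show "\<exists>C. admissible_code c C \<and> num_superblocks C = B \<and> superblock_len C = n \<and> num_messages C = M \<and>
      error_prob c C \<le> real B * (2 * (real (2 * n) * V / \<Delta>\<^sup>2 + real M * (real M / (real M - 1)) ^ (2 * n) * exp (- \<gamma>)))"
      using p(2) unfolding \<tau>_def by (intro exI[of _ "threshold_code \<nu> \<gamma> B n M p"]) (simp add: threshold_code_def Let_def)
  qed
qed

end

section \<open>Achievability\<close>

lemma scaleR_measurable_CN: "(\<lambda>z. x *\<^sub>R z) \<in> CN \<mu> v \<rightarrow>\<^sub>M borel"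
  by measurable

lemma ln_snr_measurable:
  fixes x y :: real
  assumes "sets M = sets borel"
  shows "(\<lambda>z. ln (1 + (cmod z)\<^sup>2 * x / y)) \<in> borel_measurable M"
    "(\<lambda>z. ln (1 + x * (cmod z)\<^sup>2)) \<in> borel_measurable M"
  unfolding measurable_cong_sets[OF assms refl] by measurable

context training_channel
begin

lemma capacity_integrable:
  "integrable (CN 0 (est_var l)) (\<lambda>g. ln (1 + (cmod g)\<^sup>2 * symbol_energy c l / eff_noise l))"
  by (rule est_expectation(2)[where A=0 and B="symbol_energy c l / eff_noise l"])
    (use ln_snr_bounds[of "symbol_energy c l" _ l] symbol_pos[of l] in auto)

text \<open>Makes the exponent of the number of messages positive, on which
  \<open>pairwise_loss_le\<close> rests. Otherwise the estimate would vanish almost surely, against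
  its positive variance.\<close>

lemma capacity_pos: "capacity l > 0"
proof -
  let ?f = "\<lambda>g. ln (1 + (cmod g)\<^sup>2 * symbol_energy c l / eff_noise l)"
  have nn: "0 \<le> ?f g" for g using ln_snr_bounds(1)[of "symbol_energy c l" g l] symbol_pos[of l] by simp
  have "capacity l \<noteq> 0"
  proof
    assume "capacity l = 0"
    then have "AE g in CN 0 (est_var l). ?f g = 0"
      using integral_nonneg_eq_0_iff_AE[OF capacity_integrable[of l]] nn by (simp add: capacity_def)
    then have "AE g in CN 0 (est_var l). (cmod g)\<^sup>2 = 0"
    proof eventually_elim
      case (elim g)
      have "0 \<le> (cmod g)\<^sup>2 * symbol_energy c l / eff_noise l"
        using symbol_pos[of l] eff_noise_pos[of l] by simp
      then have "1 + (cmod g)\<^sup>2 * symbol_energy c l / eff_noise l = 1"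
        using elim by (subst (asm) ln_eq_zero_iff) auto
      then show ?case using symbol_pos[of l] eff_noise_pos[of l] by simp
    qed
    then have "(LINT g|CN 0 (est_var l). (cmod g)\<^sup>2) = (LINT g|CN 0 (est_var l). 0)"
      by (intro integral_cong_AE) (simp_all add: measurable_cong_sets[OF sets_CN refl])
    then show False
      using has_bochner_integral_integral_eq[OF CN_square[OF est_var_pos[of l]]] est_var_pos[of l] by simp
  qed
  moreover have "0 \<le> capacity l" unfolding capacity_def using nn by (intro integral_nonneg_AE) simp
  ultimately show ?thesis by simp
qed

lemma capacity_standard:
  "capacity l = (LINT z|CN 0 1. ln (1 + est_var l * symbol_energy c l / eff_noise l * (cmod z)\<^sup>2))"
proof -
  have "CN 0 (est_var l) = distr (CN 0 1) borel (\<lambda>z. sqrt (est_var l) *\<^sub>R z)"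
    using distr_CN_scaleR[of 1 "sqrt (est_var l)"] est_var_pos[of l] by simp
  then have "capacity l = (LINT g|distr (CN 0 1) borel (\<lambda>z. sqrt (est_var l) *\<^sub>R z).
      ln (1 + (cmod g)\<^sup>2 * symbol_energy c l / eff_noise l))"
    by (simp only: capacity_def)
  also have "\<dots> = (LINT z|CN 0 1. ln (1 + (cmod (sqrt (est_var l) *\<^sub>R z))\<^sup>2 * symbol_energy c l / eff_noise l))"
    by (rule integral_distr[OF scaleR_measurable_CN ln_snr_measurable(1)]) (rule refl)
  also have "\<dots> = (LINT z|CN 0 1. ln (1 + est_var l * symbol_energy c l / eff_noise l * (cmod z)\<^sup>2))"
    using est_var_pos[of l] by (simp add: power_mult_distrib mult_ac)
  finally show ?thesis .
qed

lemma standard_integrable: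
  "integrable (CN 0 1) (\<lambda>z. ln (1 + est_var l * symbol_energy c l / eff_noise l * (cmod z)\<^sup>2))"
proof (rule Bochner_Integration.integrable_bound)
  let ?r = "est_var l * symbol_energy c l / eff_noise l"
  have r: "?r \<ge> 0" using est_var_pos[of l] symbol_pos[of l] eff_noise_pos[of l] by simp
  show "integrable (CN 0 1) (\<lambda>z. ?r * (cmod z)\<^sup>2)"
    using CN_square[of 1] by (intro integrable_mult_right) (simp add: has_bochner_integral_iff)
  have "norm (ln (1 + x)) \<le> norm x" if "0 \<le> x" for x :: real
    using ln_add_one_self_le_self[OF that] that by simp
  from this[OF mult_nonneg_nonneg[OF r zero_le_power2]]
  show "AE z in CN 0 1. norm (ln (1 + ?r * (cmod z)\<^sup>2)) \<le> norm (?r * (cmod z)\<^sup>2)" by simp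
qed (intro ln_snr_measurable sets_CN)

section \<open>Choice of parameters and the limit of many blocks\<close>

lemma rates_close_to_capacity:
  fixes \<kappa> :: real
  assumes "\<kappa> > 0"
  defines "I \<equiv> min (real (data_len c SR) * capacity SR) (real (data_len c SD) * capacity SD + real (data_len c RD) * capacity RD)"
  shows "\<exists>\<nu>>0. I - \<kappa> \<le> real (data_len c SR) * rate SR \<nu> \<and>
    I - \<kappa> \<le> real (data_len c SD) * rate SD \<nu> + real (data_len c RD) * rate RD \<nu>"
proof -
  let ?K = "\<lambda>l. real (data_len c l)"
  \<comment> \<open>Shares \<open>\<kappa>\<close> among the three links; the \<open>+ 1\<close>
    keeps the denominator positive.\<close>
  define e where "e = \<kappa> / (?K SR + ?K SD + ?K RD + 1)"
  have e: "e > 0" using assms by (simp add: e_def add_nonneg_pos)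
  have eK: "?K SR * e + ?K SD * e + ?K RD * e \<le> \<kappa>"
  proof -
    have "(?K SR + ?K SD + ?K RD + 1) * e = \<kappa>" by (simp add: e_def add_nonneg_eq_0_iff)
    then show ?thesis using e by (simp add: distrib_right)
  qed
  have "\<forall>\<^sub>F \<nu> in sequentially. \<nu> > 0 \<and> capacity SR - e < rate SR \<nu> \<and> capacity SD - e < rate SD \<nu> \<and> capacity RD - e < rate RD \<nu>"
    using rate_eventually[OF e] eventually_gt_at_top[of 0] by (intro eventually_conj)
  then obtain \<nu> where \<nu>: "\<nu> > 0" "capacity SR - e < rate SR \<nu>" "capacity SD - e < rate SD \<nu>" "capacity RD - e < rate RD \<nu>"
    by (auto simp: eventually_sequentially)
  have "?K l * capacity l - ?K l * e \<le> ?K l * rate l \<nu>" if "capacity l - e < rate l \<nu>" for l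
    using mult_left_mono[of "capacity l - e" "rate l \<nu>" "?K l"] that by (simp add: right_diff_distrib)
  from this[OF \<nu>(2)] this[OF \<nu>(3)] this[OF \<nu>(4)] have
    "?K SR * capacity SR - ?K SR * e \<le> ?K SR * rate SR \<nu>"
    "?K SD * capacity SD - ?K SD * e \<le> ?K SD * rate SD \<nu>"
    "?K RD * capacity RD - ?K RD * e \<le> ?K RD * rate RD \<nu>" .
  moreover have "0 \<le> ?K SR * e" "0 \<le> ?K SD * e" "0 \<le> ?K RD * e" using e by simp_all
  moreover have "I \<le> ?K SR * capacity SR" "I \<le> ?K SD * capacity SD + ?K RD * capacity RD" by (simp_all add: I_def)
  ultimately have "I - \<kappa> \<le> ?K SR * rate SR \<nu>" "I - \<kappa> \<le> ?K SD * rate SD \<nu> + ?K RD * rate RD \<nu>"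
    using eK by linarith+
  then show ?thesis using \<nu>(1) by blast
qed

text \<open>Permutations instead of independent draws cost \<open>M / (M - 1)\<close> at each of
  \<open>2 * n\<close> uses. As \<open>M\<close> grows exponentially in \<open>n\<close>, even the
  crude \<open>M - 1 \<ge> n * \<rho>\<close> keeps the product bounded.\<close>

lemma pairwise_loss_le:
  fixes M \<rho> :: real
  assumes "\<rho> > 0" "n > 0" "exp (real n * \<rho>) \<le> M"
  shows "(M / (M - 1)) ^ (2 * n) \<le> exp (2 / \<rho>)"
proof -
  have np: "real n * \<rho> > 0" using assms by simp
  have M: "real n * \<rho> \<le> M - 1" using exp_ge_add_one_self[of "real n * \<rho>"] assms(3) by linarith
  then have M1: "M - 1 > 0" using np by linarith
  have "M / (M - 1) = 1 + 1 / (M - 1)" using M1 by (simp add: field_simps)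
  also have "\<dots> \<le> exp (1 / (M - 1))" by (rule exp_ge_add_one_self)
  finally have "(M / (M - 1)) ^ (2 * n) \<le> exp (1 / (M - 1)) ^ (2 * n)" using M1 by (intro power_mono) auto
  also have "\<dots> = exp (real (2 * n) * (1 / (M - 1)))" by (rule exp_of_nat_mult[symmetric])
  also have "\<dots> \<le> exp (2 / \<rho>)"
  proof -
    have "real (2 * n) * (1 / (M - 1)) \<le> 2 * real n / (real n * \<rho>)"
      using divide_left_mono[OF M, of "2 * real n"] M1 np by simp
    also have "\<dots> = 2 / \<rho>" using assms by simp
    finally show ?thesis by simp
  qed
  finally show ?thesis .
qed

theorem df_achievable_capacity:
  fixes b :: real
  assumes b: "b > 1" and block: "block_len c > 0"
    and len: "data_len c SR > 0"
    and energy: "\<And>l. pilot_energy c l + real (data_len c l) * symbol_energy c l \<le> real (block_len c) * tx_power c l"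
  defines "I \<equiv> min (real (data_len c SR) * capacity SR) (real (data_len c SD) * capacity SD + real (data_len c RD) * capacity RD)"
  shows "df_achievable b c (I / (real (block_len c) * ln b))"
  unfolding df_achievable_def
proof (intro allI impI)
  fix \<eta> \<epsilon> :: real
  assume \<eta>: "\<eta> > 0" and \<epsilon>: "\<epsilon> > 0"
  define D where "D = real (block_len c) * ln b"
  have D: "D > 0" using b block by (simp add: D_def)
  have I: "I > 0"
    using capacity_pos[of SR] capacity_pos[of SD] capacity_pos[of RD] len
    by (simp add: I_def source_links add_pos_nonneg)
  \<comment> \<open>The first bound keeps \<open>\<rho>\<close> positive, the second limits the loss
    \<open>3 * \<kappa> / D\<close> of rate to \<open>\<eta> / 2\<close>; the other half is left for
    the extra superblock.\<close>
  define \<kappa> where "\<kappa> = min (I / 4) (\<eta> * D / 6)"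
  have \<kappa>: "\<kappa> > 0" "\<kappa> \<le> I / 4" "3 * \<kappa> / D \<le> \<eta> / 2"
  proof -
    show "\<kappa> > 0" "\<kappa> \<le> I / 4" using I \<eta> D by (simp_all add: \<kappa>_def)
    have "\<kappa> \<le> \<eta> * D / 6" by (simp add: \<kappa>_def)
    then show "3 * \<kappa> / D \<le> \<eta> / 2" using D by (simp add: field_simps)
  qed
  \<comment> \<open>Three margins: one for the finite constellation, one between mean score and
    threshold \<open>n * (\<rho> + \<kappa>)\<close>, one between threshold and message exponent
    \<open>n * \<rho>\<close>.\<close>
  define \<rho> where "\<rho> = I - 3 * \<kappa>"
  have \<rho>: "\<rho> > 0" using \<kappa> I by (simp add: \<rho>_def)
  obtain \<nu> where \<nu>: "\<nu> > 0" "I - \<kappa> \<le> real (data_len c SR) * rate SR \<nu>"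
    "I - \<kappa> \<le> real (data_len c SD) * rate SD \<nu> + real (data_len c RD) * rate RD \<nu>"
    using rates_close_to_capacity[OF \<kappa>(1)] unfolding I_def by blast
  show "\<exists>C. admissible_code c C \<and> I / (real (block_len c) * ln b) - \<eta> < code_rate b c C \<and> error_prob c C < \<epsilon>"
  proof (rule exists_threshold_code[OF \<nu>(1) energy], goal_cases)
    case V: (1 V)
    \<comment> \<open>Only \<open>B\<close> of \<open>B + 1\<close> superblocks bring new messages;
      this choice makes that loss smaller than \<open>\<eta> / 2\<close>.\<close>
    define B where "B = nat \<lceil>2 * I / (D * \<eta>)\<rceil>"
    have B: "I / (D * (real B + 1)) < \<eta> / 2" "B > 0"
    proof -
      have pos: "2 * I / (D * \<eta>) > 0" using I D \<eta> by simp
      then show "B > 0" by (simp add: B_def)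
      have "2 * I / (D * \<eta>) \<le> real B" using pos by (simp add: B_def)
      then have "2 * I / (D * \<eta>) < real B + 1" by simp
      then have "2 * I < (real B + 1) * (D * \<eta>)" using D \<eta> by (simp add: pos_divide_less_eq)
      then have "I < \<eta> / 2 * (D * (real B + 1))" by (simp add: algebra_simps)
      then show "I / (D * (real B + 1)) < \<eta> / 2"
        using D by (subst pos_divide_less_eq) (auto intro: mult_pos_pos add_nonneg_pos)
    qed
    \<comment> \<open>A common multiple of the numbers of words of all links; \<open>M n\<close> is
      the least multiple of it that reaches \<open>exp (n * \<rho>)\<close>.\<close>
    define Q :: nat where "Q = (16 ^ \<nu>) ^ (data_len c SR + data_len c SD + data_len c RD)"
    have Q: "Q > 0" by (simp add: Q_def)
    define M where "M n = Q * nat \<lceil>exp (real n * \<rho>) / real Q\<rceil>" for n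
    have M: "exp (real n * \<rho>) \<le> real (M n)" "real (M n) \<le> exp (real n * \<rho>) + real Q" for n
    proof -
      define x where "x = exp (real n * \<rho>) / real Q"
      have "x > 0" using Q by (simp add: x_def)
      then have "x \<le> real (nat \<lceil>x\<rceil>)" "real (nat \<lceil>x\<rceil>) \<le> x + 1" by linarith+
      then have "real Q * x \<le> real Q * real (nat \<lceil>x\<rceil>)" "real Q * real (nat \<lceil>x\<rceil>) \<le> real Q * (x + 1)"
        by (intro mult_left_mono; simp)+
      moreover have "real Q * x = exp (real n * \<rho>)" using Q by (simp add: x_def)
      ultimately show "exp (real n * \<rho>) \<le> real (M n)" "real (M n) \<le> exp (real n * \<rho>) + real Q"
        by (simp_all add: M_def x_def distrib_left)
    qed
    have dvd: "(16 ^ \<nu>) ^ data_len c l dvd M n" for l n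
    proof -
      have "(16 ^ \<nu>) ^ data_len c l dvd Q" unfolding Q_def by (rule le_imp_power_dvd) (cases l; simp)
      then show ?thesis by (simp add: M_def)
    qed
    \<comment> \<open>The first term is Chebyshev's with gap \<open>n * \<kappa>\<close>; the others
      come from \<open>M n \<le> exp (n * \<rho>) + Q\<close> times \<open>exp (- \<gamma>)\<close>,
      with the bounded pairwise loss in front.\<close>
    define g where "g n = 2 * V / \<kappa>\<^sup>2 * (1 / real n) + exp (2 / \<rho>) * (exp (- (real n * \<kappa>)) + real Q * exp (- (real n * (\<rho> + \<kappa>))))" for n
    have h1: "(\<lambda>n. 1 / real n) \<longlonglongrightarrow> 0" by real_asymp
    have h2: "(\<lambda>n. exp (- (real n * x))) \<longlonglongrightarrow> 0" if "x > 0" for x using that by real_asymp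
    have "g \<longlonglongrightarrow> 2 * V / \<kappa>\<^sup>2 * 0 + exp (2 / \<rho>) * (0 + real Q * 0)"
      unfolding g_def[abs_def]
      using \<rho> \<kappa>(1) by (intro tendsto_add tendsto_mult tendsto_const h1 h2) simp_all
    then have "(\<lambda>n. real B * (2 * g n)) \<longlonglongrightarrow> real B * (2 * 0)" by (intro tendsto_intros) simp
    then have "\<forall>\<^sub>F n in sequentially. real B * (2 * g n) < \<epsilon>" using \<epsilon> by (intro order_tendstoD) auto
    then have "\<forall>\<^sub>F n in sequentially. real B * (2 * g n) < \<epsilon> \<and> n > 0" by (intro eventually_conj eventually_gt_at_top)
    then obtain n where n: "real B * (2 * g n) < \<epsilon>" "n > 0" by (auto simp: eventually_sequentially)
    have "1 < exp (real n * \<rho>)" using n \<rho> by simp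
    then have M2: "2 \<le> M n" using M(1)[of n] by linarith
    define \<gamma> where "\<gamma> = real n * (\<rho> + \<kappa>)"
    have gap: "\<gamma> \<le> real n * R - real n * \<kappa>" if "I - \<kappa> \<le> R" for R
    proof -
      have "real n * (\<rho> + 2 * \<kappa>) \<le> real n * R" using that by (intro mult_left_mono) (simp_all add: \<rho>_def)
      then show ?thesis by (simp add: \<gamma>_def algebra_simps)
    qed
    have "real n * \<kappa> > 0" using n \<kappa> by simp
    from V[OF B(2) n(2) M2 dvd this gap[OF \<nu>(2)] gap[OF \<nu>(3)]]
    obtain C where C: "admissible_code c C" "num_superblocks C = B" "superblock_len C = n" "num_messages C = M n"
      "error_prob c C \<le> real B * (2 * (real (2 * n) * V / (real n * \<kappa>)\<^sup>2 + real (M n) * (real (M n) / (real (M n) - 1)) ^ (2 * n) * exp (- \<gamma>)))"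
      by blast
    have "real (2 * n) * V / (real n * \<kappa>)\<^sup>2 = 2 * V / \<kappa>\<^sup>2 * (1 / real n)"
      using n by (simp add: power2_eq_square)
    moreover have "real (M n) * (real (M n) / (real (M n) - 1)) ^ (2 * n) * exp (- \<gamma>)
        \<le> (exp (real n * \<rho>) + real Q) * exp (2 / \<rho>) * exp (- \<gamma>)"
      using M2 by (intro mult_right_mono mult_mono M pairwise_loss_le[OF \<rho> n(2)]) auto
    moreover have "(exp (real n * \<rho>) + real Q) * exp (2 / \<rho>) * exp (- \<gamma>)
        = exp (2 / \<rho>) * (exp (- (real n * \<kappa>)) + real Q * exp (- (real n * (\<rho> + \<kappa>))))"
    proof -
      have "exp (real n * \<rho>) * exp (- \<gamma>) = exp (- (real n * \<kappa>))"
        by (simp add: exp_add[symmetric] \<gamma>_def distrib_left)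
      then show ?thesis by (simp add: distrib_left distrib_right \<gamma>_def mult_ac)
    qed
    ultimately have "real (2 * n) * V / (real n * \<kappa>)\<^sup>2 + real (M n) * (real (M n) / (real (M n) - 1)) ^ (2 * n) * exp (- \<gamma>) \<le> g n"
      by (simp add: g_def)
    then have "error_prob c C \<le> real B * (2 * g n)"
      by (intro order_trans[OF C(5)] mult_left_mono) auto
    then have err: "error_prob c C < \<epsilon>" using n by simp
    have "I / D - \<eta> < code_rate b c C"
    proof -
      have "real n * \<rho> \<le> ln (real (M n))"
        using M(1)[of n] M2 by (subst ln_ge_iff) auto
      then have "real B * (real n * \<rho>) / ((real B + 1) * real n * D) \<le> real B * ln (real (M n)) / ((real B + 1) * real n * D)"
        using D n B(2) by (intro divide_right_mono mult_left_mono) auto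
      also have "\<dots> = code_rate b c C"
        by (simp add: code_rate_def C D_def log_def algebra_simps)
      also have "real B * (real n * \<rho>) / ((real B + 1) * real n * D) = \<rho> / D - \<rho> / (D * (real B + 1))"
      proof -
        have "(x - 1) * (y * r) / (x * y * d) = r / d - r / (d * x)" if "x \<noteq> 0" "y \<noteq> 0" "d \<noteq> 0" for x y d r :: real
          using that by (simp add: field_simps)
        from this[of "real B + 1" "real n" D \<rho>] show ?thesis using n(2) D by simp
      qed
      also have "\<rho> / D = I / D - 3 * \<kappa> / D" by (simp add: \<rho>_def diff_divide_distrib)
      finally have "I / D - 3 * \<kappa> / D - \<rho> / (D * (real B + 1)) \<le> code_rate b c C" .
      moreover have "\<rho> / (D * (real B + 1)) \<le> I / (D * (real B + 1))"
        using D \<kappa>(1) by (intro divide_right_mono) (simp_all add: \<rho>_def)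
      ultimately show ?thesis using \<kappa>(3) B(1) by linarith
    qed
    then show ?case using C(1) err unfolding D_def by blast
  qed
qed

end

section \<open>The effective signal-to-noise ratio in closed form\<close>

lemma snr_coefficient:
  fixes \<delta> m P N0 s a :: real
  assumes "0 < \<delta>" "\<delta> < 1" "2 < m" "0 < P" "0 < N0" "0 < s" "0 < a"
  defines "e \<equiv> \<delta> * m * P" and "E \<equiv> (1 - \<delta>) * m * P / ((m - 2) * a)"
  defines "V \<equiv> e * s\<^sup>2 + N0"
  shows "(sqrt e * s\<^sup>2 / V)\<^sup>2 * V * E / (s\<^sup>2 * N0 / V * E + N0)
    = (\<delta> * (1 - \<delta>) * m\<^sup>2 * P\<^sup>2 * s ^ 4 / a) / ((1 - \<delta>) * m * P * s\<^sup>2 * N0 / a + (m - 2) * (s\<^sup>2 * \<delta> * m * P + N0) * N0)"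
proof -
  define x where "x = (1 - \<delta>) * m * P / a"
  have pos: "e > 0" "V > 0" "x > 0" "m - 2 > 0" using assms by (simp_all add: e_def V_def x_def add_pos_pos)
  have E: "E = x / (m - 2)" by (simp add: E_def x_def)
  have "(sqrt e * s\<^sup>2 / V)\<^sup>2 * V * E / (s\<^sup>2 * N0 / V * E + N0)
      = (e * s ^ 4 / V * E) / (s\<^sup>2 * N0 / V * E + N0)"
    using pos by (simp add: power_mult_distrib power_divide power2_eq_square power4_eq_xxxx)
  \<comment> \<open>Multiplying through by \<open>V * (m - 2)\<close> clears the observation
    variance and the division by \<open>m - 2\<close> in \<open>E\<close>.\<close>
  also have "\<dots> = ((V * (m - 2)) * (e * s ^ 4 / V * E)) / ((V * (m - 2)) * (s\<^sup>2 * N0 / V * E + N0))"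
    using pos by simp
  also have "(V * (m - 2)) * (e * s ^ 4 / V * E) = e * s ^ 4 * x" using pos by (simp add: E)
  also have "(V * (m - 2)) * (s\<^sup>2 * N0 / V * E + N0) = s\<^sup>2 * N0 * x + (m - 2) * V * N0"
    using pos by (simp add: E distrib_left)
  also have "e * s ^ 4 * x = \<delta> * (1 - \<delta>) * m\<^sup>2 * P\<^sup>2 * s ^ 4 / a"
    by (simp add: e_def x_def power2_eq_square)
  also have "s\<^sup>2 * N0 * x + (m - 2) * V * N0
      = (1 - \<delta>) * m * P * s\<^sup>2 * N0 / a + (m - 2) * (s\<^sup>2 * \<delta> * m * P + N0) * N0"
    by (simp add: V_def e_def x_def mult_ac)
  finally show ?thesis .
qed

theorem theorem3:
  fixes m :: nat
    and \<alpha> \<delta>s \<delta>r Ps Pr N0 b :: real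
    and \<sigma> :: "link \<Rightarrow> real"
    and W :: "'w measure"
    and w :: "link \<Rightarrow> 'w \<Rightarrow> complex"
    and a1 c1 d1 :: "'w \<Rightarrow> real"
  assumes "2 < m" and "0 < \<alpha>" and "\<alpha> < 1"
    and "0 < \<delta>s" and "\<delta>s < 1" and "0 < \<delta>r" and "\<delta>r < 1"
    and "0 < Ps" and "0 < Pr" and "0 < N0"
    and "0 < \<sigma> SD" and "0 < \<sigma> SR" and "0 < \<sigma> RD"
    and "1 < b"
    and "\<alpha> * (real m - 2) \<in> \<int>" and "(1 - \<alpha>) * (real m - 2) \<in> \<int>"
    and "prob_space W"
    and "prob_space.indep_vars W (\<lambda>_. borel) w UNIV"
    and "\<And>l. distributed W lborel (w l) (\<lambda>z. ennreal (cn_density 0 1 z))"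
    and "\<And>\<omega>. a1 \<omega> =
      (\<delta>s * (1 - \<delta>s) * (real m)\<^sup>2 * Ps\<^sup>2 * \<sigma> SD ^ 4 / (1 - \<alpha>)) /
      ((1 - \<delta>s) * real m * Ps * (\<sigma> SD)\<^sup>2 * N0 / (1 - \<alpha>) +
        (real m - 2) * ((\<sigma> SD)\<^sup>2 * \<delta>s * real m * Ps + N0) * N0) * (cmod (w SD \<omega>))\<^sup>2"
    and "\<And>\<omega>. c1 \<omega> =
      (\<delta>s * (1 - \<delta>s) * (real m)\<^sup>2 * Ps\<^sup>2 * \<sigma> SR ^ 4 / (1 - \<alpha>)) /
      ((1 - \<delta>s) * real m * Ps * (\<sigma> SR)\<^sup>2 * N0 / (1 - \<alpha>) +
        (real m - 2) * ((\<sigma> SR)\<^sup>2 * \<delta>s * real m * Ps + N0) * N0) * (cmod (w SR \<omega>))\<^sup>2"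
    and "\<And>\<omega>. d1 \<omega> =
      (\<delta>r * (1 - \<delta>r) * (real m)\<^sup>2 * Pr\<^sup>2 * \<sigma> RD ^ 4 / \<alpha>) /
      ((1 - \<delta>r) * real m * Pr * (\<sigma> RD)\<^sup>2 * N0 / \<alpha> +
        (real m - 2) * ((\<sigma> RD)\<^sup>2 * \<delta>r * real m * Pr + N0) * N0) * (cmod (w RD \<omega>))\<^sup>2"
  shows "df_achievable b
    \<lparr>block_len = m, relay_duty = \<alpha>, src_train_frac = \<delta>s, rel_train_frac = \<delta>r,
     src_power = Ps, rel_power = Pr, noise_var = N0, fade_dev = \<sigma>\<rparr>
    (min (LINT \<omega>|W. (1 - \<alpha>) * (real m - 2) / real m * log b (1 + c1 \<omega>))
         (LINT \<omega>|W. (1 - \<alpha>) * (real m - 2) / real m * log b (1 + a1 \<omega>) +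
                     \<alpha> * (real m - 2) / real m * log b (1 + d1 \<omega>)))"
proof -
  define c where "c = \<lparr>block_len = m, relay_duty = \<alpha>, src_train_frac = \<delta>s, rel_train_frac = \<delta>r,
     src_power = Ps, rel_power = Pr, noise_var = N0, fade_dev = \<sigma>\<rparr>"
  have m: "real m > 2" "m > 0" using assms(1) by simp_all
  have sp: "0 < \<sigma> l" "0 < train_frac c l" "train_frac c l < 1" "0 < tx_power c l" "0 < duty c l" "duty c l < 1" for l
    using assms(2-13) by (cases l; simp add: c_def)+
  have c_simps: "block_len c = m" "noise_var c = N0" "fade_dev c = \<sigma>" by (simp_all add: c_def)
  interpret training_channel c
  proof
    show "fade_dev c l > 0" for l using sp by (simp add: c_simps)
    show "noise_var c > 0" using assms(10) by (simp add: c_simps)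
    show "pilot_energy c l > 0" for l using sp m by (simp add: pilot_energy_def c_simps)
    show "symbol_energy c l > 0" for l using sp m by (simp add: symbol_energy_def c_simps)
  qed
  \<comment> \<open>Integrality makes the floor in \<open>data_len\<close> exact, so that pilot and
    data energy add up to exactly the power budget below.\<close>
  have len: "real (data_len c l) = duty c l * (real m - 2)" for l
  proof -
    have "duty c l * (real m - 2) \<in> \<int>" using assms(15,16) by (cases l) (simp_all add: c_def)
    then obtain k where k: "duty c l * (real m - 2) = of_int k" by (auto elim: Ints_cases)
    have "0 \<le> duty c l * (real m - 2)" using sp[of l] m by (intro mult_nonneg_nonneg) auto
    then have "0 \<le> k" unfolding k by simp
    then show ?thesis by (simp add: data_len_def c_simps k)
  qed
  have energy: "pilot_energy c l + real (data_len c l) * symbol_energy c l \<le> real (block_len c) * tx_power c l" for l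
  proof -
    have "duty c l * (real m - 2) \<noteq> 0" using sp[of l] m by simp
    then have "real (data_len c l) * symbol_energy c l = (1 - train_frac c l) * real m * tx_power c l"
      by (simp add: len symbol_energy_def c_simps)
    then show ?thesis by (simp add: pilot_energy_def c_simps algebra_simps)
  qed
  have len_pos: "data_len c SR > 0"
  proof -
    have "real (data_len c SR) > 0" unfolding len using sp[of SR] m by simp
    then show ?thesis by simp
  qed
  \<comment> \<open>Coefficient of \<open>(cmod (w l \<omega>))\<^sup>2\<close> in
    \<open>a1\<close>, \<open>c1\<close> and \<open>d1\<close> for the links \<open>SD\<close>,
    \<open>SR\<close> and \<open>RD\<close>.\<close>
  define r where "r l = est_var l * symbol_energy c l / eff_noise l" for l
  have r: "r l = (train_frac c l * (1 - train_frac c l) * (real m)\<^sup>2 * (tx_power c l)\<^sup>2 * \<sigma> l ^ 4 / duty c l) /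
      ((1 - train_frac c l) * real m * tx_power c l * (\<sigma> l)\<^sup>2 * N0 / duty c l +
        (real m - 2) * ((\<sigma> l)\<^sup>2 * train_frac c l * real m * tx_power c l + N0) * N0)" for l
    using snr_coefficient[of "train_frac c l" "real m" "tx_power c l" N0 "\<sigma> l" "duty c l"] sp[of l] m assms(10)
    by (simp add: r_def est_var_def gain_def eff_noise_def err_var_def obs_var_def fade_var_def pilot_energy_def symbol_energy_def c_simps)
  interpret W: prob_space W by fact
  have distr_w: "distr W borel (w l) = CN 0 1" for l
  proof -
    have "distr W borel (w l) = distr W lborel (w l)" by (intro distr_cong) auto
    then show ?thesis using distributed_distr_eq_density[OF assms(19)[of l]] by (simp add: CN_def)
  qed
  have w_meas: "w l \<in> borel_measurable W" for l
    using distributed_measurable[OF assms(19)[of l]] by simp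
  have cap: "(LINT \<omega>|W. ln (1 + r l * (cmod (w l \<omega>))\<^sup>2)) = capacity l"
    "integrable W (\<lambda>\<omega>. ln (1 + r l * (cmod (w l \<omega>))\<^sup>2))" for l
  proof -
    have f: "(\<lambda>z. ln (1 + r l * (cmod z)\<^sup>2)) \<in> borel_measurable borel" by (intro ln_snr_measurable refl)
    show "(LINT \<omega>|W. ln (1 + r l * (cmod (w l \<omega>))\<^sup>2)) = capacity l"
      using integral_distr[OF w_meas f] unfolding distr_w capacity_standard r_def by simp
    show "integrable W (\<lambda>\<omega>. ln (1 + r l * (cmod (w l \<omega>))\<^sup>2))"
      using integrable_distr_eq[OF w_meas f] standard_integrable[of l] unfolding distr_w r_def by simp
  qed
  have a1: "a1 = (\<lambda>\<omega>. r SD * (cmod (w SD \<omega>))\<^sup>2)" and c1: "c1 = (\<lambda>\<omega>. r SR * (cmod (w SR \<omega>))\<^sup>2)"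
    and d1: "d1 = (\<lambda>\<omega>. r RD * (cmod (w RD \<omega>))\<^sup>2)"
    by (rule ext, simp only: assms(20-22) r, simp add: c_def)+
  \<comment> \<open>Converts the base: each link contributes its data length times its rate in nats,
    divided by \<open>m * ln b\<close>.\<close>
  have log: "x * (real m - 2) / real m * log b y = x * (real m - 2) / (real m * ln b) * ln y" for x y
    by (simp add: log_def)
  have duties: "duty c SR = 1 - \<alpha>" "duty c SD = 1 - \<alpha>" "duty c RD = \<alpha>" by (simp_all add: c_def)
  let ?D = "real m * ln b"
  have D: "?D > 0" using m assms(14) by simp
  have "(LINT \<omega>|W. (1 - \<alpha>) * (real m - 2) / real m * log b (1 + c1 \<omega>)) = real (data_len c SR) * capacity SR / ?D"
    unfolding log c1 len duties using cap by simp
  moreover have "(LINT \<omega>|W. (1 - \<alpha>) * (real m - 2) / real m * log b (1 + a1 \<omega>) + \<alpha> * (real m - 2) / real m * log b (1 + d1 \<omega>))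
      = (real (data_len c SD) * capacity SD + real (data_len c RD) * capacity RD) / ?D"
    unfolding log a1 d1 len duties using cap by (simp add: add_divide_distrib)
  moreover have "min (x / ?D) (y / ?D) = min x y / ?D" for x y
    using D by (simp add: min_def divide_le_cancel)
  ultimately show ?thesis
    using df_achievable_capacity[OF assms(14) _ len_pos energy] m(2) unfolding c_def[symmetric] by (simp add: c_simps)
qed

end
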